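(* Let $n\ge 1$, let $\omega=(\omega_1,\dots,\omega_n)\in\mathbb{R}^n$ be diophantine with exponent $\tau$, that is, there is $\alpha>0$ with $$|\langle k,\omega\rangle|\ge \alpha|k|^{-\tau}\qquad\text{for all } 0\ne k\in\mathbb{Z}^n,$$ and let $N=\sum_{i=1}^n\omega_i\partial_i$ be the corresponding constant vector field on the torus $\mathbb{T}^n=\mathbb{R}^n/2\pi\mathbb{Z}^n$. Then for every integer $b\ge 2$ there exists $\varepsilon>0$ such that KAM applies to every perturbation $P$ of $N$ with $$\|P\|_{\tau+1,b}\le\varepsilon .$$ That is, for every real vector field $P=\sum_{0\ne k\in\mathbb{Z}^n}p_k e^{i\langle k,x\rangle}$ on $\mathbb{T}^n$ with $\|P\|_{\tau+1,b}\le\varepsilon$ there exist a constant vector field $Y\in\mathbb{R}^n$ and a $C^1$-diffeomorphism $\Psi$ of $\mathbb{T}^n$ such that $$\Psi^*(N+P-Y)=N .$$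
   Context: For $k\in\mathbb{Z}^n$, $|k|=|k_1|+\dots+|k_n|$ and $\langle k,\omega\rangle=\sum_i k_i\omega_i$. Vector fields on $\mathbb{T}^n$ are identified with $\mathbb{R}^n$-valued functions on $\mathbb{T}^n$; the Fourier coefficients $p_k\in\mathbb{C}^n$ of a real vector field satisfy $p_{-k}=\overline{p_k}$, and $|p_k|$ is the Euclidean norm. Perturbations have mean value zero ($p_0=0$). For real $r\ge 0$ and an integer $b\ge2$, $$\|P\|_{r,b}=\sum_{\nu\ge0}\Big(\sum_{b^{\nu-1}<|k|\le b^\nu}|p_k|^2|k|^{2r}\Big)^{1/2},$$ where $\nu$ runs over the nonnegative integers and $k$ over $\mathbb{Z}^n$. For a $C^1$-diffeomorphism $\Psi$ of $\mathbb{T}^n$ and a vector field $X$, the pullback is $\Psi^*X=(D\Psi)^{-1}\,(X\circ\Psi)$. Thus $\Psi^*(N+P-Y)=N$ means $(N+P-Y)\circ\Psi=D\Psi\cdot N$, i.e. $N+P-Y$ is conjugate to $N$.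
   Formalization: The case n = 1, τ < −1/2 is excluded (for n ≥ 2 diophantine forces τ ≥ n−1): there the norm with r = τ+1 < 1/2 does not control sup|P|, and narrow deep cusps give perturbations of arbitrarily small norm for which no Y and Ψ exist. *)

theory Defs
  imports "HOL-Analysis.Analysis"
begin

text \<open>
  The torus \<open>\<real>\<^sup>n / 2\<pi>\<int>\<^sup>n\<close> is treated through its universal cover \<open>real ^ 'n\<close>: vector fields on
  the torus are \<open>2\<pi>\<close>-periodic functions, and maps between tori are given by their lifts.
\<close>

definition l1norm :: "int ^ 'n \<Rightarrow> int" where
  "l1norm k = (\<Sum>i\<in>UNIV. \<bar>k $ i\<bar>)"

definition freq :: "int ^ 'n \<Rightarrow> real ^ 'n \<Rightarrow> real" where
  "freq k x = (\<Sum>i\<in>UNIV. of_int (k $ i) * x $ i)"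

definition diophantine :: "real \<Rightarrow> real ^ 'n \<Rightarrow> bool" where
  "diophantine \<tau> \<omega> \<longleftrightarrow>
     (\<exists>\<alpha>>0. \<forall>k. k \<noteq> 0 \<longrightarrow> \<bar>freq k \<omega>\<bar> \<ge> \<alpha> * of_int (l1norm k) powr (- \<tau>))"

text \<open>
  The sum of the Fourier series is unconditional, ranges over \<open>k \<noteq> 0\<close> only (mean value zero), and
  has real values; periodicity of \<open>P\<close> and \<open>p (- k) = cnj (p k)\<close> are consequences. Here \<open>*s\<close> is
  multiplication of a vector by a complex scalar.
\<close>
definition is_fourier_series :: "(real ^ 'n \<Rightarrow> real ^ 'n) \<Rightarrow> (int ^ 'n \<Rightarrow> complex ^ 'n) \<Rightarrow> bool" where
  "is_fourier_series P p \<longleftrightarrow>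
     (\<forall>x. ((\<lambda>k. exp (\<i> * complex_of_real (freq k x)) *s p k) has_sum
            (\<chi> i. complex_of_real (P x $ i))) (UNIV - {0}))"

definition shell :: "nat \<Rightarrow> nat \<Rightarrow> (int ^ 'n) set" where
  "shell b \<nu> = {k. real b powi (int \<nu> - 1) < of_int (l1norm k) \<and> of_int (l1norm k) \<le> real b ^ \<nu>}"

text \<open>
  The norm of the vector field with Fourier coefficients \<open>p\<close>; the value is \<open>\<infinity>\<close> if the series over
  the (finite) shells diverges.
\<close>
definition fourier_norm :: "real \<Rightarrow> nat \<Rightarrow> (int ^ 'n \<Rightarrow> complex ^ 'n) \<Rightarrow> ennreal" where
  "fourier_norm r b p =
     (\<Sum>\<nu>. ennreal (sqrt (\<Sum>k\<in>shell b \<nu>. (norm (p k))\<^sup>2 * of_int (l1norm k) powr (2 * r))))"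

definition period_lattice :: "(real ^ 'n) set" where
  "period_lattice = range (\<lambda>m :: int ^ 'n. \<chi> i. 2 * pi * of_int (m $ i))"

definition C1_map :: "(real ^ 'n \<Rightarrow> real ^ 'n) \<Rightarrow> bool" where
  "C1_map f \<longleftrightarrow>
     (\<exists>f' :: real ^ 'n \<Rightarrow> (real ^ 'n) \<Rightarrow>\<^sub>L (real ^ 'n).
        (\<forall>x. (f has_derivative blinfun_apply (f' x)) (at x)) \<and> continuous_on UNIV f')"

text \<open>
  The lifts of \<open>C\<^sup>1\<close>-diffeomorphisms of the torus: the lattice condition says that the map descends
  to a well-defined injective map of the quotient. Diffeomorphisms not homotopic to the identity
  are included.
\<close>
definition torus_C1_diffeo :: "(real ^ 'n \<Rightarrow> real ^ 'n) \<Rightarrow> bool" where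
  "torus_C1_diffeo \<Psi> \<longleftrightarrow>
     bij \<Psi> \<and> C1_map \<Psi> \<and> C1_map (inv \<Psi>) \<and>
     (\<forall>x y. \<Psi> x - \<Psi> y \<in> period_lattice \<longleftrightarrow> x - y \<in> period_lattice)"

definition pullback ::
  "(real ^ 'n \<Rightarrow> real ^ 'n) \<Rightarrow> (real ^ 'n \<Rightarrow> real ^ 'n) \<Rightarrow> real ^ 'n \<Rightarrow> real ^ 'n" where
  "pullback \<Psi> X x = inv (frechet_derivative \<Psi> (at x)) (X (\<Psi> x))"

definition KAM_applies :: "real ^ 'n \<Rightarrow> (real ^ 'n \<Rightarrow> real ^ 'n) \<Rightarrow> bool" where
  "KAM_applies \<omega> P \<longleftrightarrow>
     (\<exists>Y \<Psi>. torus_C1_diffeo \<Psi> \<and> pullback \<Psi> (\<lambda>x. \<omega> + P x - Y) = (\<lambda>x. \<omega>))"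

text \<open>
  The main statement assumes \<open>- 1 / 2 \<le> \<tau>\<close>. For \<open>n \<ge> 2\<close> this follows from \<open>diophantine \<tau> \<omega>\<close>, which
  forces \<open>\<tau> \<ge> n - 1\<close> by Dirichlet's theorem. For \<open>n = 1\<close> every \<open>\<omega> \<noteq> 0\<close> is diophantine with any
  exponent \<open>\<tau> \<ge> - 1\<close>, but for \<open>\<tau> < - 1 / 2\<close> the norm with \<open>r = \<tau> + 1 < 1 / 2\<close> does not control the
  sup norm and narrow high spikes are counterexamples.
\<close>

end

theory Submission
  imports Defs
begin

text \<open>
  The conjugacy is built by a quasi-Newton iteration on shrinking complex strips. If \<open>\<Psi> = id + U\<close>
  conjugates \<open>\<omega> + P - Y\<close> to \<open>\<omega>\<close> up to the error \<open>E = (\<omega> + P - Y) \<circ> \<Psi> - D\<Psi> \<omega>\<close>, let \<open>W\<close> solve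
  \<open>\<partial>\<^sub>\<omega> W = E - [E]\<close> and pass to \<open>\<Psi> \<circ> (id + W)\<close> and \<open>Y + [E]\<close>. The new error is
  \<open>(E \<circ> (id + W) - E) - (DU \<circ> (id + W)) (E - [E])\<close>, which is a small multiple of \<open>E\<close>; neither an
  inverse of \<open>D\<Psi>\<close> nor an exact choice of \<open>Y\<close> is needed. In step \<open>\<nu>\<close> the strip has width \<open>b\<^sup>-\<^sup>\<nu>\<close>, and the
  part of \<open>P\<close> with frequencies in shell \<open>\<nu>\<close>, composed with the new \<open>\<Psi>\<close>, is added to the error.

  Errors are measured in a weighted \<open>l\<^sup>2\<close> norm, displacements in weighted \<open>l\<^sup>1\<close> norms of the Fourier
  coefficients. Ruessmann's bound for the sum of \<open>\<langle>k,\<omega>\<rangle>\<^sup>-\<^sup>2\<close> over \<open>0 < |k| \<le> K\<close> by a multiple of \<open>K\<^sup>2\<^sup>\<tau>\<close> leads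
  from the former to the latter at the cost of exactly \<open>\<tau>\<close> derivatives, and the summability of the shell
  norms yields convergence in \<open>C\<^sup>1\<close>. The \<open>l\<^sup>2\<close> norm of a trigonometric polynomial composed with \<open>\<Psi>\<close> is
  controlled by averages over fine grids: rounding the images of the grid points to grid points is
  at most \<open>5\<^sup>n\<close> to one.

  A negative \<open>\<tau>\<close> forces \<open>n = 1\<close>, where \<open>\<Psi>\<^sup>-\<^sup>1\<close> is obtained by quadrature.
\<close>

text \<open>The obstacle is that regularity exactly \<tau> + 1 leaves nothing to give away.
  Narrowing the strip at scale \<open>b^-\<nu>\<close> costs \<open>b^(\<nu> (\<tau> + 1))\<close>
  in the derivative of \<open>W\<close>, which is precisely the weight of shell \<nu> in the norm.
  The rescaled errors \<open>D\<close> therefore obey only a linear recursion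
  \<open>D' = D / 2 + const * shell norm\<close>. This suffices: the sum of the \<open>D\<close> is
  bounded by the sum of the shell norms, and it controls \<open>D\<Psi> - 1\<close>. The factor 1/2
  has to beat fixed combinatorial constants and the rescaling, which is what the choice of
  \<epsilon> achieves.

  Bounding the shells of \<open>P\<close> in the sup norm would lose n/2 derivatives, hence the l2
  norm for errors. That norm is neither an algebra norm nor obviously stable under composition. So
  displacements live in the Wiener algebra, and l2 bounds of compositions go through means over real
  tori shifted in imaginary directions.

  The error formula is exact: the chain rule for \<open>\<Psi> \<circ> (id + W)\<close> cancels
  \<open>D\<Psi> \<omega>\<close> at the new point. It need only be verified on the real torus,
  since values there determine the coefficients.\<close>

definition kn :: "int ^ 'n \<Rightarrow> real" where
  "kn k = of_int (l1norm k)"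

lemma kn_eq_sum: "kn k = (\<Sum>i\<in>UNIV. \<bar>of_int (k $ i)\<bar>)"
  by (simp add: kn_def l1norm_def)

lemma kn_nonneg [simp]: "0 \<le> kn k"
  by (simp add: kn_eq_sum sum_nonneg)

lemma kn_zero [simp]: "kn 0 = 0"
  by (simp add: kn_eq_sum)

lemma kn_minus [simp]: "kn (- k) = kn k"
  by (simp add: kn_eq_sum)

lemma kn_triangle: "kn (k + l) \<le> kn k + kn l"
  unfolding kn_eq_sum sum.distrib[symmetric] by (intro sum_mono) auto

lemma comp_le_kn: "\<bar>of_int (k $ i)\<bar> \<le> kn k"
  unfolding kn_eq_sum by (rule member_le_sum) auto

lemma kn_ge_1: "k \<noteq> 0 \<Longrightarrow> 1 \<le> kn k"
proof -
  assume "k \<noteq> 0"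
  then obtain i where "k $ i \<noteq> 0" by (auto simp: vec_eq_iff)
  then have "1 \<le> \<bar>k $ i\<bar>" by auto
  then have "1 \<le> \<bar>of_int (k $ i) :: real\<bar>" by linarith
  then show ?thesis using comp_le_kn[of k i] by linarith
qed

lemma finite_vec_comp: "finite S \<Longrightarrow> finite {k :: 'a ^ 'n. \<forall>i. k $ i \<in> S}"
proof -
  assume S: "finite S"
  have "{k :: 'a ^ 'n. \<forall>i. k $ i \<in> S} \<subseteq> vec_lambda ` (UNIV \<rightarrow>\<^sub>E S)"
  proof
    fix k :: "'a ^ 'n" assume "k \<in> {k. \<forall>i. k $ i \<in> S}"
    then have "vec_nth k \<in> UNIV \<rightarrow>\<^sub>E S" by auto
    moreover have "k = vec_lambda (vec_nth k)" by simp
    ultimately show "k \<in> vec_lambda ` (UNIV \<rightarrow>\<^sub>E S)" by blast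
  qed
  moreover have "finite (UNIV \<rightarrow>\<^sub>E S :: ('n \<Rightarrow> 'a) set)"
    by (intro finite_PiE S) auto
  ultimately show ?thesis by (meson finite_imageI finite_subset)
qed

lemma finite_kn_le: "finite {k :: int ^ 'n. kn k \<le> R}"
proof (rule finite_subset)
  show "finite {k :: int ^ 'n. \<forall>i. k $ i \<in> {- \<lceil>R\<rceil>..\<lceil>R\<rceil>}}" by (intro finite_vec_comp) auto
  show "{k :: int ^ 'n. kn k \<le> R} \<subseteq> {k. \<forall>i. k $ i \<in> {- \<lceil>R\<rceil>..\<lceil>R\<rceil>}}"
  proof safe
    fix k :: "int ^ 'n" and i assume "kn k \<le> R"
    then have "\<bar>of_int (k $ i)\<bar> \<le> R" using comp_le_kn[of k i] by linarith
    then have "\<bar>k $ i\<bar> \<le> \<lceil>R\<rceil>" by linarith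
    then show "k $ i \<in> {- \<lceil>R\<rceil>..\<lceil>R\<rceil>}" by auto
  qed
qed

section \<open>Characters and their growth on complex strips\<close>

definition cfreq :: "int ^ 'n \<Rightarrow> complex ^ 'n \<Rightarrow> complex" where
  "cfreq k z = (\<Sum>i\<in>UNIV. of_int (k $ i) * z $ i)"

definition ee :: "int ^ 'n \<Rightarrow> complex ^ 'n \<Rightarrow> complex" where
  "ee k z = exp (\<i> * cfreq k z)"

definition strip :: "real \<Rightarrow> (complex ^ 'n) set" where
  "strip s = {z. \<forall>i. \<bar>Im (z $ i)\<bar> \<le> s}"

definition cvec :: "real ^ 'n \<Rightarrow> complex ^ 'n" where
  "cvec x = (\<chi> i. complex_of_real (x $ i))"

lemma cvec_nth [simp]: "cvec x $ i = complex_of_real (x $ i)"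
  by (simp add: cvec_def)

lemma cvec_add: "cvec (x + y) = cvec x + cvec y"
  by (simp add: vec_eq_iff)

lemma cvec_strip [simp]: "0 \<le> s \<Longrightarrow> cvec x \<in> strip s"
  by (simp add: strip_def)

lemma strip_mono: "s \<le> t \<Longrightarrow> strip s \<subseteq> strip t"
  unfolding strip_def by (auto intro: order.trans)

lemma cfreq_add_left: "cfreq (k + l) z = cfreq k z + cfreq l z"
  by (simp add: cfreq_def algebra_simps sum.distrib)

lemma cfreq_add_right: "cfreq k (z + w) = cfreq k z + cfreq k w"
  by (simp add: cfreq_def algebra_simps sum.distrib)

lemma cfreq_zero_left [simp]: "cfreq 0 z = 0"
  by (simp add: cfreq_def)

lemma cfreq_cvec: "cfreq k (cvec x) = complex_of_real (freq k x)"
  by (simp add: cfreq_def freq_def)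

lemma ee_add_left: "ee (k + l) z = ee k z * ee l z"
  by (simp add: ee_def cfreq_add_left algebra_simps exp_add)

lemma ee_add_right: "ee k (z + w) = ee k z * ee k w"
  by (simp add: ee_def cfreq_add_right algebra_simps exp_add)

lemma ee_zero_left [simp]: "ee 0 z = 1"
  by (simp add: ee_def)

lemma ee_cvec: "ee k (cvec x) = exp (\<i> * complex_of_real (freq k x))"
  by (simp add: ee_def cfreq_cvec)

lemma norm_ee_cvec [simp]: "norm (ee k (cvec x)) = 1"
  by (simp add: ee_cvec)

lemma norm_cfreq_le: "(\<And>i. norm (z $ i) \<le> r) \<Longrightarrow> norm (cfreq k z) \<le> r * kn k"
proof -
  assume z: "\<And>i. norm (z $ i) \<le> r"
  have "norm (cfreq k z) \<le> (\<Sum>i\<in>UNIV. norm (of_int (k $ i) * z $ i))"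
    unfolding cfreq_def by (rule norm_sum)
  also have "\<dots> \<le> (\<Sum>i\<in>UNIV. \<bar>of_int (k $ i)\<bar> * r)"
    by (intro sum_mono) (auto simp: norm_mult z mult_left_mono)
  finally show ?thesis by (simp add: kn_eq_sum sum_distrib_left mult.commute)
qed

lemma abs_freq_le: "(\<And>i. \<bar>x $ i\<bar> \<le> r) \<Longrightarrow> \<bar>freq k x\<bar> \<le> r * kn k"
  using norm_cfreq_le[of "cvec x" r k] by (simp add: cfreq_cvec)

lemma norm_ee_strip:
  assumes "z \<in> strip s" shows "norm (ee k z) \<le> exp (s * kn k)"
proof -
  have "\<bar>\<Sum>i\<in>UNIV. of_int (k $ i) * Im (z $ i)\<bar> \<le> (\<Sum>i\<in>UNIV. \<bar>of_int (k $ i)\<bar> * s)"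
    using assms by (intro order.trans[OF sum_abs] sum_mono) (auto simp: abs_mult strip_def mult_left_mono)
  then have "\<bar>\<Sum>i\<in>UNIV. of_int (k $ i) * Im (z $ i)\<bar> \<le> s * kn k"
    by (simp add: kn_eq_sum sum_distrib_left mult.commute)
  moreover have "Im (cfreq k z) = (\<Sum>i\<in>UNIV. of_int (k $ i) * Im (z $ i))"
    by (simp add: cfreq_def)
  ultimately show ?thesis by (simp add: ee_def)
qed

lemma exp_minus_1_le: "exp x - 1 \<le> x * exp x" for x :: real
  using exp_ge_add_one_self[of "- x"] mult_right_mono[of "1 - x" "exp (- x)" "exp x"]
  by (simp add: exp_minus field_simps)

lemma norm_exp_minus_1_le: "norm (exp w - 1) \<le> norm w * exp (norm w)" for w :: complex
proof -
  have "norm (exp w - 1) \<le> exp (norm w) - 1"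
  proof -
    have s: "(\<lambda>n. w ^ Suc n /\<^sub>R fact (Suc n)) sums (exp w - 1)"
      using exp_converges[of w] by (subst sums_Suc_iff) simp
    have t: "(\<lambda>n. norm w ^ Suc n /\<^sub>R fact (Suc n)) sums (exp (norm w) - 1)"
      using exp_converges[of "norm w"] by (subst sums_Suc_iff) simp
    have "norm (suminf (\<lambda>n. w ^ Suc n /\<^sub>R fact (Suc n))) \<le> suminf (\<lambda>n. norm w ^ Suc n /\<^sub>R fact (Suc n))"
      by (rule norm_suminf_le) (use t in \<open>auto simp: norm_mult norm_power sums_iff divide_inverse mult.commute\<close>)
    then show ?thesis using s t by (simp add: sums_iff)
  qed
  also have "exp (norm w) - 1 \<le> norm w * exp (norm w)" by (rule exp_minus_1_le)
  finally show ?thesis .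
qed

text \<open>A chord is no longer than its arc. As the exponential factor of the complex bound is
  absent, Lipschitz estimates on the real torus get by with strip width 0.\<close>

lemma norm_exp_imag_minus_1_le: "norm (exp (\<i> * complex_of_real t) - 1) \<le> \<bar>t\<bar>"
proof -
  have "norm (exp (\<i> * complex_of_real t) - 1) = 2 * \<bar>sin (t / 2)\<bar>"
    using dist_exp_i_1[of t] by (simp add: dist_norm)
  also have "\<dots> \<le> 2 * \<bar>t / 2\<bar>" using abs_sin_x_le_abs_x[of "t / 2"] by linarith
  finally show ?thesis by simp
qed

lemma norm_ee_diff_le:
  assumes "\<And>i. \<bar>x $ i - y $ i\<bar> \<le> r"
  shows "norm (ee k (cvec x) - ee k (cvec y)) \<le> r * kn k"
proof -
  have "ee k (cvec x) = ee k (cvec y) * ee k (cvec (x - y))"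
    by (simp flip: ee_add_right cvec_add)
  then have "norm (ee k (cvec x) - ee k (cvec y)) = norm (ee k (cvec y) * (ee k (cvec (x - y)) - 1))"
    by (simp add: algebra_simps)
  also have "\<dots> \<le> \<bar>freq k (x - y)\<bar>"
    by (simp add: norm_mult ee_cvec norm_exp_imag_minus_1_le)
  also have "\<dots> \<le> r * kn k" by (rule abs_freq_le) (use assms in auto)
  finally show ?thesis .
qed

section \<open>Weighted Wiener norms\<close>

text \<open>Bounding all finite partial sums expresses summability and the bound on the sum at once.\<close>
definition wle :: "real \<Rightarrow> real \<Rightarrow> (int ^ 'n \<Rightarrow> complex) \<Rightarrow> bool" where
  "wle s C a \<longleftrightarrow> (\<forall>F. finite F \<longrightarrow> (\<Sum>k\<in>F. norm (a k) * exp (s * kn k)) \<le> C)"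

text \<open>Stands in for the gradient: \<open>\<bar>freq k h\<bar>\<close> is at most
  \<open>kn k\<close> times the sup norm of \<open>h\<close>, so a bound on \<open>knm a\<close>
  controls every directional derivative.\<close>

definition knm :: "(int ^ 'n \<Rightarrow> complex) \<Rightarrow> int ^ 'n \<Rightarrow> complex" where
  "knm a k = complex_of_real (kn k) * a k"

definition fser :: "(int ^ 'n \<Rightarrow> complex) \<Rightarrow> complex ^ 'n \<Rightarrow> complex" where
  "fser a z = (\<Sum>\<^sub>\<infinity>k. a k * ee k z)"

lemma norm_knm [simp]: "norm (knm a k) = kn k * norm (a k)"
  by (simp add: knm_def norm_mult)

lemma bounded_sums_summable:
  fixes f :: "'a \<Rightarrow> real"
  assumes "\<And>k. k \<in> A \<Longrightarrow> 0 \<le> f k" "\<And>F. finite F \<Longrightarrow> F \<subseteq> A \<Longrightarrow> sum f F \<le> C"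
  shows "f summable_on A" "infsum f A \<le> C"
proof -
  show s: "f summable_on A"
    by (rule nonneg_bounded_partial_sums_imp_summable_on[where C = C])
       (use assms in \<open>auto intro!: eventually_finite_subsets_at_top_weakI\<close>)
  show "infsum f A \<le> C" by (rule infsum_le_finite_sums[OF s]) (use assms in auto)
qed

lemma wleD:
  assumes "wle s C a"
  shows "(\<lambda>k. norm (a k) * exp (s * kn k)) summable_on UNIV"
    and "(\<Sum>\<^sub>\<infinity>k. norm (a k) * exp (s * kn k)) \<le> C"
  using assms by (auto intro!: bounded_sums_summable simp: wle_def)

lemma wleI:
  assumes "(\<lambda>k. norm (a k) * exp (s * kn k)) summable_on UNIV"
    and "(\<Sum>\<^sub>\<infinity>k. norm (a k) * exp (s * kn k)) \<le> C"
  shows "wle s C a"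
  unfolding wle_def using finite_sum_le_infsum[OF assms(1)] assms(2)
  by (auto intro: order.trans)

lemma wle_nonneg: "wle s C a \<Longrightarrow> 0 \<le> C"
  unfolding wle_def by (auto dest: spec[of _ "{}"])

lemma wle_mono:
  fixes a :: "int ^ 'n \<Rightarrow> complex"
  assumes "wle t D b" "D \<le> C"
    and "\<And>k. norm (a k) * exp (s * kn k) \<le> norm (b k) * exp (t * kn k)"
  shows "wle s C a"
  unfolding wle_def
proof safe
  fix F :: "(int ^ 'n) set" assume "finite F"
  have "(\<Sum>k\<in>F. norm (a k) * exp (s * kn k)) \<le> (\<Sum>k\<in>F. norm (b k) * exp (t * kn k))"
    by (intro sum_mono assms)
  also have "\<dots> \<le> D" using assms(1) \<open>finite F\<close> by (auto simp: wle_def)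
  finally show "(\<Sum>k\<in>F. norm (a k) * exp (s * kn k)) \<le> C" using assms(2) by simp
qed

lemma wle_bound_mono: "wle s C a \<Longrightarrow> C \<le> D \<Longrightarrow> wle s D a"
  unfolding wle_def by (blast intro: order.trans)

lemma wle_strip_mono: "wle t C a \<Longrightarrow> s \<le> t \<Longrightarrow> wle s C a"
  by (erule wle_mono) (auto intro!: mult_left_mono mult_right_mono)

lemma wle_add:
  fixes a :: "int ^ 'n \<Rightarrow> complex"
  shows "wle s C a \<Longrightarrow> wle s D b \<Longrightarrow> wle s (C + D) (\<lambda>k. a k + b k)"
  unfolding wle_def
proof safe
  fix F :: "(int ^ 'n) set"
  assume *: "\<forall>F. finite F \<longrightarrow> (\<Sum>k\<in>F. norm (a k) * exp (s * kn k)) \<le> C"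
    "\<forall>F. finite F \<longrightarrow> (\<Sum>k\<in>F. norm (b k) * exp (s * kn k)) \<le> D" "finite F"
  have "(\<Sum>k\<in>F. norm (a k + b k) * exp (s * kn k)) \<le>
        (\<Sum>k\<in>F. norm (a k) * exp (s * kn k) + norm (b k) * exp (s * kn k))"
    by (intro sum_mono) (auto simp: norm_triangle_ineq mult_right_mono simp flip: distrib_right)
  also have "\<dots> \<le> C + D" using * by (auto simp: sum.distrib intro!: add_mono)
  finally show "(\<Sum>k\<in>F. norm (a k + b k) * exp (s * kn k)) \<le> C + D" .
qed

lemma wle_cmult: "wle s C a \<Longrightarrow> wle s (norm c * C) (\<lambda>k. c * a k)"
  unfolding wle_def
  by (auto simp: norm_mult mult.assoc sum_distrib_left[symmetric] intro!: mult_left_mono)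

text \<open>\<open>x \<le> exp x\<close> at \<open>x = (t - s) * kn k\<close>. On coefficients this
  is Cauchy's estimate: narrowing the strip by \<open>t - s\<close> buys one derivative at the price
  \<open>1 / (t - s)\<close>.\<close>

lemma kn_exp_le:
  assumes "s < t" shows "kn k * exp (s * kn k) \<le> exp (t * kn k) / (t - s)"
proof -
  have "kn k * (t - s) \<le> exp ((t - s) * kn k)"
    using exp_ge_add_one_self[of "(t - s) * kn k"] by (simp add: algebra_simps)
  then have "kn k * (t - s) * exp (s * kn k) \<le> exp ((t - s) * kn k) * exp (s * kn k)"
    by (intro mult_right_mono) auto
  also have "\<dots> = exp (t * kn k)" by (simp flip: exp_add add: algebra_simps)
  finally show ?thesis using assms by (simp add: field_simps)
qed

lemma wle_knm:
  assumes "wle t C a" "s < t" shows "wle s (C / (t - s)) (knm a)"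
proof -
  have "wle t (norm (complex_of_real (1 / (t - s))) * C) (\<lambda>k. complex_of_real (1 / (t - s)) * a k)"
    by (rule wle_cmult[OF assms(1)])
  then show ?thesis
  proof (rule wle_mono)
    have n: "norm (complex_of_real (1 / (t - s))) = 1 / (t - s)"
      using assms(2) by (simp only: norm_of_real) simp
    show "norm (complex_of_real (1 / (t - s))) * C \<le> C / (t - s)" unfolding n by simp
    fix k
    have "norm (a k) * (kn k * exp (s * kn k)) \<le> norm (a k) * (exp (t * kn k) / (t - s))"
      by (intro mult_left_mono kn_exp_le assms) auto
    then show "norm (knm a k) * exp (s * kn k) \<le> norm (complex_of_real (1 / (t - s)) * a k) * exp (t * kn k)"
      unfolding norm_mult n by (simp add: mult_ac)
  qed
qed

lemma fser_abs_summable: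
  assumes "wle s C a" "z \<in> strip s"
  shows "(\<lambda>k. norm (a k * ee k z)) summable_on A" "infsum (\<lambda>k. norm (a k * ee k z)) A \<le> C"
proof -
  have b: "(\<Sum>k\<in>F. norm (a k * ee k z)) \<le> C" if "finite F" for F
  proof -
    have "(\<Sum>k\<in>F. norm (a k * ee k z)) \<le> (\<Sum>k\<in>F. norm (a k) * exp (s * kn k))"
      by (intro sum_mono) (auto simp: norm_mult norm_ee_strip[OF assms(2)] mult_left_mono)
    also have "\<dots> \<le> C" using assms(1) that by (auto simp: wle_def)
    finally show ?thesis .
  qed
  show "(\<lambda>k. norm (a k * ee k z)) summable_on A" "infsum (\<lambda>k. norm (a k * ee k z)) A \<le> C"
    by (auto intro!: bounded_sums_summable b)
qed

lemma fser_summable: "wle s C a \<Longrightarrow> z \<in> strip s \<Longrightarrow> (\<lambda>k. a k * ee k z) summable_on A"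
  by (rule abs_summable_summable[OF fser_abs_summable(1)])

lemma norm_fser_le: "wle s C a \<Longrightarrow> z \<in> strip s \<Longrightarrow> norm (fser a z) \<le> C"
  unfolding fser_def
  by (rule order.trans[OF norm_infsum_bound fser_abs_summable(2)]) (auto intro: fser_abs_summable)

lemma fser_add:
  assumes "wle s C a" "wle s D b" "z \<in> strip s"
  shows "fser (\<lambda>k. a k + b k) z = fser a z + fser b z"
  unfolding fser_def distrib_right
  by (rule infsum_add) (use assms in \<open>auto intro: fser_summable\<close>)

lemma fser_cmult: "fser (\<lambda>k. c * a k) z = c * fser a z"
  unfolding fser_def mult.assoc by (rule infsum_cmult_right')

lemma fser_single: "fser (\<lambda>k. if k = l then c else 0) z = c * ee l z"
proof -
  have "fser (\<lambda>k. if k = l then c else 0) z = (\<Sum>\<^sub>\<infinity>k\<in>{l}. c * ee k z)"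
    unfolding fser_def by (rule infsum_cong_neutral) auto
  then show ?thesis by simp
qed

lemma wle_finite:
  fixes a :: "int ^ 'n \<Rightarrow> complex"
  assumes "finite F"
  shows "wle s (\<Sum>k\<in>F. norm (a k) * exp (s * kn k)) (\<lambda>k. if k \<in> F then a k else 0)"
  unfolding wle_def
proof safe
  fix G :: "(int ^ 'n) set" assume "finite G"
  have "(\<Sum>k\<in>G. norm (if k \<in> F then a k else 0) * exp (s * kn k)) =
        (\<Sum>k\<in>G \<inter> F. norm (a k) * exp (s * kn k))"
    using \<open>finite G\<close> by (simp add: if_distrib[of norm] if_distrib[of "\<lambda>x. x * _"] sum.inter_restrict cong: if_cong)
  also have "\<dots> \<le> (\<Sum>k\<in>F. norm (a k) * exp (s * kn k))"
    using assms by (intro sum_mono2) auto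
  finally show "(\<Sum>k\<in>G. norm (if k \<in> F then a k else 0) * exp (s * kn k)) \<le> \<dots>" .
qed

lemma fser_finite:
  assumes "finite F"
  shows "fser (\<lambda>k. if k \<in> F then a k else 0) z = (\<Sum>k\<in>F. a k * ee k z)"
proof -
  have "fser (\<lambda>k. if k \<in> F then a k else 0) z = (\<Sum>\<^sub>\<infinity>k\<in>F. a k * ee k z)"
    unfolding fser_def by (rule infsum_cong_neutral) auto
  then show ?thesis using assms by simp
qed

text \<open>Reduces statements about series to trigonometric polynomials; \<open>F0\<close> keeps
  prescribed frequencies in the finite part.\<close>

lemma wle_tail:
  fixes a :: "int ^ 'n \<Rightarrow> complex"
  assumes "wle s C a" "0 < \<eta>" "finite F0"
  obtains F where "finite F" "F0 \<subseteq> F" "wle s \<eta> (\<lambda>k. if k \<in> F then 0 else a k)"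
proof -
  let ?f = "\<lambda>k. norm (a k) * exp (s * kn k)"
  have s: "?f summable_on UNIV" by (rule wleD[OF assms(1)])
  obtain F1 where F1: "finite F1" "dist (sum ?f F1) (infsum ?f UNIV) \<le> \<eta>"
    using infsum_finite_approximation[OF s assms(2)] by auto
  define F where "F = F1 \<union> F0"
  have F: "finite F" using F1 assms by (simp add: F_def)
  have "sum ?f F1 \<le> sum ?f F" using F by (intro sum_mono2) (auto simp: F_def)
  then have Fs: "infsum ?f UNIV - \<eta> \<le> sum ?f F" using F1 by (simp add: dist_real_def)
  show ?thesis
  proof (rule that[OF F])
    show "F0 \<subseteq> F" by (simp add: F_def)
    show "wle s \<eta> (\<lambda>k. if k \<in> F then 0 else a k)"
      unfolding wle_def
    proof safe
      fix G :: "(int ^ 'n) set" assume G: "finite G"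
      have "(\<Sum>k\<in>G. norm (if k \<in> F then 0 else a k) * exp (s * kn k)) = sum ?f (G - F)"
        by (rule sum.mono_neutral_cong_right) (use G in auto)
      moreover have "sum ?f (G - F) + sum ?f F = sum ?f ((G - F) \<union> F)"
        by (rule sum.union_disjoint[symmetric]) (use F G in auto)
      moreover have "sum ?f ((G - F) \<union> F) \<le> infsum ?f UNIV"
        by (rule finite_sum_le_infsum[OF s]) (use F G in auto)
      ultimately show "(\<Sum>k\<in>G. norm (if k \<in> F then 0 else a k) * exp (s * kn k)) \<le> \<eta>"
        using Fs by linarith
    qed
  qed
qed

text \<open>\<open>C\<close> bounds the Wiener norm on the strip and \<open>D\<close> the seminorm carrying one extra derivative.\<close>
definition wn :: "real \<Rightarrow> real \<Rightarrow> real \<Rightarrow> (complex ^ 'n \<Rightarrow> complex) \<Rightarrow> bool" where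
  "wn s C D f \<longleftrightarrow> (\<exists>a. wle s C a \<and> wle s D (knm a) \<and> (\<forall>z\<in>strip s. f z = fser a z))"

lemma wn_nonneg: "wn s C D f \<Longrightarrow> 0 \<le> C" "wn s C D f \<Longrightarrow> 0 \<le> D"
  unfolding wn_def by (auto dest: wle_nonneg)

lemma wn_mono: "wn s C D f \<Longrightarrow> C \<le> C' \<Longrightarrow> D \<le> D' \<Longrightarrow> wn s C' D' f"
  unfolding wn_def by (meson order_refl wle_mono)

lemma wn_cong: "wn s C D f \<Longrightarrow> (\<And>z. z \<in> strip s \<Longrightarrow> g z = f z) \<Longrightarrow> wn s C D g"
  unfolding wn_def by auto

lemma norm_wn_le: "wn s C D f \<Longrightarrow> z \<in> strip s \<Longrightarrow> norm (f z) \<le> C"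
  unfolding wn_def using norm_fser_le by fastforce

lemma wn_fser: "wle s C a \<Longrightarrow> wle s D (knm a) \<Longrightarrow> wn s C D (fser a)"
  unfolding wn_def by auto

lemma knm_add: "knm (\<lambda>k. a k + b k) = (\<lambda>k. knm a k + knm b k)"
  by (auto simp: knm_def algebra_simps)

lemma knm_cmult: "knm (\<lambda>k. c * a k) = (\<lambda>k. c * knm a k)"
  by (auto simp: knm_def algebra_simps)

lemma wn_add:
  assumes "wn s C D f" "wn s C' D' g"
  shows "wn s (C + C') (D + D') (\<lambda>z. f z + g z)"
proof -
  obtain a b where a: "wle s C a" "wle s D (knm a)" "\<forall>z\<in>strip s. f z = fser a z"
    and b: "wle s C' b" "wle s D' (knm b)" "\<forall>z\<in>strip s. g z = fser b z"
    using assms unfolding wn_def by auto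
  show ?thesis unfolding wn_def
    by (rule exI[of _ "\<lambda>k. a k + b k"])
       (use a b in \<open>auto simp: knm_add intro: wle_add fser_add[symmetric]\<close>)
qed

lemma wn_cmult:
  assumes "wn s C D f"
  shows "wn s (norm c * C) (norm c * D) (\<lambda>z. c * f z)"
proof -
  obtain a where a: "wle s C a" "wle s D (knm a)" "\<forall>z\<in>strip s. f z = fser a z"
    using assms unfolding wn_def by auto
  show ?thesis unfolding wn_def
    by (rule exI[of _ "\<lambda>k. c * a k"])
       (use a in \<open>auto simp: knm_cmult fser_cmult intro: wle_cmult\<close>)
qed

lemma wn_zero: "wn s 0 0 (\<lambda>z. 0)"
  unfolding wn_def by (rule exI[of _ "\<lambda>k. 0"]) (auto simp: wle_def fser_def)

lemma wn_const: "wn s (norm c) 0 (\<lambda>z. c)"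
  unfolding wn_def
proof (intro exI conjI ballI)
  show "wle s (norm c) (\<lambda>k. if k = 0 then c else 0)"
    using wle_finite[of "{0}" s "\<lambda>_. c"] by simp
  show "wle s 0 (knm (\<lambda>k. if k = 0 then c else 0))"
    by (auto simp: wle_def intro!: sum_nonpos)
  show "c = fser (\<lambda>k. if k = 0 then c else 0) z" for z by (simp add: fser_single)
qed

lemma wn_sum:
  assumes "finite I" "\<And>i. i \<in> I \<Longrightarrow> wn s (C i) (D i) (f i)"
  shows "wn s (\<Sum>i\<in>I. C i) (\<Sum>i\<in>I. D i) (\<lambda>z. \<Sum>i\<in>I. f i z)"
  using assms by (induction I rule: finite_induct) (auto intro: wn_zero wn_add)

text \<open>Products, exponentials and compositions are all expanded into series of functions with
  known bounds; the exchange of the two summations is done once, here.\<close>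

lemma wn_infsum:
  fixes f :: "'i \<Rightarrow> complex ^ 'n \<Rightarrow> complex"
  assumes f: "\<And>j. j \<in> I \<Longrightarrow> wn s (C j) (D j) (f j)"
    and C: "\<And>J. finite J \<Longrightarrow> J \<subseteq> I \<Longrightarrow> sum C J \<le> Cs"
    and D: "\<And>J. finite J \<Longrightarrow> J \<subseteq> I \<Longrightarrow> sum D J \<le> Ds"
  shows "wn s Cs Ds (\<lambda>z. \<Sum>\<^sub>\<infinity>j\<in>I. f j z)"
proof -
  from f have "\<forall>j\<in>I. \<exists>a. wle s (C j) a \<and> wle s (D j) (knm a) \<and> (\<forall>z\<in>strip s. f j z = fser a z)"
    unfolding wn_def by auto
  then obtain a where a: "\<And>j. j \<in> I \<Longrightarrow> wle s (C j) (a j)" "\<And>j. j \<in> I \<Longrightarrow> wle s (D j) (knm (a j))"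
      "\<And>j z. j \<in> I \<Longrightarrow> z \<in> strip s \<Longrightarrow> f j z = fser (a j) z"
    unfolding bchoice_iff by blast
  define b where "b k = (\<Sum>\<^sub>\<infinity>j\<in>I. a j k)" for k
  have fin: "(\<Sum>j\<in>J. \<Sum>k\<in>F. norm (a j k) * exp (s * kn k)) \<le> Cs"
    "(\<Sum>j\<in>J. \<Sum>k\<in>F. norm (knm (a j) k) * exp (s * kn k)) \<le> Ds"
    if "finite J" "J \<subseteq> I" "finite F" for J F
  proof -
    have "(\<Sum>j\<in>J. \<Sum>k\<in>F. norm (a j k) * exp (s * kn k)) \<le> sum C J"
      using a(1) that by (intro sum_mono) (auto simp: wle_def)
    then show "(\<Sum>j\<in>J. \<Sum>k\<in>F. norm (a j k) * exp (s * kn k)) \<le> Cs" using C that by fastforce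
    have "(\<Sum>j\<in>J. \<Sum>k\<in>F. norm (knm (a j) k) * exp (s * kn k)) \<le> sum D J"
      using a(2) that by (intro sum_mono) (auto simp: wle_def)
    then show "(\<Sum>j\<in>J. \<Sum>k\<in>F. norm (knm (a j) k) * exp (s * kn k)) \<le> Ds" using D that by fastforce
  qed
  have aj: "(\<lambda>j. norm (a j k)) summable_on I" for k
  proof (rule bounded_sums_summable(1)[where C = "Cs / exp (s * kn k)"])
    fix J assume "finite J" "J \<subseteq> I"
    then show "(\<Sum>j\<in>J. norm (a j k)) \<le> Cs / exp (s * kn k)"
      using fin(1)[of J "{k}"] by (simp add: field_simps sum_distrib_left)
  qed auto
  have nb: "norm (b k) \<le> (\<Sum>\<^sub>\<infinity>j\<in>I. norm (a j k))" for k
    unfolding b_def by (rule norm_infsum_bound[OF aj])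
  \<comment> \<open>A general weight \<open>w\<close> serves both the norm and the seminorm with the
    extra factor \<open>kn k\<close>.\<close>
  have bw: "(\<Sum>k\<in>F. norm (b k) * w k) \<le> B"
    if w: "\<And>k. 0 \<le> w k" and F: "finite F"
      and J: "\<And>J. finite J \<Longrightarrow> J \<subseteq> I \<Longrightarrow> (\<Sum>j\<in>J. \<Sum>k\<in>F. norm (a j k) * w k) \<le> B" for w F B
  proof -
    have "(\<Sum>k\<in>F. norm (b k) * w k) \<le> (\<Sum>k\<in>F. (\<Sum>\<^sub>\<infinity>j\<in>I. norm (a j k)) * w k)"
      by (intro sum_mono mult_right_mono nb w)
    also have "\<dots> \<le> B"
    proof (rule tendsto_le[OF _ tendsto_const tendsto_sum])
      show "((\<lambda>J. (\<Sum>j\<in>J. norm (a j k)) * w k) \<longlongrightarrow> (\<Sum>\<^sub>\<infinity>j\<in>I. norm (a j k)) * w k)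
              (finite_subsets_at_top I)" for k
        by (intro tendsto_mult tendsto_const infsum_tendsto aj)
      show "\<forall>\<^sub>F J in finite_subsets_at_top I. (\<Sum>k\<in>F. (\<Sum>j\<in>J. norm (a j k)) * w k) \<le> B"
      proof (rule eventually_finite_subsets_at_top_weakI)
        fix J assume *: "finite J" "J \<subseteq> I"
        have "(\<Sum>k\<in>F. (\<Sum>j\<in>J. norm (a j k)) * w k) = (\<Sum>j\<in>J. \<Sum>k\<in>F. norm (a j k) * w k)"
          unfolding sum_distrib_right by (rule sum.swap)
        then show "(\<Sum>k\<in>F. (\<Sum>j\<in>J. norm (a j k)) * w k) \<le> B" using J[OF *] by simp
      qed
    qed simp
    finally show ?thesis .
  qed
  have "wle s Cs b" unfolding wle_def using fin(1) by (auto intro!: bw)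
  moreover have "wle s Ds (knm b)" unfolding wle_def
  proof safe
    fix F :: "(int ^ 'n) set" assume F: "finite F"
    have "(\<Sum>k\<in>F. norm (b k) * (kn k * exp (s * kn k))) \<le> Ds"
      by (rule bw) (use F fin(2) in \<open>auto simp: mult_ac\<close>)
    then show "(\<Sum>k\<in>F. norm (knm b k) * exp (s * kn k)) \<le> Ds" by (simp add: mult_ac)
  qed
  moreover have "(\<Sum>\<^sub>\<infinity>j\<in>I. f j z) = fser b z" if z: "z \<in> strip s" for z
  proof -
    \<comment> \<open>Absolute summability over pairs: a finite set of pairs is enclosed in the
      product of its projections.\<close>
    have sm: "(\<lambda>(j, k). a j k * ee k z) summable_on I \<times> UNIV"
    proof (rule abs_summable_summable, rule bounded_sums_summable(1)[where C = Cs])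
      fix G :: "('i \<times> (int ^ 'n)) set" assume G: "finite G" "G \<subseteq> I \<times> UNIV"
      have "(\<Sum>x\<in>G. norm (case x of (j, k) \<Rightarrow> a j k * ee k z)) \<le>
            (\<Sum>x\<in>fst ` G \<times> snd ` G. norm (case x of (j, k) \<Rightarrow> a j k * ee k z))"
        using G by (intro sum_mono2) (auto simp: image_iff, force+)
      also have "\<dots> = (\<Sum>j\<in>fst ` G. \<Sum>k\<in>snd ` G. norm (a j k * ee k z))"
        by (simp add: sum.cartesian_product case_prod_unfold)
      also have "\<dots> \<le> (\<Sum>j\<in>fst ` G. \<Sum>k\<in>snd ` G. norm (a j k) * exp (s * kn k))"
        by (intro sum_mono) (auto simp: norm_mult norm_ee_strip[OF z] mult_left_mono)
      also have "\<dots> \<le> Cs" using G by (intro fin) auto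
      finally show "(\<Sum>x\<in>G. norm (case x of (j, k) \<Rightarrow> a j k * ee k z)) \<le> Cs" .
    qed auto
    have "(\<Sum>\<^sub>\<infinity>j\<in>I. f j z) = (\<Sum>\<^sub>\<infinity>j\<in>I. \<Sum>\<^sub>\<infinity>k. a j k * ee k z)"
      by (intro infsum_cong) (simp add: a(3) z fser_def)
    also have "\<dots> = (\<Sum>\<^sub>\<infinity>k. \<Sum>\<^sub>\<infinity>j\<in>I. a j k * ee k z)"
      by (rule infsum_swap_banach[OF sm])
    also have "\<dots> = fser b z"
      unfolding fser_def b_def by (intro infsum_cong infsum_cmult_left') 
    finally show ?thesis .
  qed
  ultimately show ?thesis unfolding wn_def by blast
qed

section \<open>Products, powers and exponentials in the Wiener norms\<close>

lemma wn_ee: "wn s (exp (s * kn k)) (kn k * exp (s * kn k)) (ee k)"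
  unfolding wn_def
proof (intro exI conjI ballI)
  show "wle s (exp (s * kn k)) (\<lambda>l. if l \<in> {k} then 1 else 0)"
    using wle_finite[of "{k}" s "\<lambda>_. 1"] by simp
  have "wle s (kn k * exp (s * kn k)) (\<lambda>l. if l \<in> {k} then knm (\<lambda>_. 1) l else 0)"
    using wle_finite[of "{k}" s "knm (\<lambda>_. 1)"] by simp
  moreover have "knm (\<lambda>l. if l \<in> {k} then 1 else 0) = (\<lambda>l. if l \<in> {k} then knm (\<lambda>_. 1) l else 0)"
    by (auto simp: knm_def)
  ultimately show "wle s (kn k * exp (s * kn k)) (knm (\<lambda>l. if l \<in> {k} then 1 else 0))" by simp
  show "ee k z = fser (\<lambda>l. if l \<in> {k} then 1 else 0) z" for z
    by (subst fser_finite) auto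
qed

text \<open>The weight is submultiplicative by the triangle inequality for \<open>kn\<close>; this
  makes the Wiener norms algebra norms.\<close>

lemma wle_shift:
  fixes a :: "int ^ 'n \<Rightarrow> complex"
  assumes "0 \<le> s" "wle s C a"
  shows "wle s (exp (s * kn k) * C) (\<lambda>l. a (l - k))"
  unfolding wle_def
proof safe
  fix F :: "(int ^ 'n) set" assume F: "finite F"
  have "(\<Sum>l\<in>F. norm (a (l - k)) * exp (s * kn l)) \<le>
        (\<Sum>l\<in>F. exp (s * kn k) * (norm (a (l - k)) * exp (s * kn (l - k))))"
  proof (intro sum_mono)
    fix l
    have "s * kn l \<le> s * (kn k + kn (l - k))"
      using kn_triangle[of k "l - k"] assms by (intro mult_left_mono) auto
    then have "exp (s * kn l) \<le> exp (s * kn k) * exp (s * kn (l - k))"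
      by (simp add: algebra_simps flip: exp_add)
    then have "norm (a (l - k)) * exp (s * kn l) \<le> norm (a (l - k)) * (exp (s * kn k) * exp (s * kn (l - k)))"
      by (intro mult_left_mono) auto
    then show "norm (a (l - k)) * exp (s * kn l) \<le>
        exp (s * kn k) * (norm (a (l - k)) * exp (s * kn (l - k)))"
      by (simp add: mult_ac)
  qed
  also have "\<dots> = exp (s * kn k) * (\<Sum>m\<in>(\<lambda>l. l - k) ` F. norm (a m) * exp (s * kn m))"
    by (subst sum.reindex) (auto simp: inj_on_def sum_distrib_left)
  also have "\<dots> \<le> exp (s * kn k) * C"
    using assms(2) F by (intro mult_left_mono) (auto simp: wle_def)
  finally show "(\<Sum>l\<in>F. norm (a (l - k)) * exp (s * kn l)) \<le> exp (s * kn k) * C" .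
qed

text \<open>Multiplication by a character shifts the coefficients, and
  \<open>kn l \<le> kn k + kn (l - k)\<close> plays the role of the Leibniz rule.\<close>

lemma wn_ee_mult:
  fixes f :: "complex ^ 'n \<Rightarrow> complex"
  assumes "0 \<le> s" "wn s C D f"
  shows "wn s (exp (s * kn k) * C) (exp (s * kn k) * (kn k * C + D)) (\<lambda>z. ee k z * f z)"
proof -
  obtain a where a: "wle s C a" "wle s D (knm a)" "\<forall>z\<in>strip s. f z = fser a z"
    using assms(2) unfolding wn_def by auto
  show ?thesis unfolding wn_def
  proof (intro exI conjI ballI)
    show "wle s (exp (s * kn k) * C) (\<lambda>l. a (l - k))" by (rule wle_shift[OF assms(1) a(1)])
    have "wle s (norm (complex_of_real (kn k)) * (exp (s * kn k) * C) + exp (s * kn k) * D)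
       (\<lambda>l. complex_of_real (kn k) * a (l - k) + knm a (l - k))"
      by (intro wle_add wle_cmult wle_shift assms a)
    moreover have "norm (knm (\<lambda>l. a (l - k)) l) \<le> (kn k + kn (l - k)) * norm (a (l - k))" for l
      using kn_triangle[of k "l - k"] by (auto intro: mult_right_mono)
    moreover have "norm (complex_of_real (kn k) * a (l - k) + knm a (l - k)) = (kn k + kn (l - k)) * norm (a (l - k))" for l
    proof -
      have "complex_of_real (kn k) * a (l - k) + knm a (l - k) = complex_of_real (kn k + kn (l - k)) * a (l - k)"
        by (simp add: knm_def algebra_simps)
      then show ?thesis by (simp add: norm_mult del: of_real_add)
    qed
    ultimately have "norm (knm (\<lambda>l. a (l - k)) l) \<le> norm (complex_of_real (kn k) * a (l - k) + knm a (l - k))"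
      and w: "wle s (norm (complex_of_real (kn k)) * (exp (s * kn k) * C) + exp (s * kn k) * D)
       (\<lambda>l. complex_of_real (kn k) * a (l - k) + knm a (l - k))" for l by auto
    then have le: "norm (knm (\<lambda>l. a (l - k)) l) * exp (s * kn l) \<le>
        norm (complex_of_real (kn k) * a (l - k) + knm a (l - k)) * exp (s * kn l)" for l
      by (intro mult_right_mono) auto
    show "wle s (exp (s * kn k) * (kn k * C + D)) (knm (\<lambda>l. a (l - k)))"
      by (rule wle_mono[OF w _ le]) (simp add: algebra_simps)
    fix z :: "complex ^ 'n" assume z: "z \<in> strip s"
    have "bij (\<lambda>l. l - k)" by (rule bij_betw_byWitness[where f' = "\<lambda>l. l + k"]) auto
    then have "(\<Sum>\<^sub>\<infinity>l. a (l - k) * ee l z) = (\<Sum>\<^sub>\<infinity>m. a m * ee (m + k) z)"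
      using infsum_reindex_bij_betw[of "\<lambda>l. l - k" UNIV UNIV "\<lambda>m. a m * ee (m + k) z"] by simp
    also have "\<dots> = (\<Sum>\<^sub>\<infinity>m. ee k z * (a m * ee m z))"
      by (simp add: ee_add_left mult_ac)
    also have "\<dots> = ee k z * fser a z" unfolding fser_def by (rule infsum_cmult_right')
    finally show "ee k z * f z = fser (\<lambda>l. a (l - k)) z" using a(3) z by (simp add: fser_def)
  qed
qed

text \<open>Only \<open>f\<close> is expanded: the product becomes a sum of character multiples of
  \<open>g\<close>, which avoids convolutions of coefficients.\<close>

lemma wn_mult:
  fixes f :: "complex ^ 'n \<Rightarrow> complex"
  assumes s: "0 \<le> s" and f: "wn s C D f" and g: "wn s C' D' g"
  shows "wn s (C * C') (D * C' + C * D') (\<lambda>z. f z * g z)"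
proof -
  obtain a where a: "wle s C a" "wle s D (knm a)" "\<forall>z\<in>strip s. f z = fser a z"
    using f unfolding wn_def by auto
  note pos = wn_nonneg[OF g] 
  have "wn s (C * C') (D * C' + C * D') (\<lambda>z. \<Sum>\<^sub>\<infinity>k. a k * (ee k z * g z))"
  proof (rule wn_infsum)
    show "wn s (norm (a k) * (exp (s * kn k) * C')) (norm (a k) * (exp (s * kn k) * (kn k * C' + D')))
       (\<lambda>z. a k * (ee k z * g z))" for k
      by (intro wn_cmult wn_ee_mult s g)
    fix J :: "(int ^ 'n) set" assume J: "finite J"
    have 1: "(\<Sum>k\<in>J. norm (a k) * exp (s * kn k)) * X \<le> C * X" if "0 \<le> X" for X
      using a(1) J that by (intro mult_right_mono) (auto simp: wle_def)
    have 2: "(\<Sum>k\<in>J. norm (knm a k) * exp (s * kn k)) * X \<le> D * X" if "0 \<le> X" for X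
      using a(2) J that by (intro mult_right_mono) (auto simp: wle_def)
    show "(\<Sum>k\<in>J. norm (a k) * (exp (s * kn k) * C')) \<le> C * C'"
      using 1[OF pos(1)] by (simp add: sum_distrib_left mult_ac)
    have "(\<Sum>k\<in>J. norm (a k) * (exp (s * kn k) * (kn k * C' + D'))) =
      (\<Sum>k\<in>J. norm (knm a k) * exp (s * kn k)) * C' + (\<Sum>k\<in>J. norm (a k) * exp (s * kn k)) * D'"
      unfolding sum_distrib_right sum.distrib[symmetric]
      by (intro sum.cong refl) (simp add: algebra_simps)
    then show "(\<Sum>k\<in>J. norm (a k) * (exp (s * kn k) * (kn k * C' + D'))) \<le> D * C' + C * D'"
      using 1[OF pos(2)] 2[OF pos(1)] by linarith
  qed
  then show ?thesis
  proof (rule wn_cong)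
    fix z assume z: "z \<in> (strip s :: (complex ^ 'n) set)"
    have "(\<Sum>\<^sub>\<infinity>k. a k * (ee k z * g z)) = (\<Sum>\<^sub>\<infinity>k. a k * ee k z * g z)"
      by (simp add: mult_ac)
    also have "\<dots> = fser a z * g z" unfolding fser_def by (rule infsum_cmult_left')
    finally show "f z * g z = (\<Sum>\<^sub>\<infinity>k. a k * (ee k z * g z))" using a(3) z by simp
  qed
qed

text \<open>For \<open>m = 0\<close> the truncated \<open>m - 1\<close> is harmless because of the
  factor \<open>real m\<close>.\<close>

lemma wn_power:
  assumes "0 \<le> s" "wn s C D f"
  shows "wn s (C ^ m) (real m * C ^ (m - 1) * D) (\<lambda>z. f z ^ m)"
proof (induction m)
  case 0
  show ?case using wn_const[of s 1] by simp
next
  case (Suc m)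
  have "wn s (C * C ^ m) (D * C ^ m + C * (real m * C ^ (m - 1) * D)) (\<lambda>z. f z * f z ^ m)"
    by (rule wn_mult[OF assms Suc])
  moreover have "D * C ^ m + C * (real m * C ^ (m - 1) * D) = real (Suc m) * C ^ m * D"
    by (cases m) (auto simp: algebra_simps)
  ultimately show ?case by simp
qed

text \<open>Without its constant term the exponential series is of first order in \<open>C\<close>;
  this is the source of the factor \<open>\<rho>\<close> in the composition estimates.\<close>

lemma wn_exp_minus_1:
  fixes f :: "complex ^ 'n \<Rightarrow> complex"
  assumes s: "0 \<le> s" and f: "wn s C D f"
  shows "wn s (exp C - 1) (D * exp C) (\<lambda>z. exp (f z) - 1)"
proof -
  note pos = wn_nonneg[OF f]
  have sC: "(\<lambda>n. C ^ Suc n /\<^sub>R fact (Suc n)) sums (exp C - 1)"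
    using exp_converges[of C] by (subst sums_Suc_iff) simp
  have "wn s (exp C - 1) (D * exp C) (\<lambda>z. \<Sum>\<^sub>\<infinity>n\<in>UNIV. complex_of_real (1 / fact (Suc n)) * f z ^ Suc n)"
  proof (rule wn_infsum)
    show "wn s (norm (complex_of_real (1 / fact (Suc n))) * C ^ Suc n)
      (norm (complex_of_real (1 / fact (Suc n))) * (real (Suc n) * C ^ (Suc n - 1) * D))
      (\<lambda>z. complex_of_real (1 / fact (Suc n)) * f z ^ Suc n)" for n
      by (intro wn_cmult wn_power s f)
    fix J :: "nat set" assume J: "finite J"
    have n: "norm (complex_of_real (1 / fact (Suc n))) = 1 / fact (Suc n)" for n
      by (simp only: norm_of_real) simp
    have "(\<Sum>n\<in>J. C ^ Suc n /\<^sub>R fact (Suc n)) \<le> exp C - 1"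
      using sum_le_suminf[of "\<lambda>n. C ^ Suc n /\<^sub>R fact (Suc n)" J] sC J pos by (auto simp: sums_iff)
    then show "(\<Sum>n\<in>J. norm (complex_of_real (1 / fact (Suc n))) * C ^ Suc n) \<le> exp C - 1"
      unfolding n by (simp add: divide_inverse)
    have "(\<Sum>n\<in>J. C ^ n /\<^sub>R fact n) \<le> exp C"
      using sum_le_suminf[of "\<lambda>n. C ^ n /\<^sub>R fact n" J] exp_converges[of C] J pos by (auto simp: sums_iff)
    then have "D * (\<Sum>n\<in>J. C ^ n /\<^sub>R fact n) \<le> D * exp C" using pos by (intro mult_left_mono) auto
    moreover have "norm (complex_of_real (1 / fact (Suc n))) * (real (Suc n) * C ^ (Suc n - 1) * D) = D * (C ^ n /\<^sub>R fact n)" for n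
      unfolding n by (simp add: divide_simps del: of_nat_Suc)
    ultimately show "(\<Sum>n\<in>J. norm (complex_of_real (1 / fact (Suc n))) * (real (Suc n) * C ^ (Suc n - 1) * D)) \<le> D * exp C"
      by (simp only: sum_distrib_left)
  qed
  then show ?thesis
  proof (rule wn_cong)
    fix z
    let ?g = "\<lambda>n. complex_of_real (1 / fact (Suc n)) * f z ^ Suc n"
    have eq: "?g n = f z ^ Suc n /\<^sub>R fact (Suc n)" for n
      by (simp only: scaleR_conv_of_real inverse_eq_divide)
    have "?g sums (exp (f z) - 1)" unfolding eq
      using exp_converges[of "f z"] by (subst sums_Suc_iff) simp
    moreover have "summable (\<lambda>n. norm (?g n))"
    proof -
      have "summable (\<lambda>n. norm (f z ^ n /\<^sub>R fact n))" by (rule summable_norm_exp)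
      then have "summable (\<lambda>n. norm (f z ^ Suc n /\<^sub>R fact (Suc n)))"
        by (subst summable_Suc_iff[of "\<lambda>n. norm (f z ^ n /\<^sub>R fact n)"])
      then show ?thesis unfolding eq .
    qed
    ultimately have "(?g has_sum (exp (f z) - 1)) UNIV" by (intro norm_summable_imp_has_sum)
    then show "exp (f z) - 1 = (\<Sum>\<^sub>\<infinity>n\<in>UNIV. ?g n)" by (simp add: infsumI)
  qed
qed

section \<open>Composition with maps close to the identity\<close>

lemma wn_cfreq:
  assumes "\<And>i. wn s \<rho> \<delta> (W i)"
  shows "wn s (kn k * \<rho>) (kn k * \<delta>) (\<lambda>z. \<i> * cfreq k (\<chi> i. W i z))"
proof -
  have "wn s (\<Sum>i\<in>UNIV. norm (of_int (k $ i) :: complex) * \<rho>) (\<Sum>i\<in>UNIV. norm (of_int (k $ i) :: complex) * \<delta>)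
     (\<lambda>z. \<Sum>i\<in>UNIV. of_int (k $ i) * W i z)"
    by (intro wn_sum wn_cmult assms) auto
  from wn_cmult[OF this, of \<i>] show ?thesis
    by (simp add: cfreq_def kn_eq_sum sum_distrib_right)
qed

lemma wn_shift_strip:
  assumes "\<And>i. wn s \<rho> \<delta> (W i)" "z \<in> strip s"
  shows "z + (\<chi> i. W i z) \<in> strip (s + \<rho>)"
proof -
  have "\<bar>Im (z $ i + W i z)\<bar> \<le> s + \<rho>" for i
  proof -
    have "\<bar>Im (z $ i)\<bar> \<le> s" using assms(2) by (simp add: strip_def)
    then show ?thesis
      using norm_wn_le[OF assms(1)[of i] assms(2)] abs_Im_le_cmod[of "W i z"] by simp
  qed
  then show ?thesis by (simp add: strip_def)
qed

text \<open>Each coefficient is multiplied by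
  \<open>exp (\<i> * cfreq k (\<chi> i. W i z)) - 1\<close>, of size at most
  \<open>kn k * \<rho> * exp (kn k * \<rho>)\<close>. The wider strip \<open>s + \<rho>\<close>
  absorbs the exponential, one application of \<open>knm\<close> the factor \<open>kn k\<close>; the
  derivative of the difference needs a second one.\<close>

lemma wn_comp_diff:
  fixes a :: "int ^ 'n \<Rightarrow> complex"
  assumes s: "0 \<le> s" and W: "\<And>i. wn s \<rho> \<delta> (W i)"
    and a: "wle (s + \<rho>) A0 a" "wle (s + \<rho>) A1 (knm a)" "wle (s + \<rho>) A2 (knm (knm a))"
  shows "wn s (\<rho> * A1) (\<rho> * A2 + \<delta> * A1) (\<lambda>z. fser a (z + (\<chi> i. W i z)) - fser a z)"
proof -
  note pos = wn_nonneg[OF W]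
  let ?C = "\<lambda>k. norm (a k) * (exp (s * kn k) * (exp (kn k * \<rho>) - 1))"
  let ?D = "\<lambda>k. norm (a k) * (exp (s * kn k) *
      (kn k * (exp (kn k * \<rho>) - 1) + kn k * \<delta> * exp (kn k * \<rho>)))"
  have "wn s (\<rho> * A1) (\<rho> * A2 + \<delta> * A1)
    (\<lambda>z. \<Sum>\<^sub>\<infinity>k. a k * (ee k z * (exp (\<i> * cfreq k (\<chi> i. W i z)) - 1)))"
  proof (rule wn_infsum)
    show "wn s (?C k) (?D k) (\<lambda>z. a k * (ee k z * (exp (\<i> * cfreq k (\<chi> i. W i z)) - 1)))" for k
      by (intro wn_cmult wn_add wn_ee wn_ee_mult wn_exp_minus_1 wn_cfreq s W)
    fix J :: "(int ^ 'n) set" assume J: "finite J"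
    have e: "exp (kn k * \<rho>) - 1 \<le> kn k * \<rho> * exp (kn k * \<rho>)" for k :: "int ^ 'n"
      by (rule exp_minus_1_le)
    have "?C k \<le> \<rho> * (norm (knm a k) * exp ((s + \<rho>) * kn k))" for k
    proof -
      have "?C k \<le> norm (a k) * (exp (s * kn k) * (kn k * \<rho> * exp (kn k * \<rho>)))"
        by (intro mult_left_mono e) auto
      then show ?thesis by (simp add: algebra_simps exp_add)
    qed
    then have "(\<Sum>k\<in>J. ?C k) \<le> \<rho> * (\<Sum>k\<in>J. norm (knm a k) * exp ((s + \<rho>) * kn k))"
      by (simp add: sum_distrib_left sum_mono)
    also have "\<dots> \<le> \<rho> * A1" using a(2) J pos by (intro mult_left_mono) (auto simp: wle_def)
    finally show "(\<Sum>k\<in>J. ?C k) \<le> \<rho> * A1" .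
    have "?D k \<le> \<rho> * (norm (knm (knm a) k) * exp ((s + \<rho>) * kn k)) + \<delta> * (norm (knm a k) * exp ((s + \<rho>) * kn k))" for k
    proof -
      have "?D k \<le> norm (a k) * (exp (s * kn k) * (kn k * (kn k * \<rho> * exp (kn k * \<rho>)) + kn k * \<delta> * exp (kn k * \<rho>)))"
        by (intro mult_left_mono add_right_mono e) auto
      then show ?thesis by (simp add: algebra_simps exp_add)
    qed
    then have "(\<Sum>k\<in>J. ?D k) \<le> \<rho> * (\<Sum>k\<in>J. norm (knm (knm a) k) * exp ((s + \<rho>) * kn k))
       + \<delta> * (\<Sum>k\<in>J. norm (knm a k) * exp ((s + \<rho>) * kn k))"
      by (simp add: sum_distrib_left sum_mono sum.distrib[symmetric])
    also have "\<dots> \<le> \<rho> * A2 + \<delta> * A1" using a(2,3) J pos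
      by (intro add_mono mult_left_mono) (auto simp: wle_def)
    finally show "(\<Sum>k\<in>J. ?D k) \<le> \<rho> * A2 + \<delta> * A1" .
  qed
  then show ?thesis
  proof (rule wn_cong)
    fix z assume z: "z \<in> (strip s :: (complex ^ 'n) set)"
    have z': "z \<in> strip (s + \<rho>)" using z strip_mono[of s "s + \<rho>"] pos by auto
    have "fser a (z + (\<chi> i. W i z)) - fser a z =
      (\<Sum>\<^sub>\<infinity>k. a k * ee k (z + (\<chi> i. W i z)) + - (a k * ee k z))"
      unfolding fser_def diff_conv_add_uminus infsum_uminus[symmetric]
      by (rule infsum_add[symmetric])
         (auto intro!: fser_summable[OF a(1)] wn_shift_strip W z z' simp: summable_on_uminus)
    also have "\<dots> = (\<Sum>\<^sub>\<infinity>k. a k * (ee k z * (exp (\<i> * cfreq k (\<chi> i. W i z)) - 1)))"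
      by (intro infsum_cong) (simp add: ee_add_right, simp add: ee_def algebra_simps)
    finally show "fser a (z + (\<chi> i. W i z)) - fser a z = \<dots>" .
  qed
qed

lemma wn_comp:
  fixes a :: "int ^ 'n \<Rightarrow> complex"
  assumes s: "0 \<le> s" and W: "\<And>i. wn s \<rho> \<delta> (W i)"
    and a: "wle (s + \<rho>) A0 a" "wle (s + \<rho>) A1 (knm a)" "wle (s + \<rho>) A2 (knm (knm a))"
  shows "wn s (A0 + \<rho> * A1) (A1 + (\<rho> * A2 + \<delta> * A1)) (\<lambda>z. fser a (z + (\<chi> i. W i z)))"
proof -
  have "s \<le> s + \<rho>" using wn_nonneg(1)[OF W] by simp
  from wn_add[OF wn_fser[OF wle_strip_mono[OF a(1) this] wle_strip_mono[OF a(2) this]]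
      wn_comp_diff[where W = W, OF s W a]]
  show ?thesis by simp
qed

section \<open>Real restrictions of Fourier series\<close>

text \<open>Shared by real displacements, where \<open>s = 0\<close> and \<open>c\<close> is the
  distance, and complex ones, where the weight absorbs the growth of the characters.\<close>

lemma fser_diff_le:
  assumes a: "wle s A0 a" "wle s A (knm a)" and z: "z \<in> strip s" "z' \<in> strip s"
    and d: "\<And>k. norm (ee k z - ee k z') \<le> c * (kn k * exp (s * kn k))" and c: "0 \<le> c"
  shows "norm (fser a z - fser a z') \<le> c * A"
proof -
  have "((\<lambda>k. a k * ee k z - a k * ee k z') has_sum (fser a z - fser a z')) UNIV"
    unfolding fser_def diff_conv_add_uminus
    by (intro has_sum_add has_sum_uminusI has_sum_infsum fser_summable[OF a(1)] z)
  then have "(\<Sum>\<^sub>\<infinity>k. a k * ee k z - a k * ee k z') = fser a z - fser a z'" by (rule infsumI)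
  moreover have b: "(\<Sum>k\<in>F. norm (a k * ee k z - a k * ee k z')) \<le> c * A" if "finite F" for F
  proof -
    have "(\<Sum>k\<in>F. norm (a k * ee k z - a k * ee k z')) \<le> (\<Sum>k\<in>F. c * (norm (knm a k) * exp (s * kn k)))"
    proof (intro sum_mono)
      fix k
      have "norm (a k * ee k z - a k * ee k z') = norm (a k) * norm (ee k z - ee k z')"
        by (simp flip: norm_mult right_diff_distrib)
      also have "\<dots> \<le> norm (a k) * (c * (kn k * exp (s * kn k)))" by (intro mult_left_mono d) auto
      finally show "norm (a k * ee k z - a k * ee k z') \<le> c * (norm (knm a k) * exp (s * kn k))"
        by (simp add: mult_ac)
    qed
    also have "\<dots> \<le> c * A"
      using a(2) that c unfolding sum_distrib_left[symmetric] by (intro mult_left_mono) (auto simp: wle_def)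
    finally show ?thesis .
  qed
  moreover have "(\<lambda>k. norm (a k * ee k z - a k * ee k z')) summable_on UNIV"
      "(\<Sum>\<^sub>\<infinity>k. norm (a k * ee k z - a k * ee k z')) \<le> c * A"
    by (auto intro!: bounded_sums_summable b)
  ultimately show ?thesis
    using norm_infsum_bound[of "\<lambda>k. a k * ee k z - a k * ee k z'" UNIV] by simp
qed

lemma fser_lipschitz:
  assumes "wle 0 A0 a" "wle 0 A (knm a)" "\<And>i. \<bar>x $ i - y $ i\<bar> \<le> r"
  shows "norm (fser a (cvec x) - fser a (cvec y)) \<le> r * A"
proof -
  have "0 \<le> r" using assms(3) by (meson abs_ge_zero order.trans)
  then show ?thesis
    by (intro fser_diff_le[OF assms(1,2)]) (use norm_ee_diff_le[OF assms(3)] in auto)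
qed

lemma fser_imag_diff:
  assumes "wle s A0 a" "wle s A (knm a)" "\<And>i. norm (w $ i) \<le> s"
  shows "norm (fser a (cvec x + w) - fser a (cvec x)) \<le> s * A"
proof (rule fser_diff_le[OF assms(1,2)])
  show s: "0 \<le> s" using assms(3) by (meson norm_ge_zero order.trans)
  show "cvec x \<in> strip s" using s by simp
  show "cvec x + w \<in> strip s"
    using assms(3) order.trans[OF abs_Im_le_cmod] by (simp add: strip_def)
  fix k
  have n: "norm (cfreq k w) \<le> s * kn k" by (rule norm_cfreq_le[OF assms(3)])
  have "norm (ee k (cvec x + w) - ee k (cvec x)) = norm (ee k (cvec x) * (exp (\<i> * cfreq k w) - 1))"
    by (simp add: ee_add_right right_diff_distrib) (simp add: ee_def)
  also have "\<dots> \<le> norm (cfreq k w) * exp (norm (cfreq k w))"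
    using norm_exp_minus_1_le[of "\<i> * cfreq k w"] by (simp add: norm_mult)
  also have "\<dots> \<le> s * kn k * exp (s * kn k)" using n s by (intro mult_mono) auto
  finally show "norm (ee k (cvec x + w) - ee k (cvec x)) \<le> s * (kn k * exp (s * kn k))" by simp
qed

lemma ee_periodic:
  assumes "v \<in> period_lattice" shows "ee k (cvec (x + v)) = ee k (cvec x)"
proof -
  obtain m :: "int ^ 'a" where m: "v = (\<chi> i. 2 * pi * of_int (m $ i))"
    using assms by (auto simp: period_lattice_def)
  have "freq k v = 2 * pi * of_int (\<Sum>i\<in>UNIV. k $ i * m $ i)"
    by (simp add: freq_def m sum_distrib_left mult_ac)
  then have "ee k (cvec v) = 1"
    using exp_integer_2pi[of "of_int (\<Sum>i\<in>UNIV. k $ i * m $ i)"]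
    by (simp add: ee_cvec mult_ac Ints_sum)
  then show ?thesis by (simp add: cvec_add ee_add_right)
qed

lemma fser_periodic: "v \<in> period_lattice \<Longrightarrow> fser a (cvec (x + v)) = fser a (cvec x)"
  by (simp add: fser_def ee_periodic)

lemma wle_restrict: "wle s C a \<Longrightarrow> wle s C (\<lambda>k. if k \<in> F then a k else 0)"
  by (erule wle_mono) auto

lemma fser_split:
  assumes "wle s C a" "finite F" "z \<in> strip s"
  shows "fser a z = (\<Sum>k\<in>F. a k * ee k z) + fser (\<lambda>k. if k \<in> F then 0 else a k) z"
proof -
  have 1: "wle s C (\<lambda>k. if k \<in> F then a k else 0)" by (rule wle_restrict[OF assms(1)])
  have 2: "wle s C (\<lambda>k. if k \<in> F then 0 else a k)" by (rule wle_mono[OF assms(1)]) auto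
  have "fser a z = fser (\<lambda>k. (if k \<in> F then a k else 0) + (if k \<in> F then 0 else a k)) z"
    by (rule arg_cong2[of _ _ _ _ fser]) auto
  then show ?thesis using fser_add[OF 1 2 assms(3)] by (simp add: fser_finite assms(2))
qed

lemma continuous_on_uniform_approx:
  fixes f :: "'a::metric_space \<Rightarrow> 'b::metric_space"
  assumes "\<And>\<eta>. 0 < \<eta> \<Longrightarrow> \<exists>g. continuous_on UNIV g \<and> (\<forall>x. dist (f x) (g x) \<le> \<eta>)"
  shows "continuous_on UNIV f"
  unfolding continuous_on_iff
proof (intro ballI allI impI)
  fix x and e :: real assume "0 < e"
  obtain g where g: "continuous_on UNIV g" "\<And>x. dist (f x) (g x) \<le> e / 4"
    using assms[of "e / 4"] \<open>0 < e\<close> by auto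
  obtain d where d: "0 < d" "\<And>y. dist y x < d \<Longrightarrow> dist (g y) (g x) < e / 4"
    using g(1) \<open>0 < e\<close> unfolding continuous_on_iff by (metis UNIV_I divide_pos_pos zero_less_numeral)
  have "dist (f y) (f x) < e" if "dist y x < d" for y
    using d(2)[OF that] g(2)[of x] g(2)[of y] dist_triangle[of "f y" "f x" "g y"]
      dist_triangle[of "g y" "f x" "g x"] dist_commute[of "f x" "g x"] \<open>0 < e\<close> by linarith
  then show "\<exists>d>0. \<forall>y\<in>UNIV. dist y x < d \<longrightarrow> dist (f y) (f x) < e" using d(1) by auto
qed

section \<open>Continuity and derivatives on the real torus\<close>

lemma bounded_linear_freq: "bounded_linear (freq k)"
  unfolding freq_def
  by (intro bounded_linear_sum bounded_linear_const_mult bounded_linear_vec_nth)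

lemma ee_cvec_has_derivative:
  "((\<lambda>x. ee k (cvec x)) has_derivative (\<lambda>h. \<i> * complex_of_real (freq k h) * ee k (cvec x))) (at x)"
proof -
  have 1: "((\<lambda>x. \<i> * complex_of_real (freq k x)) has_derivative (\<lambda>h. \<i> * complex_of_real (freq k h))) (at x)"
    by (intro bounded_linear_imp_has_derivative bounded_linear_const_mult
        bounded_linear_compose[OF bounded_linear_of_real bounded_linear_freq])
  have 2: "(exp has_derivative (\<lambda>h. exp (\<i> * complex_of_real (freq k x)) * h)) (at (\<i> * complex_of_real (freq k x)))"
    using DERIV_exp has_field_derivative_def by blast
  show ?thesis unfolding ee_cvec
    using has_derivative_compose[OF 1 2] by (simp add: mult_ac)
qed

lemma continuous_on_ee_cvec: "continuous_on S (\<lambda>x. ee k (cvec x))"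
  by (intro continuous_at_imp_continuous_on ballI) (rule has_derivative_continuous[OF ee_cvec_has_derivative])

lemma continuous_on_fser:
  assumes "wle 0 A a" shows "continuous_on UNIV (\<lambda>x. fser a (cvec x))"
proof (rule continuous_on_uniform_approx)
  fix \<eta> :: real assume \<eta>: "0 < \<eta>"
  obtain F where F: "finite F" "wle 0 \<eta> (\<lambda>k. if k \<in> F then 0 else a k)"
    by (rule wle_tail[OF assms \<eta>, of "{}"]) auto
  show "\<exists>g. continuous_on UNIV g \<and> (\<forall>x. dist (fser a (cvec x)) (g x) \<le> \<eta>)"
  proof (intro exI conjI allI)
    show "continuous_on UNIV (\<lambda>x. \<Sum>k\<in>F. a k * ee k (cvec x))"
      by (intro continuous_intros continuous_on_ee_cvec)
    show "dist (fser a (cvec x)) (\<Sum>k\<in>F. a k * ee k (cvec x)) \<le> \<eta>" for x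
      using fser_split[OF assms F(1), of "cvec x"] norm_fser_le[OF F(2), of "cvec x"]
      by (simp add: dist_norm)
  qed
qed

definition dcoef :: "real ^ 'n \<Rightarrow> (int ^ 'n \<Rightarrow> complex) \<Rightarrow> int ^ 'n \<Rightarrow> complex" where
  "dcoef h a k = \<i> * complex_of_real (freq k h) * a k"

lemma wle_dcoef:
  assumes "wle s A (knm a)" "\<And>i. \<bar>h $ i\<bar> \<le> r"
  shows "wle s (r * A) (dcoef h a)"
proof -
  have r: "0 \<le> r" using assms(2) by (meson abs_ge_zero order.trans)
  have "wle s (norm (complex_of_real r) * A) (\<lambda>k. complex_of_real r * knm a k)" by (rule wle_cmult[OF assms(1)])
  then show ?thesis
  proof (rule wle_mono)
    show "norm (complex_of_real r) * A \<le> r * A" using r by simp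
    fix k
    have "\<bar>freq k h\<bar> \<le> r * kn k" by (rule abs_freq_le[OF assms(2)])
    then show "norm (dcoef h a k) * exp (s * kn k) \<le> norm (complex_of_real r * knm a k) * exp (s * kn k)"
      using r by (auto simp: dcoef_def norm_mult mult.assoc[symmetric] intro!: mult_right_mono)
  qed
qed

lemma abs_component_le: "\<bar>h $ i\<bar> \<le> norm h" for h :: "real ^ 'n"
  by (metis component_le_norm_cart)

lemma dcoef_linear: "dcoef (h + h') a = (\<lambda>k. dcoef h a k + dcoef h' a k)"
    "dcoef (c *\<^sub>R h) a = (\<lambda>k. complex_of_real c * dcoef h a k)"
  by (auto simp: dcoef_def freq_def algebra_simps sum.distrib sum_distrib_left)

lemma bounded_linear_fser_dcoef:
  assumes "wle s A (knm a)" "z \<in> strip s"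
  shows "bounded_linear (\<lambda>h. fser (dcoef h a) z)"
proof (rule bounded_linear_intro)
  show "fser (dcoef (h + h') a) z = fser (dcoef h a) z + fser (dcoef h' a) z" for h h'
    unfolding dcoef_linear by (rule fser_add) (use assms in \<open>auto intro: wle_dcoef abs_component_le\<close>)
  show "fser (dcoef (c *\<^sub>R h) a) z = c *\<^sub>R fser (dcoef h a) z" for c h
    unfolding dcoef_linear fser_cmult by (simp add: scaleR_conv_of_real)
  show "norm (fser (dcoef h a) z) \<le> norm h * A" for h
    by (rule norm_fser_le[OF wle_dcoef[OF assms(1)] assms(2)]) (rule abs_component_le)
qed

text \<open>The finite part is differentiable; for the tail both the increment and the linear part
  are at most \<open>e / 4\<close> times the displacement, because \<open>knm\<close> of the tail is
  small.\<close>

lemma fser_has_derivative: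
  assumes a: "wle 0 A0 a" "wle 0 A (knm a)"
  shows "((\<lambda>x. fser a (cvec x)) has_derivative (\<lambda>h. fser (dcoef h a) (cvec x))) (at x)"
  unfolding has_derivative_at_alt
proof (intro conjI allI impI)
  show "bounded_linear (\<lambda>h. fser (dcoef h a) (cvec x))"
    by (rule bounded_linear_fser_dcoef[OF a(2)]) simp
  fix e :: real assume e: "0 < e"
  obtain F where F: "finite F" "wle 0 (e / 4) (\<lambda>k. if k \<in> F then 0 else knm a k)"
    by (rule wle_tail[OF a(2), of "e / 4" "{}"]) (use e in auto)
  define t where "t = (\<lambda>k. if k \<in> F then 0 else a k)"
  have t: "wle 0 A0 t" "wle 0 (e / 4) (knm t)"
    using wle_mono[OF a(1) order_refl, of t 0] wle_mono[OF F(2) order_refl, of "knm t" 0]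
    by (auto simp: t_def)
  have "((\<lambda>x. \<Sum>k\<in>F. a k * ee k (cvec x)) has_derivative
      (\<lambda>h. \<Sum>k\<in>F. a k * (\<i> * complex_of_real (freq k h) * ee k (cvec x)))) (at x)"
    by (intro has_derivative_sum has_derivative_mult_right ee_cvec_has_derivative)
  then obtain d where d: "0 < d" "\<And>y. norm (y - x) < d \<Longrightarrow>
     norm ((\<Sum>k\<in>F. a k * ee k (cvec y)) - (\<Sum>k\<in>F. a k * ee k (cvec x)) -
       (\<Sum>k\<in>F. a k * (\<i> * complex_of_real (freq k (y - x)) * ee k (cvec x)))) \<le> e / 4 * norm (y - x)"
    unfolding has_derivative_at_alt using e by (meson divide_pos_pos zero_less_numeral)
  show "\<exists>d>0. \<forall>y. norm (y - x) < d \<longrightarrow>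
     norm (fser a (cvec y) - fser a (cvec x) - fser (dcoef (y - x) a) (cvec x)) \<le> e * norm (y - x)"
  proof (rule exI[of _ d], intro conjI allI impI)
    show "0 < d" by (rule d(1))
    fix y assume y: "norm (y - x) < d"
    let ?A = "(\<Sum>k\<in>F. a k * ee k (cvec y)) - (\<Sum>k\<in>F. a k * ee k (cvec x)) -
       (\<Sum>k\<in>F. a k * (\<i> * complex_of_real (freq k (y - x)) * ee k (cvec x)))"
    have "fser (dcoef (y - x) a) (cvec x) = (\<Sum>k\<in>F. dcoef (y - x) a k * ee k (cvec x)) + fser (dcoef (y - x) t) (cvec x)"
    proof -
      have "(\<lambda>k. if k \<in> F then 0 else dcoef (y - x) a k) = dcoef (y - x) t"
        by (auto simp: dcoef_def t_def)
      then show ?thesis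
        using fser_split[OF wle_dcoef[OF a(2) abs_component_le] F(1), of "cvec x" "y - x"] by simp
    qed
    moreover have "fser a (cvec z) = (\<Sum>k\<in>F. a k * ee k (cvec z)) + fser t (cvec z)" for z
      using fser_split[OF a(1) F(1), of "cvec z"] by (simp add: t_def)
    ultimately have E: "fser a (cvec y) - fser a (cvec x) - fser (dcoef (y - x) a) (cvec x)
        = ?A + (fser t (cvec y) - fser t (cvec x)) - fser (dcoef (y - x) t) (cvec x)"
      by (simp add: dcoef_def algebra_simps)
    have "norm ?A \<le> e / 4 * norm (y - x)" by (rule d(2)[OF y])
    moreover have "norm (fser t (cvec y) - fser t (cvec x)) \<le> norm (y - x) * (e / 4)"
      by (rule fser_lipschitz[OF t]) (use abs_component_le[of "y - x"] in simp)
    moreover have "norm (fser (dcoef (y - x) t) (cvec x)) \<le> norm (y - x) * (e / 4)"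
      by (rule norm_fser_le[OF wle_dcoef[OF t(2)]]) (rule abs_component_le, simp)
    moreover have "norm (p + q - r) \<le> norm p + norm q + norm r" for p q r :: complex
      by (meson add_mono norm_triangle_ineq norm_triangle_ineq4 order.trans order_refl)
    note this[of ?A "fser t (cvec y) - fser t (cvec x)" "fser (dcoef (y - x) t) (cvec x)"]
    ultimately have "norm (fser a (cvec y) - fser a (cvec x) - fser (dcoef (y - x) a) (cvec x))
       \<le> e / 4 * norm (y - x) + norm (y - x) * (e / 4) + norm (y - x) * (e / 4)"
      unfolding E by linarith
    also have "\<dots> \<le> e * norm (y - x)" using e by (simp add: algebra_simps)
    finally show "norm (fser a (cvec y) - fser a (cvec x) - fser (dcoef (y - x) a) (cvec x)) \<le> e * norm (y - x)" .
  qed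
qed

section \<open>Grid averages\<close>

definition grid :: "nat \<Rightarrow> (int ^ 'n) set" where
  "grid M = {j. \<forall>i. j $ i \<in> {0..<int M}}"

definition gpt :: "nat \<Rightarrow> int ^ 'n \<Rightarrow> real ^ 'n" where
  "gpt M j = (\<chi> i. 2 * pi * of_int (j $ i) / of_nat M)"

definition vmod :: "nat \<Rightarrow> int ^ 'n \<Rightarrow> int ^ 'n" where
  "vmod M j = (\<chi> i. j $ i mod int M)"

text \<open>Root mean square over the grid. Grids take the place of the integral because a change of
  variables then amounts to counting grid points.\<close>

definition gn :: "nat \<Rightarrow> (real ^ 'n \<Rightarrow> complex) \<Rightarrow> real" where
  "gn M f = L2_set (\<lambda>j. norm (f (gpt M j))) (grid M) / sqrt (card (grid M :: (int ^ 'n) set))"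

lemma finite_grid [simp]: "finite (grid M)"
  unfolding grid_def by (rule finite_vec_comp) simp

lemma card_grid_pos: "0 < M \<Longrightarrow> 0 < card (grid M :: (int ^ 'n) set)"
proof -
  assume "0 < M"
  then have "(0 :: int ^ 'n) \<in> grid M" by (simp add: grid_def)
  then show ?thesis by (metis card_gt_0_iff empty_iff finite_grid)
qed

lemma gpt_add: "gpt M (j + l) = gpt M j + gpt M l"
  by (simp add: gpt_def vec_eq_iff algebra_simps add_divide_distrib)

lemma vmod_grid: "0 < M \<Longrightarrow> vmod M j \<in> grid M"
  by (simp add: grid_def vmod_def)

lemma vmod_id: "j \<in> grid M \<Longrightarrow> vmod M j = j"
  by (simp add: grid_def vmod_def vec_eq_iff)

lemma gpt_mult_lattice: "0 < M \<Longrightarrow> gpt M (\<chi> i. int M * m $ i) \<in> period_lattice"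
  unfolding period_lattice_def by (rule image_eqI[where x = m]) (auto simp: gpt_def vec_eq_iff)

lemma ee_gpt_vmod:
  assumes "0 < M" shows "ee k (cvec (gpt M (vmod M j))) = ee k (cvec (gpt M j))"
proof -
  have "j = vmod M j + (\<chi> i. int M * (\<chi> i. j $ i div int M) $ i)"
    by (simp add: vmod_def vec_eq_iff)
  then have "gpt M j = gpt M (vmod M j) + gpt M (\<chi> i. int M * (\<chi> i. j $ i div int M) $ i)"
    by (simp only: gpt_add[symmetric])
  then show ?thesis using ee_periodic[OF gpt_mult_lattice[OF assms]] by metis
qed

lemma gn_nonneg [simp]: "0 \<le> gn M f"
  by (simp add: gn_def L2_set_nonneg)

lemma gn_mono:
  assumes "\<And>x. norm (f x) \<le> c * norm (g x)" "0 \<le> c"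
  shows "gn M f \<le> c * gn M g"
proof -
  have "L2_set (\<lambda>j. norm (f (gpt M j))) (grid M) \<le> L2_set (\<lambda>j. c * norm (g (gpt M j))) (grid M)"
    by (rule L2_set_mono) (use assms in auto)
  also have "\<dots> = c * L2_set (\<lambda>j. norm (g (gpt M j))) (grid M)"
    using assms(2) by (simp add: L2_set_right_distrib)
  finally show ?thesis by (simp add: gn_def divide_right_mono)
qed

lemma gn_bound:
  fixes f :: "real ^ 'a \<Rightarrow> complex"
  assumes "\<And>x. norm (f x) \<le> c" shows "gn M f \<le> c"
proof -
  have c: "0 \<le> c" using assms by (meson norm_ge_zero order.trans)
  have "gn M f \<le> c * gn M (\<lambda>_ :: real ^ 'a. 1)" by (rule gn_mono) (use assms c in auto)
  moreover have "gn M (\<lambda>_ :: real ^ 'a. 1) \<le> 1" by (simp add: gn_def L2_set_def)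
  ultimately show ?thesis using mult_left_mono[of "gn M (\<lambda>_ :: real ^ 'a. 1)" 1 c] c by fastforce
qed

lemma gn_add: "gn M (\<lambda>x. f x + g x) \<le> gn M f + gn M g"
proof -
  have "L2_set (\<lambda>j. norm (f (gpt M j) + g (gpt M j))) (grid M) \<le>
      L2_set (\<lambda>j. norm (f (gpt M j)) + norm (g (gpt M j))) (grid M)"
    by (rule L2_set_mono) (auto simp: norm_triangle_ineq)
  also have "\<dots> \<le> L2_set (\<lambda>j. norm (f (gpt M j))) (grid M) + L2_set (\<lambda>j. norm (g (gpt M j))) (grid M)"
    by (rule L2_set_triangle_ineq)
  finally show ?thesis by (simp add: gn_def divide_right_mono flip: add_divide_distrib)
qed

lemma gn_zero [simp]: "gn M (\<lambda>x. 0) = 0"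
  by (simp add: gn_def L2_set_def)

lemma gn_sum: "finite I \<Longrightarrow> gn M (\<lambda>x. \<Sum>i\<in>I. f i x) \<le> (\<Sum>i\<in>I. gn M (f i))"
proof (induction I rule: finite_induct)
  case (insert i I)
  have "gn M (\<lambda>x. \<Sum>i\<in>insert i I. f i x) = gn M (\<lambda>x. f i x + (\<Sum>i\<in>I. f i x))"
    using insert by simp
  also have "\<dots> \<le> gn M (f i) + gn M (\<lambda>x. \<Sum>i\<in>I. f i x)" by (rule gn_add)
  finally show ?case using insert by simp
qed simp

lemma gn_tendsto:
  assumes "\<And>x. (\<lambda>N. f N x) \<longlonglongrightarrow> g x"
  shows "(\<lambda>N. gn M (f N)) \<longlonglongrightarrow> gn M g"
proof (cases "card (grid M :: (int ^ 'a) set) = 0")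
  case True
  then show ?thesis by (simp add: gn_def)
next
  case False
  then show ?thesis unfolding gn_def L2_set_def
    by (intro tendsto_intros assms) auto
qed

text \<open>Translation by one grid step in direction \<open>i0\<close> permutes the grid and
  multiplies the sum by a root of unity \<open>\<zeta> \<noteq> 1\<close>.\<close>

lemma ee_orthogonal:
  fixes k :: "int ^ 'n"
  assumes M: "0 < M" and k: "\<not> int M dvd k $ i0"
  shows "(\<Sum>j\<in>grid M. ee k (cvec (gpt M j))) = 0"
proof -
  define a :: "int ^ 'n" where "a = axis i0 1"
  define \<zeta> where "\<zeta> = ee k (cvec (gpt M a))"
  have "(\<Sum>j\<in>grid M. ee k (cvec (gpt M j))) = (\<Sum>j\<in>grid M. ee k (cvec (gpt M (vmod M (j + a)))))"
  proof (rule sum.reindex_bij_witness[where i = "\<lambda>j. vmod M (j + a)" and j = "\<lambda>j. vmod M (j - a)"])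
    fix j :: "int ^ 'n" assume j: "j \<in> grid M"
    show "vmod M (vmod M (j - a) + a) = j"
      using vmod_id[OF j] by (simp add: vmod_def vec_eq_iff mod_simps)
    show "vmod M (vmod M (j + a) - a) = j"
      using vmod_id[OF j] by (simp add: vmod_def vec_eq_iff mod_simps)
    show "vmod M (j - a) \<in> grid M" "vmod M (j + a) \<in> grid M" using M by (auto intro: vmod_grid)
    then show "ee k (cvec (gpt M (vmod M (vmod M (j - a) + a)))) = ee k (cvec (gpt M j))"
      using \<open>vmod M (vmod M (j - a) + a) = j\<close> by simp
  qed
  also have "\<dots> = \<zeta> * (\<Sum>j\<in>grid M. ee k (cvec (gpt M j)))"
    by (simp add: ee_gpt_vmod[OF M] gpt_add cvec_add ee_add_right sum_distrib_left \<zeta>_def mult.commute)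
  finally have e: "(\<zeta> - 1) * (\<Sum>j\<in>grid M. ee k (cvec (gpt M j))) = 0" by (simp add: algebra_simps)
  have "\<zeta> \<noteq> 1"
  proof
    assume "\<zeta> = 1"
    moreover have "freq k (gpt M a) = of_int (k $ i0) * (2 * pi / M)"
    proof -
      have "freq k (gpt M a) = (\<Sum>i\<in>UNIV. if i = i0 then of_int (k $ i0) * (2 * pi / M) else 0)"
        unfolding freq_def by (intro sum.cong) (auto simp: gpt_def a_def axis_def)
      then show ?thesis by simp
    qed
    ultimately obtain m :: int where "of_int (k $ i0) * (2 * pi / M) = of_int (2 * m) * pi"
      by (auto simp: \<zeta>_def ee_cvec exp_eq_1)
    then have "of_int (k $ i0) = real_of_int m * of_nat M" using M by (simp add: field_simps)
    then have "real_of_int (k $ i0) = real_of_int (m * int M)" by simp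
    then have "k $ i0 = m * int M" by (simp only: of_int_eq_iff)
    then show False using k by simp
  qed
  then show ?thesis using e by simp
qed

lemma cnj_ee_cvec: "cnj (ee k (cvec x)) = ee (- k) (cvec x)"
  by (simp add: ee_cvec exp_cnj freq_def sum_negf)

text \<open>Parseval on the grid. It is exact once \<open>2 * R < M\<close>: frequencies from
  \<open>F\<close> then differ by less than \<open>M\<close> in each component, so distinct ones are
  orthogonal.\<close>

lemma gn_trig:
  fixes a :: "int ^ 'n \<Rightarrow> complex"
  assumes F: "finite F" "\<And>k. k \<in> F \<Longrightarrow> kn k \<le> R" and M: "0 < M" "2 * R < real M"
  shows "gn M (\<lambda>x. \<Sum>k\<in>F. a k * ee k (cvec x)) = sqrt (\<Sum>k\<in>F. (norm (a k))\<^sup>2)"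
proof -
  let ?G = "grid M :: (int ^ 'n) set"
  let ?g = "\<lambda>j. \<Sum>k\<in>F. a k * ee k (cvec (gpt M j))"
  have orth: "(\<Sum>j\<in>?G. ee (k - l) (cvec (gpt M j))) = (if k = l then of_nat (card ?G) else 0)"
    if kl: "k \<in> F" "l \<in> F" for k l
  proof (cases "k = l")
    case False
    then obtain i where i: "k $ i \<noteq> l $ i" by (auto simp: vec_eq_iff)
    have "\<bar>of_int (k $ i - l $ i)\<bar> \<le> kn k + kn l"
      using comp_le_kn[of k i] comp_le_kn[of l i] by simp
    also have "\<dots> < real M" using F(2)[OF kl(1)] F(2)[OF kl(2)] M by simp
    finally have "\<bar>k $ i - l $ i\<bar> < int M" by linarith
    then have "\<not> int M dvd (k - l) $ i" using i zdvd_imp_le[of "int M" "\<bar>k $ i - l $ i\<bar>"] by auto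
    then show ?thesis using ee_orthogonal[OF M(1), of "k - l" i] False by simp
  qed simp
  have "complex_of_real (\<Sum>j\<in>?G. (norm (?g j))\<^sup>2) = (\<Sum>j\<in>?G. ?g j * cnj (?g j))"
    by (simp only: of_real_sum complex_norm_square)
  also have "\<dots> = (\<Sum>j\<in>?G. \<Sum>k\<in>F. \<Sum>l\<in>F. a k * cnj (a l) * ee (k - l) (cvec (gpt M j)))"
    by (simp add: sum_product cnj_ee_cvec ee_add_left[of _ "- _", simplified] mult_ac cong: sum.cong)
  also have "\<dots> = (\<Sum>k\<in>F. \<Sum>j\<in>?G. \<Sum>l\<in>F. a k * cnj (a l) * ee (k - l) (cvec (gpt M j)))"
    by (rule sum.swap)
  also have "\<dots> = (\<Sum>k\<in>F. \<Sum>l\<in>F. \<Sum>j\<in>?G. a k * cnj (a l) * ee (k - l) (cvec (gpt M j)))"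
    by (intro sum.cong refl sum.swap)
  also have "\<dots> = (\<Sum>k\<in>F. \<Sum>l\<in>F. if k = l then a k * cnj (a l) * of_nat (card ?G) else 0)"
    by (intro sum.cong refl) (simp add: sum_distrib_left[symmetric] orth)
  also have "\<dots> = (\<Sum>k\<in>F. a k * cnj (a k) * of_nat (card ?G))"
    using F(1) by simp
  also have "\<dots> = complex_of_real (card ?G * (\<Sum>k\<in>F. (norm (a k))\<^sup>2))"
    by (simp only: of_real_sum complex_norm_square of_real_mult sum_distrib_left of_real_of_nat_eq mult_ac)
  finally have "(\<Sum>j\<in>?G. (norm (?g j))\<^sup>2) = card ?G * (\<Sum>k\<in>F. (norm (a k))\<^sup>2)"
    by (simp only: of_real_eq_iff)
  then show ?thesis using card_grid_pos[OF M(1), where 'n = 'n]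
    by (auto simp: gn_def L2_set_def real_sqrt_mult card_gt_0_iff)
qed

text \<open>The number of grid points that a map with Lipschitz constant of the inverse at most 2 can
  send, after rounding, to the same grid point is at most the number of these offsets.\<close>
definition offsets :: "(int ^ 'n) set" where
  "offsets = {d. \<forall>i. d $ i \<in> {-2..2}}"

lemma finite_offsets: "finite offsets"
  unfolding offsets_def by (rule finite_vec_comp) simp

lemma card_offsets_ge_1: "1 \<le> card (offsets :: (int ^ 'n) set)"
proof -
  have "(0 :: int ^ 'n) \<in> offsets" by (simp add: offsets_def)
  then have "0 < card (offsets :: (int ^ 'n) set)"
    by (metis card_gt_0_iff empty_iff finite_offsets)
  then show ?thesis by simp
qed

text \<open>Lipschitz constant 1/2 in the sup norm, which suits a rectangular grid; periodicity
  makes \<open>U\<close> a function on the torus.\<close>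

definition half_lipschitz :: "(real ^ 'n \<Rightarrow> real ^ 'n) \<Rightarrow> bool" where
  "half_lipschitz U \<longleftrightarrow> (\<forall>x y r. (\<forall>i. \<bar>x $ i - y $ i\<bar> \<le> r) \<longrightarrow> (\<forall>i. \<bar>U x $ i - U y $ i\<bar> \<le> r / 2)) \<and>
     (\<forall>x. \<forall>v\<in>period_lattice. U (x + v) = U x)"

text \<open>The l2 norm plus the worst error of rounding image points to the grid, which moves each
  coordinate by at most \<open>pi / M\<close>. The second term vanishes as \<open>M\<close>
  grows.\<close>

definition qn :: "nat \<Rightarrow> (int ^ 'n) set \<Rightarrow> (int ^ 'n \<Rightarrow> complex) \<Rightarrow> real" where
  "qn M F a = sqrt (\<Sum>k\<in>F. (norm (a k))\<^sup>2) + pi / M * (\<Sum>k\<in>F. kn k * norm (a k))"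

lemma qn_nonneg: "0 \<le> qn M F a"
  by (simp add: qn_def sum_nonneg)

lemma qn_mono:
  assumes "\<And>k. k \<in> F \<Longrightarrow> norm (a k) \<le> c * norm (b k)" "0 \<le> c"
  shows "qn M F a \<le> c * qn M F b"
proof -
  have "sqrt (\<Sum>k\<in>F. (norm (a k))\<^sup>2) \<le> sqrt (\<Sum>k\<in>F. (c * norm (b k))\<^sup>2)"
    using assms by (intro real_sqrt_le_mono sum_mono power_mono) auto
  also have "\<dots> = c * sqrt (\<Sum>k\<in>F. (norm (b k))\<^sup>2)"
    using assms(2) by (simp add: power_mult_distrib sum_distrib_left[symmetric] real_sqrt_mult)
  finally have 1: "sqrt (\<Sum>k\<in>F. (norm (a k))\<^sup>2) \<le> c * sqrt (\<Sum>k\<in>F. (norm (b k))\<^sup>2)" .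
  have "(\<Sum>k\<in>F. kn k * norm (a k)) \<le> (\<Sum>k\<in>F. kn k * (c * norm (b k)))"
    using assms by (intro sum_mono mult_left_mono) auto
  then have "pi / M * (\<Sum>k\<in>F. kn k * norm (a k)) \<le> pi / M * (\<Sum>k\<in>F. kn k * (c * norm (b k)))"
    by (intro mult_left_mono) auto
  also have "\<dots> = c * (pi / M * (\<Sum>k\<in>F. kn k * norm (b k)))"
    by (simp add: sum_distrib_left mult_ac)
  finally show ?thesis using 1 by (simp add: qn_def algebra_simps)
qed

lemma rounding_close:
  fixes t :: "real ^ 'n"
  assumes M: "0 < M"
  shows "\<bar>t $ i - gpt M (\<chi> i. round (M * t $ i / (2 * pi))) $ i\<bar> \<le> pi / M"
proof -
  have "\<bar>of_int (round (M * t $ i / (2 * pi))) - M * t $ i / (2 * pi)\<bar> \<le> 1 / 2"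
    by (rule of_int_round_abs_le)
  then have "\<bar>of_int (round (M * t $ i / (2 * pi))) - M * t $ i / (2 * pi)\<bar> * (2 * pi / M) \<le> 1 / 2 * (2 * pi / M)"
    by (rule mult_right_mono) auto
  moreover have "t $ i - gpt M (\<chi> i. round (M * t $ i / (2 * pi))) $ i =
      - ((of_int (round (M * t $ i / (2 * pi))) - M * t $ i / (2 * pi)) * (2 * pi / M))"
    using M by (simp add: gpt_def field_simps)
  ultimately show ?thesis by (simp add: abs_mult)
qed

text \<open>If two grid points round to the same point, their images differ by at most
  \<open>2 * pi / M\<close> in each coordinate, modulo periods. As \<open>U\<close> has Lipschitz
  constant 1/2, the sup distance \<open>r\<close> of the points satisfies
  \<open>r - r / 2 \<le> 2 * pi / M\<close>, that is, at most two grid steps.\<close>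

lemma rounding_fibre:
  fixes U :: "real ^ 'n \<Rightarrow> real ^ 'n"
  assumes U: "half_lipschitz U" and M: "0 < M"
  defines "p \<equiv> \<lambda>j. \<chi> i. round (M * (gpt M j + U (gpt M j)) $ i / (2 * pi))"
  shows "card {j \<in> grid M. vmod M (p j) = l} \<le> card (offsets :: (int ^ 'n) set)"
proof (cases "{j \<in> grid M. vmod M (p j) = l} = {}")
  case True
  then show ?thesis by (simp only: card.empty)
next
  case False
  then obtain j0 where j0: "j0 \<in> grid M" "vmod M (p j0) = l" by auto
  have rnd: "\<bar>(gpt M j + U (gpt M j)) $ i - gpt M (p j) $ i\<bar> \<le> pi / M" for j i
    unfolding p_def by (rule rounding_close[OF M])
  have "{j \<in> grid M. vmod M (p j) = l} \<subseteq> (\<lambda>d. vmod M (j0 + d)) ` offsets"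
  proof
    fix j assume "j \<in> {j \<in> grid M. vmod M (p j) = l}"
    then have j: "j \<in> grid M" "vmod M (p j) = vmod M (p j0)" using j0 by auto
    \<comment> \<open>The rounded images agree only modulo \<open>M\<close>; \<open>m\<close>
      records the period by which \<open>j0\<close> is translated to make them equal.\<close>
    define m where "m = (\<chi> i. (p j $ i - p j0 $ i) div int M)"
    have m: "p j = p j0 + (\<chi> i. int M * m $ i)"
    proof -
      have "p j $ i mod int M = p j0 $ i mod int M" for i
        using j(2) by (simp add: vmod_def vec_eq_iff)
      then have "int M dvd p j $ i - p j0 $ i" for i by (simp add: mod_eq_dvd_iff)
      then show ?thesis by (simp add: m_def vec_eq_iff)
    qed
    let ?v = "gpt M (\<chi> i. int M * m $ i)"
    define y where "y = gpt M j0 + ?v"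
    have Uy: "U y = U (gpt M j0)"
      using U gpt_mult_lattice[OF M, of m] unfolding half_lipschitz_def y_def by blast
    have close: "\<bar>(gpt M j + U (gpt M j)) $ i - (y + U y) $ i\<bar> \<le> 2 * pi / M" for i
      using rnd[of j i] rnd[of j0 i] Uy unfolding m gpt_add by (simp add: y_def)
    define r where "r = Max (range (\<lambda>i. \<bar>gpt M j $ i - y $ i\<bar>))"
    have le_r: "\<bar>gpt M j $ i - y $ i\<bar> \<le> r" for i
      unfolding r_def by (rule Max_ge) auto
    have "r \<in> range (\<lambda>i. \<bar>gpt M j $ i - y $ i\<bar>)" unfolding r_def by (rule Max_in) auto
    then obtain i0 where "r = \<bar>gpt M j $ i0 - y $ i0\<bar>" by auto
    moreover have "\<bar>U (gpt M j) $ i0 - U y $ i0\<bar> \<le> r / 2"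
      using U le_r unfolding half_lipschitz_def by blast
    ultimately have "r \<le> 2 * (2 * pi / M)" using close[of i0] unfolding vector_add_component by linarith
    then have "r \<le> 4 * pi / M" by simp
    have "(j - j0 - (\<chi> i. int M * m $ i)) $ i \<in> {-2..2}" for i
    proof -
      have "gpt M j $ i - y $ i = 2 * pi / M * of_int ((j - j0 - (\<chi> i. int M * m $ i)) $ i)"
        using M by (simp add: y_def gpt_def field_simps)
      then have "2 * pi / M * \<bar>of_int ((j - j0 - (\<chi> i. int M * m $ i)) $ i)\<bar> \<le> 2 * pi / M * 2"
        using le_r[of i] \<open>r \<le> 4 * pi / M\<close> M by (simp add: abs_mult)
      then have "\<bar>of_int ((j - j0 - (\<chi> i. int M * m $ i)) $ i) :: real\<bar> \<le> 2"
        by (subst (asm) mult_le_cancel_left_pos) (use M in auto)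
      then have "\<bar>(j - j0 - (\<chi> i. int M * m $ i)) $ i\<bar> \<le> 2" by linarith
      then show ?thesis by (simp only: atLeastAtMost_iff) linarith
    qed
    then have "j - j0 - (\<chi> i. int M * m $ i) \<in> offsets" by (simp add: offsets_def)
    moreover have "j = vmod M (j0 + (j - j0 - (\<chi> i. int M * m $ i)))"
    proof -
      have "vmod M (j0 + (j - j0 - (\<chi> i. int M * m $ i))) = vmod M j"
        using mod_mult_self2[of "j $ i" "int M" "- m $ i" for i] by (simp add: vmod_def vec_eq_iff)
      then show ?thesis using vmod_id[OF j(1)] by simp
    qed
    ultimately show "j \<in> (\<lambda>d. vmod M (j0 + d)) ` offsets" by blast
  qed
  then show ?thesis
    by (meson card_image_le card_mono finite_imageI finite_offsets order.trans)
qed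

text \<open>Rounding replaces values at image points by values at grid points, each used at most
  \<open>card offsets\<close> times; then Parseval applies to the polynomial itself.\<close>

lemma gn_trig_comp:
  fixes a :: "int ^ 'n \<Rightarrow> complex"
  assumes U: "half_lipschitz U" and F: "finite F" "\<And>k. k \<in> F \<Longrightarrow> kn k \<le> R"
    and M: "0 < M" "2 * R < real M"
  shows "gn M (\<lambda>x. \<Sum>k\<in>F. a k * ee k (cvec (x + U x))) \<le>
     sqrt (card (offsets :: (int ^ 'n) set)) * qn M F a"
proof -
  let ?G = "grid M :: (int ^ 'n) set"
  let ?c = "card (offsets :: (int ^ 'n) set)"
  define g where "g x = (\<Sum>k\<in>F. a k * ee k (cvec x))" for x
  define p where "p j = (\<chi> i. round (M * (gpt M j + U (gpt M j)) $ i / (2 * pi)))" for j :: "int ^ 'n"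
  define err where "err = pi / M * (\<Sum>k\<in>F. kn k * norm (a k))"
  have err: "0 \<le> err" by (simp add: err_def sum_nonneg)
  have rnd: "\<bar>(gpt M j + U (gpt M j)) $ i - gpt M (p j) $ i\<bar> \<le> pi / M" for j i
    unfolding p_def by (rule rounding_close[OF M(1)])
  have gle: "norm (g (gpt M j + U (gpt M j))) \<le> norm (g (gpt M (vmod M (p j)))) + err" for j
  proof -
    have "norm (g (gpt M j + U (gpt M j)) - g (gpt M (p j))) \<le>
      (\<Sum>k\<in>F. norm (a k * ee k (cvec (gpt M j + U (gpt M j))) - a k * ee k (cvec (gpt M (p j)))))"
      unfolding g_def sum_subtractf[symmetric] by (rule norm_sum)
    also have "\<dots> \<le> (\<Sum>k\<in>F. norm (a k) * (pi / M * kn k))"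
      unfolding right_diff_distrib[symmetric] norm_mult
      by (intro sum_mono mult_left_mono norm_ee_diff_le rnd) auto
    also have "\<dots> = err" by (simp add: err_def sum_distrib_left mult_ac)
    finally have "norm (g (gpt M j + U (gpt M j)) - g (gpt M (p j))) \<le> err" .
    moreover have "g (gpt M (p j)) = g (gpt M (vmod M (p j)))"
      by (simp add: g_def ee_gpt_vmod[OF M(1)])
    ultimately show ?thesis
      using norm_triangle_sub[of "g (gpt M j + U (gpt M j))" "g (gpt M (p j))"] by simp
  qed
  have "L2_set (\<lambda>j. norm (g (gpt M j + U (gpt M j)))) ?G \<le>
      L2_set (\<lambda>j. norm (g (gpt M (vmod M (p j)))) + err) ?G"
    by (rule L2_set_mono) (auto simp: gle)
  also have "\<dots> \<le> L2_set (\<lambda>j. norm (g (gpt M (vmod M (p j))))) ?G + L2_set (\<lambda>j. err) ?G"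
    by (rule L2_set_triangle_ineq)
  also have "L2_set (\<lambda>j. err) ?G = sqrt (card ?G) * err"
    using err by (simp add: L2_set_def real_sqrt_mult)
  also have "L2_set (\<lambda>j. norm (g (gpt M (vmod M (p j))))) ?G \<le> sqrt ?c * L2_set (\<lambda>j. norm (g (gpt M j))) ?G"
  proof -
    have "(\<Sum>j\<in>?G. (norm (g (gpt M (vmod M (p j)))))\<^sup>2) =
        (\<Sum>l\<in>?G. \<Sum>j\<in>{j \<in> ?G. vmod M (p j) = l}. (norm (g (gpt M (vmod M (p j)))))\<^sup>2)"
      by (rule sum.group[symmetric]) (auto simp: vmod_grid M)
    also have "\<dots> = (\<Sum>l\<in>?G. card {j \<in> ?G. vmod M (p j) = l} * (norm (g (gpt M l)))\<^sup>2)"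
      by (intro sum.cong refl) simp
    also have "\<dots> \<le> (\<Sum>l\<in>?G. ?c * (norm (g (gpt M l)))\<^sup>2)"
      using rounding_fibre[OF U M(1)] by (intro sum_mono mult_right_mono) (auto simp: p_def)
    finally show ?thesis
      by (simp add: L2_set_def sum_distrib_left[symmetric] real_sqrt_mult[symmetric])
  qed
  finally have "L2_set (\<lambda>j. norm (g (gpt M j + U (gpt M j)))) ?G / sqrt (card ?G) \<le>
      (sqrt ?c * L2_set (\<lambda>j. norm (g (gpt M j))) ?G + sqrt (card ?G) * err) / sqrt (card ?G)"
    by (intro divide_right_mono) auto
  also have "\<dots> = sqrt ?c * gn M g + err"
  proof -
    have nz: "sqrt (card ?G) \<noteq> 0" using card_grid_pos[OF M(1), where 'n = 'n] by (simp only: real_sqrt_eq_0_iff of_nat_eq_0_iff)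
    show ?thesis
      by (simp only: gn_def add_divide_distrib nonzero_mult_div_cancel_left[OF nz] times_divide_eq_right)
  qed
  also have "gn M g = sqrt (\<Sum>k\<in>F. (norm (a k))\<^sup>2)"
    unfolding g_def by (rule gn_trig[OF F M])
  also have "sqrt ?c * sqrt (\<Sum>k\<in>F. (norm (a k))\<^sup>2) + err \<le> sqrt ?c * qn M F a"
  proof -
    have "1 \<le> sqrt ?c" using card_offsets_ge_1[where 'n = 'n] by simp
    then have "1 * err \<le> sqrt ?c * err" using err by (intro mult_right_mono)
    then show ?thesis by (simp add: qn_def err_def distrib_left)
  qed
  finally show ?thesis by (simp add: gn_def g_def)
qed

text \<open>\<open>Z\<close> varies with \<open>x\<close>, so Parseval does not apply directly. Each
  factor \<open>cfreq k (Z x)\<close> is split into coordinates: \<open>Z x $ i\<close> is bounded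
  and leaves the mean, \<open>k $ i\<close> joins the coefficient. This costs a factor
  \<open>CARD('n)\<close> per power.\<close>

lemma gn_trig_comp_power:
  fixes a :: "int ^ 'n \<Rightarrow> complex"
  assumes U: "half_lipschitz U" and F: "finite F" "\<And>k. k \<in> F \<Longrightarrow> kn k \<le> R"
    and M: "0 < M" "2 * R < real M" and Z: "\<And>x i. norm (Z x $ i) \<le> \<rho>" and \<rho>: "0 \<le> \<rho>"
  shows "gn M (\<lambda>x. \<Sum>k\<in>F. a k * ee k (cvec (x + U x)) * cfreq k (Z x) ^ m) \<le>
     sqrt (card (offsets :: (int ^ 'n) set)) * (real CARD('n) * \<rho>) ^ m *
     qn M F (\<lambda>k. of_real (kn k) ^ m * a k)"
proof (induction m arbitrary: a)
  case 0
  then show ?case using gn_trig_comp[OF U F M, of a] by simp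
next
  case (Suc m)
  let ?c = "sqrt (card (offsets :: (int ^ 'n) set)) * (real CARD('n) * \<rho>) ^ m"
  let ?h = "\<lambda>i x. \<Sum>k\<in>F. (of_int (k $ i) * a k) * ee k (cvec (x + U x)) * cfreq k (Z x) ^ m"
  have eq: "(\<Sum>k\<in>F. a k * ee k (cvec (x + U x)) * cfreq k (Z x) ^ Suc m) = (\<Sum>i\<in>UNIV. Z x $ i * ?h i x)" for x
  proof -
    have "(\<Sum>k\<in>F. a k * ee k (cvec (x + U x)) * cfreq k (Z x) ^ Suc m) =
      (\<Sum>k\<in>F. \<Sum>i\<in>UNIV. Z x $ i * ((of_int (k $ i) * a k) * ee k (cvec (x + U x)) * cfreq k (Z x) ^ m))"
      by (intro sum.cong refl)
         (simp add: cfreq_def[of _ "Z x"] sum_distrib_left sum_distrib_right mult_ac)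
    also have "\<dots> = (\<Sum>i\<in>UNIV. Z x $ i * ?h i x)"
      by (subst sum.swap) (simp add: sum_distrib_left)
    finally show ?thesis .
  qed
  have "gn M (\<lambda>x. \<Sum>k\<in>F. a k * ee k (cvec (x + U x)) * cfreq k (Z x) ^ Suc m) \<le>
      (\<Sum>i\<in>UNIV. gn M (\<lambda>x. Z x $ i * ?h i x))"
    unfolding eq by (rule gn_sum) simp
  also have "\<dots> \<le> (\<Sum>i\<in>(UNIV :: 'n set). \<rho> * (?c * qn M F (\<lambda>k. of_real (kn k) ^ Suc m * a k)))"
  proof (intro sum_mono)
    fix i
    have "gn M (\<lambda>x. Z x $ i * ?h i x) \<le> \<rho> * gn M (?h i)"
      by (rule gn_mono) (auto simp: norm_mult Z \<rho> mult_right_mono)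
    also have "\<dots> \<le> \<rho> * (?c * qn M F (\<lambda>k. of_real (kn k) ^ m * (of_int (k $ i) * a k)))"
      by (intro mult_left_mono Suc.IH \<rho>)
    also have "\<dots> \<le> \<rho> * (?c * (1 * qn M F (\<lambda>k. of_real (kn k) ^ Suc m * a k)))"
    proof (intro mult_left_mono qn_mono \<rho>)
      fix k
      have "norm (a k) * kn k ^ m * \<bar>of_int (k $ i)\<bar> \<le> norm (a k) * kn k ^ m * kn k"
        by (intro mult_left_mono comp_le_kn) auto
      then show "norm (of_real (kn k) ^ m * (of_int (k $ i) * a k)) \<le> 1 * norm (of_real (kn k) ^ Suc m * a k)"
        by (simp add: norm_mult norm_power mult_ac)
    qed (use \<rho> in auto)
    finally show "gn M (\<lambda>x. Z x $ i * ?h i x) \<le> \<rho> * (?c * qn M F (\<lambda>k. of_real (kn k) ^ Suc m * a k))"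
      by simp
  qed
  also have "\<dots> = sqrt (card (offsets :: (int ^ 'n) set)) * (real CARD('n) * \<rho>) ^ Suc m *
     qn M F (\<lambda>k. of_real (kn k) ^ Suc m * a k)"
    by simp
  finally show ?case .
qed

lemma power_le_fact_exp: "0 \<le> x \<Longrightarrow> x ^ m \<le> fact m * exp x" for x :: real
proof -
  assume x: "0 \<le> x"
  have "x ^ m /\<^sub>R fact m \<le> exp x"
    using sum_le_suminf[of "\<lambda>n. x ^ n /\<^sub>R fact n" "{m}"] exp_converges[of x] x by (auto simp: sums_iff)
  then show ?thesis by (simp add: field_simps)
qed

text \<open>In the expansion of the exponential,
  \<open>kn k ^ m \<le> fact m / \<sigma> ^ m * exp (\<sigma> * kn k)\<close> cancels the factorial
  and leaves a geometric series in \<open>CARD('n) * \<rho> / \<sigma> \<le> 1 / 2\<close>, hence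
  the factor 2.\<close>

lemma gn_trig_comp_exp:
  fixes a :: "int ^ 'n \<Rightarrow> complex"
  assumes U: "half_lipschitz U" and F: "finite F" "\<And>k. k \<in> F \<Longrightarrow> kn k \<le> R"
    and M: "0 < M" "2 * R < real M" and Z: "\<And>x i. norm (Z x $ i) \<le> \<rho>" and \<rho>: "0 \<le> \<rho>"
    and \<sigma>: "0 < \<sigma>" "real CARD('n) * \<rho> / \<sigma> \<le> 1 / 2"
  shows "gn M (\<lambda>x. \<Sum>k\<in>F. a k * ee k (cvec (x + U x)) * (exp (\<i> * cfreq k (Z x)) - 1)) \<le>
     sqrt (card (offsets :: (int ^ 'n) set)) * (2 * (real CARD('n) * \<rho> / \<sigma>)) *
     qn M F (\<lambda>k. exp (\<sigma> * kn k) * a k)"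
proof -
  let ?c = "sqrt (card (offsets :: (int ^ 'n) set))"
  let ?t = "real CARD('n) * \<rho> / \<sigma>"
  let ?q = "qn M F (\<lambda>k. exp (\<sigma> * kn k) * a k)"
  let ?f = "\<lambda>m x. complex_of_real (1 / fact (Suc m)) * \<i> ^ Suc m * (\<Sum>k\<in>F. a k * ee k (cvec (x + U x)) * cfreq k (Z x) ^ Suc m)"
  have t: "0 \<le> ?t" using \<rho> \<sigma> by simp
  have "gn M (\<lambda>x. \<Sum>m<N. ?f m x) \<le> ?c * (2 * ?t) * ?q" for N
  proof -
    have "gn M (\<lambda>x. \<Sum>m<N. ?f m x) \<le> (\<Sum>m<N. gn M (?f m))" by (rule gn_sum) simp
    also have "\<dots> \<le> (\<Sum>m<N. ?c * ?q * ?t ^ Suc m)"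
    proof (intro sum_mono)
      fix m
      have n: "norm (complex_of_real (1 / fact (Suc m))) = 1 / fact (Suc m)"
        by (simp only: norm_of_real) simp
      have "gn M (?f m) \<le> 1 / fact (Suc m) * gn M (\<lambda>x. \<Sum>k\<in>F. a k * ee k (cvec (x + U x)) * cfreq k (Z x) ^ Suc m)"
        by (rule gn_mono) (auto simp only: norm_mult n norm_power norm_ii power_one, auto)
      also have "\<dots> \<le> 1 / fact (Suc m) * (?c * (real CARD('n) * \<rho>) ^ Suc m * qn M F (\<lambda>k. of_real (kn k) ^ Suc m * a k))"
        by (intro mult_left_mono gn_trig_comp_power[OF U F M Z \<rho>]) auto
      also have "\<dots> \<le> 1 / fact (Suc m) * (?c * (real CARD('n) * \<rho>) ^ Suc m * (fact (Suc m) / \<sigma> ^ Suc m * ?q))"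
      proof (intro mult_left_mono qn_mono)
        fix k :: "int ^ 'n"
        have "(\<sigma> * kn k) ^ Suc m \<le> fact (Suc m) * exp (\<sigma> * kn k)"
          using \<sigma> by (intro power_le_fact_exp) simp
        then have "kn k ^ Suc m \<le> fact (Suc m) / \<sigma> ^ Suc m * exp (\<sigma> * kn k)"
          using \<sigma> by (simp only: power_mult_distrib) (simp add: field_simps del: power_Suc fact_Suc)
        then have "kn k ^ Suc m * norm (a k) \<le> fact (Suc m) / \<sigma> ^ Suc m * exp (\<sigma> * kn k) * norm (a k)"
          by (rule mult_right_mono) simp
        then show "norm (of_real (kn k) ^ Suc m * a k) \<le> fact (Suc m) / \<sigma> ^ Suc m * norm (exp (\<sigma> * kn k) * a k)"
          by (simp add: norm_mult norm_power mult_ac del: power_Suc fact_Suc)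
      qed (use \<rho> \<sigma> in auto)
      also have "\<dots> = ?c * ?q * ?t ^ Suc m"
        by (simp add: power_divide del: power_Suc fact_Suc)
      finally show "gn M (?f m) \<le> ?c * ?q * ?t ^ Suc m" .
    qed
    also have "\<dots> = ?c * ?q * (?t * (\<Sum>m<N. ?t ^ m))"
      by (simp add: sum_distrib_left)
    also have "\<dots> \<le> ?c * ?q * (?t * 2)"
    proof (intro mult_left_mono)
      have "(\<Sum>m<N. ?t ^ m) \<le> (\<Sum>m<N. (1 / 2) ^ m)"
        using \<sigma> t by (intro sum_mono power_mono) auto
      also have "\<dots> \<le> 2" by (simp add: sum_gp_strict)
      finally show "(\<Sum>m<N. ?t ^ m) \<le> 2" .
    qed (use t qn_nonneg in \<open>auto intro!: mult_nonneg_nonneg\<close>)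
    finally show ?thesis by (simp add: mult_ac)
  qed
  \<comment> \<open>For fixed \<open>M\<close> the average involves finitely many points, so
    pointwise convergence of the partial sums passes to \<open>gn\<close>.\<close>
  moreover have "(\<lambda>N. gn M (\<lambda>x. \<Sum>m<N. ?f m x)) \<longlonglongrightarrow>
      gn M (\<lambda>x. \<Sum>k\<in>F. a k * ee k (cvec (x + U x)) * (exp (\<i> * cfreq k (Z x)) - 1))"
  proof (rule gn_tendsto)
    fix x
    have "(\<lambda>N. \<Sum>k\<in>F. a k * ee k (cvec (x + U x)) * (\<Sum>m<N. (\<i> * cfreq k (Z x)) ^ Suc m /\<^sub>R fact (Suc m))) \<longlonglongrightarrow>
        (\<Sum>k\<in>F. a k * ee k (cvec (x + U x)) * (exp (\<i> * cfreq k (Z x)) - 1))"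
    proof (intro tendsto_sum tendsto_mult tendsto_const)
      fix k
      have "(\<lambda>m. (\<i> * cfreq k (Z x)) ^ Suc m /\<^sub>R fact (Suc m)) sums (exp (\<i> * cfreq k (Z x)) - 1)"
        using exp_converges[of "\<i> * cfreq k (Z x)"] by (subst sums_Suc_iff) simp
      then show "(\<lambda>N. \<Sum>m<N. (\<i> * cfreq k (Z x)) ^ Suc m /\<^sub>R fact (Suc m)) \<longlonglongrightarrow> exp (\<i> * cfreq k (Z x)) - 1"
        by (simp add: sums_def)
    qed
    moreover have "(\<Sum>k\<in>F. a k * ee k (cvec (x + U x)) * (\<Sum>m<N. (\<i> * cfreq k (Z x)) ^ Suc m /\<^sub>R fact (Suc m)))
        = (\<Sum>m<N. ?f m x)" for N
      unfolding sum_distrib_left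
      by (subst sum.swap) (intro sum.cong refl,
          simp only: power_mult_distrib scaleR_conv_of_real inverse_eq_divide mult_ac)
    ultimately show "(\<lambda>N. \<Sum>m<N. ?f m x) \<longlonglongrightarrow>
        (\<Sum>k\<in>F. a k * ee k (cvec (x + U x)) * (exp (\<i> * cfreq k (Z x)) - 1))" by simp
  qed
  ultimately show ?thesis by (intro LIMSEQ_le_const2) auto
qed

text \<open>An upper bound for the quadratic mean, expressed through the grid averages.\<close>
definition gb :: "real \<Rightarrow> (real ^ 'n \<Rightarrow> complex) \<Rightarrow> bool" where
  "gb B f \<longleftrightarrow> (\<forall>\<eta>>0. \<forall>\<^sub>F M in sequentially. gn M f \<le> B + \<eta>)"

section \<open>Limits of grid averages and l2 bounds on coefficients\<close>

definition l2le :: "real \<Rightarrow> real \<Rightarrow> (int ^ 'n \<Rightarrow> complex) \<Rightarrow> bool" where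
  "l2le s B a \<longleftrightarrow> (\<forall>F. finite F \<longrightarrow> sqrt (\<Sum>k\<in>F. (norm (a k) * exp (s * kn k))\<^sup>2) \<le> B)"

lemma l2le_nonneg: "l2le s B a \<Longrightarrow> 0 \<le> B"
  unfolding l2le_def by (auto dest: spec[of _ "{}"])

lemma l2le_mono:
  fixes a :: "int ^ 'n \<Rightarrow> complex"
  assumes "l2le t B b" "B \<le> C"
    and "\<And>k. norm (a k) * exp (s * kn k) \<le> norm (b k) * exp (t * kn k)"
  shows "l2le s C a"
  unfolding l2le_def
proof safe
  fix F :: "(int ^ 'n) set" assume "finite F"
  have "sqrt (\<Sum>k\<in>F. (norm (a k) * exp (s * kn k))\<^sup>2) \<le> sqrt (\<Sum>k\<in>F. (norm (b k) * exp (t * kn k))\<^sup>2)"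
    by (intro real_sqrt_le_mono sum_mono power_mono assms) auto
  also have "\<dots> \<le> B" using assms(1) \<open>finite F\<close> by (simp add: l2le_def)
  finally show "sqrt (\<Sum>k\<in>F. (norm (a k) * exp (s * kn k))\<^sup>2) \<le> C" using assms(2) by simp
qed

lemma l2le_coeff: "l2le s B a \<Longrightarrow> norm (a k) * exp (s * kn k) \<le> B"
  unfolding l2le_def by (drule spec[of _ "{k}"]) simp

lemma gb_nonneg: "gb B f \<Longrightarrow> 0 \<le> B"
proof (rule ccontr)
  assume "gb B f" "\<not> 0 \<le> B"
  then have "\<forall>\<^sub>F M in sequentially. gn M f \<le> B + (- B / 2)"
    unfolding gb_def by (meson divide_pos_pos neg_0_less_iff_less not_le zero_less_numeral)
  then obtain M where "gn M f \<le> B + (- B / 2)" by (auto simp: eventually_sequentially)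
  then show False using gn_nonneg[of M f] \<open>\<not> 0 \<le> B\<close> by linarith
qed

lemma gb_add:
  assumes "gb B f" "gb C g" shows "gb (B + C) (\<lambda>x. f x + g x)"
  unfolding gb_def
proof safe
  fix \<eta> :: real assume "0 < \<eta>"
  then have "\<forall>\<^sub>F M in sequentially. gn M f \<le> B + \<eta> / 2" "\<forall>\<^sub>F M in sequentially. gn M g \<le> C + \<eta> / 2"
    using assms unfolding gb_def by (meson half_gt_zero)+
  then show "\<forall>\<^sub>F M in sequentially. gn M (\<lambda>x. f x + g x) \<le> B + C + \<eta>"
  proof eventually_elim
    case (elim M)
    then show ?case using gn_add[of M f g] by simp
  qed
qed

lemma gb_zero: "gb 0 (\<lambda>x. 0)"
  by (simp add: gb_def)

lemma gb_sum:
  assumes "finite I" "\<And>i. i \<in> I \<Longrightarrow> gb (B i) (f i)"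
  shows "gb (\<Sum>i\<in>I. B i) (\<lambda>x. \<Sum>i\<in>I. f i x)"
  using assms by (induction I rule: finite_induct) (auto intro: gb_zero gb_add)

lemma gb_mult:
  assumes "gb B f" "\<And>x. norm (g x) \<le> c * norm (f x)" "0 \<le> c"
  shows "gb (c * B) g"
  unfolding gb_def
proof safe
  fix \<eta> :: real assume \<eta>: "0 < \<eta>"
  have "0 < \<eta> / (c + 1)" using \<eta> assms(3) by simp
  then have "\<forall>\<^sub>F M in sequentially. gn M f \<le> B + \<eta> / (c + 1)"
    using assms(1) unfolding gb_def by blast
  then show "\<forall>\<^sub>F M in sequentially. gn M g \<le> c * B + \<eta>"
  proof eventually_elim
    case (elim M)
    have "gn M g \<le> c * gn M f" by (rule gn_mono[OF assms(2,3)])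
    also have "\<dots> \<le> c * (B + \<eta> / (c + 1))" by (rule mult_left_mono[OF elim assms(3)])
    also have "\<dots> = c * B + \<eta> * (c / (c + 1))" by (simp add: distrib_left)
    also have "\<eta> * (c / (c + 1)) \<le> \<eta> * 1" using \<eta> assms(3) by (intro mult_left_mono) auto
    finally show ?case by simp
  qed
qed

lemma gb_approx:
  fixes f :: "real ^ 'n \<Rightarrow> complex"
  assumes "\<And>\<eta>. 0 < \<eta> \<Longrightarrow> \<exists>g. gb B g \<and> (\<forall>x. norm (f x - g x) \<le> \<eta>)"
  shows "gb B f"
  unfolding gb_def
proof safe
  fix \<eta> :: real assume \<eta>: "0 < \<eta>"
  obtain g where g: "gb B g" "\<And>x. norm (f x - g x) \<le> \<eta> / 2"
    using assms[of "\<eta> / 2"] \<eta> by auto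
  have "\<forall>\<^sub>F M in sequentially. gn M g \<le> B + \<eta> / 2" using g(1) \<eta> unfolding gb_def by (meson half_gt_zero)
  then show "\<forall>\<^sub>F M in sequentially. gn M f \<le> B + \<eta>"
  proof eventually_elim
    case (elim M)
    have "gn M f \<le> gn M g + gn M (\<lambda>x. f x - g x)"
      using gn_add[of M g "\<lambda>x. f x - g x"] by simp
    moreover have "gn M (\<lambda>x. f x - g x) \<le> \<eta> / 2" by (rule gn_bound[OF g(2)])
    ultimately show ?case using elim by simp
  qed
qed

lemma finite_kn_bound:
  assumes "finite F" obtains R where "\<And>k. k \<in> F \<Longrightarrow> kn k \<le> R"
  using assms by (meson bdd_above.unfold bdd_above_finite finite_imageI image_eqI)

lemma eventually_grid_large: "\<forall>\<^sub>F M in sequentially. 0 < M \<and> (R :: real) < real M"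
  using eventually_gt_at_top[of 0] filterlim_at_top_dense[THEN iffD1, OF filterlim_real_sequentially, rule_format, of R]
  by eventually_elim simp

text \<open>On the finite part the grid average is exact by \<open>gn_trig\<close>; the tail
  contributes at most \<open>e / 2\<close> in the sup norm.\<close>

lemma bessel:
  fixes a :: "int ^ 'n \<Rightarrow> complex"
  assumes a: "wle 0 A a" and g: "gb B (\<lambda>x. fser a (cvec x))" and F: "finite F"
  shows "sqrt (\<Sum>k\<in>F. (norm (a k))\<^sup>2) \<le> B"
proof (rule field_le_epsilon)
  fix e :: real assume e: "0 < e"
  obtain G where G: "finite G" "F \<subseteq> G" "wle 0 (e / 2) (\<lambda>k. if k \<in> G then 0 else a k)"
    by (rule wle_tail[OF a _ F, of "e / 2"]) (use e in auto)
  obtain R where R: "\<And>k. k \<in> G \<Longrightarrow> kn k \<le> R" using finite_kn_bound[OF G(1)] by blast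
  have "\<forall>\<^sub>F M in sequentially. gn M (\<lambda>x. fser a (cvec x)) \<le> B + e / 2"
    using g e unfolding gb_def by (meson half_gt_zero)
  with eventually_grid_large[of "2 * R"]
  have "\<forall>\<^sub>F M in sequentially. sqrt (\<Sum>k\<in>F. (norm (a k))\<^sup>2) \<le> B + e"
  proof eventually_elim
    case (elim M)
    let ?t = "\<lambda>x. fser (\<lambda>k. if k \<in> G then 0 else a k) (cvec x)"
    have "sqrt (\<Sum>k\<in>F. (norm (a k))\<^sup>2) \<le> sqrt (\<Sum>k\<in>G. (norm (a k))\<^sup>2)"
      using G by (intro real_sqrt_le_mono sum_mono2) auto
    also have "\<dots> = gn M (\<lambda>x. \<Sum>k\<in>G. a k * ee k (cvec x))"
      by (rule gn_trig[symmetric, OF G(1) R]) (use elim in auto)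
    also have "(\<lambda>x. \<Sum>k\<in>G. a k * ee k (cvec x)) = (\<lambda>x. fser a (cvec x) + - ?t x)"
      using fser_split[OF a G(1)] by auto
    also have "gn M \<dots> \<le> gn M (\<lambda>x. fser a (cvec x)) + gn M (\<lambda>x. - ?t x)" by (rule gn_add)
    also have "gn M (\<lambda>x. - ?t x) \<le> e / 2" by (rule gn_bound) (use norm_fser_le[OF G(3)] in simp)
    finally show ?case using elim by simp
  qed
  then show "sqrt (\<Sum>k\<in>F. (norm (a k))\<^sup>2) \<le> B + e" by (auto simp: eventually_sequentially)
qed

lemma qn_eventually:
  assumes "sqrt (\<Sum>k\<in>F. (norm (a k))\<^sup>2) \<le> B" "0 < \<eta>"
  shows "\<forall>\<^sub>F M in sequentially. qn M F a \<le> B + \<eta>"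
proof -
  have "(\<lambda>M. pi / real M * (\<Sum>k\<in>F. kn k * norm (a k))) \<longlonglongrightarrow> 0 * (\<Sum>k\<in>F. kn k * norm (a k))"
    by (intro tendsto_mult tendsto_const lim_const_over_n)
  then have "\<forall>\<^sub>F M in sequentially. pi / real M * (\<Sum>k\<in>F. kn k * norm (a k)) < \<eta>"
    using order_tendstoD(2)[of _ _ sequentially \<eta>] assms(2) by simp
  then show ?thesis by eventually_elim (use assms in \<open>simp add: qn_def\<close>)
qed

abbreviation noff :: "'n::finite itself \<Rightarrow> real" where
  "noff _ \<equiv> sqrt (card (offsets :: (int ^ 'n) set))"

lemma noff_ge_1: "1 \<le> noff TYPE('n::finite)"
  using card_offsets_ge_1[where 'n = 'n] by simp

text \<open>For fine grids the rounding term of \<open>qn\<close> drops out, so only the l2 norm of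
  the coefficients is left.\<close>

lemma gb_fser_comp:
  fixes a :: "int ^ 'n \<Rightarrow> complex"
  assumes U: "half_lipschitz U" and a: "wle 0 A a" "l2le 0 B a"
  shows "gb (noff TYPE('n) * B) (\<lambda>x. fser a (cvec (x + U x)))"
proof (rule gb_approx)
  fix \<eta> :: real assume \<eta>: "0 < \<eta>"
  obtain F where F: "finite F" "wle 0 \<eta> (\<lambda>k. if k \<in> F then 0 else a k)"
    by (rule wle_tail[OF a(1) \<eta>, of "{}"]) auto
  obtain R where R: "\<And>k. k \<in> F \<Longrightarrow> kn k \<le> R" using finite_kn_bound[OF F(1)] by blast
  let ?g = "\<lambda>x. \<Sum>k\<in>F. a k * ee k (cvec (x + U x))"
  have "gb (noff TYPE('n) * B) ?g" unfolding gb_def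
  proof safe
    fix e :: real assume e: "0 < e"
    have B: "sqrt (\<Sum>k\<in>F. (norm (a k))\<^sup>2) \<le> B" using a(2) F(1) by (auto simp: l2le_def)
    have "0 < e / noff TYPE('n)" using e noff_ge_1[where 'n = 'n] by simp
    from qn_eventually[OF B this] eventually_grid_large[of "2 * R"]
    show "\<forall>\<^sub>F M in sequentially. gn M ?g \<le> noff TYPE('n) * B + e"
    proof eventually_elim
      case (elim M)
      have "gn M ?g \<le> noff TYPE('n) * qn M F a"
        by (rule gn_trig_comp[OF U F(1) R]) (use elim in auto)
      also have "\<dots> \<le> noff TYPE('n) * (B + e / noff TYPE('n))"
        by (intro mult_left_mono elim) auto
      also have "\<dots> = noff TYPE('n) * B + e"
        using noff_ge_1[where 'n = 'n] by (simp add: distrib_left)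
      finally show ?case .
    qed
  qed
  moreover have "norm (fser a (cvec (x + U x)) - ?g x) \<le> \<eta>" for x
    using fser_split[OF a(1) F(1), of "cvec (x + U x)"] norm_fser_le[OF F(2), of "cvec (x + U x)"] by simp
  ultimately show "\<exists>g. gb (noff TYPE('n) * B) g \<and> (\<forall>x. norm (fser a (cvec (x + U x)) - g x) \<le> \<eta>)"
    by blast
qed

text \<open>The l2 counterpart of \<open>wn_comp_diff\<close>: the displacement is gained as a
  factor although the series is only measured in l2. The bound \<open>A\<close> serves to cut off
  the tail.\<close>

lemma gb_fser_comp_diff:
  fixes a :: "int ^ 'n \<Rightarrow> complex"
  assumes U: "half_lipschitz U" and a: "wle \<sigma> A a" "l2le \<sigma> B a"
    and Z: "\<And>x i. norm (Z x $ i) \<le> \<rho>" and \<sigma>: "0 < \<sigma>" "real CARD('n) * \<rho> / \<sigma> \<le> 1 / 2"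
  shows "gb (noff TYPE('n) * (2 * (real CARD('n) * \<rho> / \<sigma>)) * B)
    (\<lambda>x. fser a (cvec (x + U x) + Z x) - fser a (cvec (x + U x)))"
proof (rule gb_approx)
  fix \<eta> :: real assume \<eta>: "0 < \<eta>"
  have \<rho>: "0 \<le> \<rho>" using Z by (meson norm_ge_zero order.trans)
  \<comment> \<open>This turns the smallness hypothesis into \<open>\<rho> \<le> \<sigma>\<close>,
    so displaced points remain in the strip where the series converges.\<close>
  have "1 \<le> real CARD('n)" by simp
  then have "1 * \<rho> \<le> real CARD('n) * \<rho>" using \<rho> by (intro mult_right_mono)
  moreover have "real CARD('n) * \<rho> \<le> \<sigma> / 2" using \<sigma> by (simp add: field_simps)
  ultimately have "\<rho> \<le> \<sigma>" using \<sigma>(1) by linarith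
  have st: "cvec (x + U x) + Z x \<in> strip \<sigma>" "cvec (x + U x) \<in> strip \<sigma>" for x
    using order.trans[OF order.trans[OF abs_Im_le_cmod Z] \<open>\<rho> \<le> \<sigma>\<close>] \<sigma>(1) by (auto simp: strip_def)
  obtain F where F: "finite F" "wle \<sigma> (\<eta> / 2) (\<lambda>k. if k \<in> F then 0 else a k)"
    by (rule wle_tail[OF a(1), of "\<eta> / 2" "{}"]) (use \<eta> in auto)
  obtain R where R: "\<And>k. k \<in> F \<Longrightarrow> kn k \<le> R" using finite_kn_bound[OF F(1)] by blast
  let ?c = "noff TYPE('n) * (2 * (real CARD('n) * \<rho> / \<sigma>))"
  let ?g = "\<lambda>x. \<Sum>k\<in>F. a k * ee k (cvec (x + U x)) * (exp (\<i> * cfreq k (Z x)) - 1)"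
  have c: "0 \<le> ?c" using \<rho> \<sigma> by simp
  have "gb (?c * B) ?g" unfolding gb_def
  proof safe
    fix e :: real assume e: "0 < e"
    have B: "sqrt (\<Sum>k\<in>F. (norm (exp (\<sigma> * kn k) * a k))\<^sup>2) \<le> B"
      using a(2) F(1) by (auto simp: l2le_def norm_mult mult.commute)
    have "0 < e / (?c + 1)" using e c by simp
    from qn_eventually[OF B this] eventually_grid_large[of "2 * R"]
    show "\<forall>\<^sub>F M in sequentially. gn M ?g \<le> ?c * B + e"
    proof eventually_elim
      case (elim M)
      have "gn M ?g \<le> ?c * qn M F (\<lambda>k. exp (\<sigma> * kn k) * a k)"
        by (rule gn_trig_comp_exp[OF U F(1) R _ _ Z \<rho> \<sigma>]) (use elim in auto)
      also have "\<dots> \<le> ?c * (B + e / (?c + 1))"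
        by (intro mult_left_mono elim c)
      also have "\<dots> = ?c * B + e * (?c / (?c + 1))"
        by (simp only: distrib_left times_divide_eq_right mult.commute)
      also have "e * (?c / (?c + 1)) \<le> e * 1"
      proof (rule mult_left_mono)
        have "x / (x + 1) \<le> 1" if "0 \<le> x" for x :: real using that by simp
        from this[OF c] show "?c / (?c + 1) \<le> 1" .
      qed (use e in simp)
      finally show ?case by simp
    qed
  qed
  moreover have "norm (fser a (cvec (x + U x) + Z x) - fser a (cvec (x + U x)) - ?g x) \<le> \<eta>" for x
  proof -
    let ?t = "fser (\<lambda>k. if k \<in> F then 0 else a k)"
    have "?g x = (\<Sum>k\<in>F. a k * ee k (cvec (x + U x) + Z x)) - (\<Sum>k\<in>F. a k * ee k (cvec (x + U x)))"
      unfolding sum_subtractf[symmetric]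
      by (intro sum.cong refl) (simp add: ee_add_right, simp add: ee_def algebra_simps)
    then have "fser a (cvec (x + U x) + Z x) - fser a (cvec (x + U x)) - ?g x =
        ?t (cvec (x + U x) + Z x) - ?t (cvec (x + U x))"
      using fser_split[OF a(1) F(1) st(1)[of x]] fser_split[OF a(1) F(1) st(2)[of x]] by simp
    also have "norm \<dots> \<le> \<eta> / 2 + \<eta> / 2"
      using norm_triangle_ineq4[of "?t (cvec (x + U x) + Z x)" "?t (cvec (x + U x))"]
        norm_fser_le[OF F(2) st(1)[of x]] norm_fser_le[OF F(2) st(2)[of x]] by linarith
    finally show ?thesis by simp
  qed
  ultimately show "\<exists>g. gb (?c * B) g \<and>
      (\<forall>x. norm (fser a (cvec (x + U x) + Z x) - fser a (cvec (x + U x)) - g x) \<le> \<eta>)" by blast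
qed

section \<open>Tori shifted in imaginary directions\<close>

definition ivec :: "real \<Rightarrow> real ^ 'n \<Rightarrow> complex ^ 'n" where
  "ivec s \<sigma> = (\<chi> i. \<i> * complex_of_real (s * \<sigma> $ i))"

definition signs :: "(real ^ 'n) set" where
  "signs = {\<sigma>. \<forall>i. \<sigma> $ i \<in> {-1, 1}}"

lemma finite_signs: "finite signs"
  unfolding signs_def by (rule finite_vec_comp) simp

lemma ee_ivec: "ee k (ivec s \<sigma>) = complex_of_real (exp (- s * freq k \<sigma>))"
proof -
  have "\<i> * cfreq k (ivec s \<sigma>) = complex_of_real (- s * freq k \<sigma>)"
    by (simp add: cfreq_def ivec_def freq_def sum_distrib_left sum_negf[symmetric] algebra_simps)
  then show ?thesis unfolding ee_def by (simp only: exp_of_real)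
qed

lemma ivec_norm: "\<sigma> \<in> signs \<Longrightarrow> 0 \<le> s \<Longrightarrow> norm (ivec s \<sigma> $ i) = s"
  by (simp add: ivec_def signs_def norm_mult abs_mult) (metis abs_1 abs_minus_cancel)

lemma ivec_strip: "\<sigma> \<in> signs \<Longrightarrow> 0 \<le> s \<Longrightarrow> cvec x + ivec s \<sigma> \<in> strip s"
  using ivec_norm[of \<sigma> s] order.trans[OF abs_Im_le_cmod, of "ivec s \<sigma> $ _" s] by (simp add: strip_def)

lemma fser_shift: "fser a (z + w) = fser (\<lambda>k. a k * ee k w) z"
  unfolding fser_def by (intro infsum_cong) (simp add: ee_add_right)

lemma norm_ee_ivec_le: "\<sigma> \<in> signs \<Longrightarrow> 0 \<le> s \<Longrightarrow> norm (ee k (ivec s \<sigma>)) \<le> exp (s * kn k)"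
  using norm_ee_strip[OF ivec_strip[of \<sigma> s 0], of k] by (simp add: ee_add_right norm_mult)

lemma l2le_ivec:
  assumes "l2le (s + t) B a" "\<sigma> \<in> signs" "0 \<le> s"
  shows "l2le t B (\<lambda>k. a k * ee k (ivec s \<sigma>))"
  using assms(1) order_refl
proof (rule l2le_mono)
  fix k
  have "norm (a k) * (norm (ee k (ivec s \<sigma>)) * exp (t * kn k)) \<le> norm (a k) * (exp (s * kn k) * exp (t * kn k))"
    by (intro mult_left_mono mult_right_mono norm_ee_ivec_le assms) auto
  then show "norm (a k * ee k (ivec s \<sigma>)) * exp (t * kn k) \<le> norm (a k) * exp ((s + t) * kn k)"
    by (simp add: norm_mult exp_add algebra_simps)
qed

lemma wle_ivec:
  assumes "wle (s + t) B a" "\<sigma> \<in> signs" "0 \<le> s"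
  shows "wle t B (\<lambda>k. a k * ee k (ivec s \<sigma>))"
  using assms(1) order_refl
proof (rule wle_mono)
  fix k
  have "norm (a k) * (norm (ee k (ivec s \<sigma>)) * exp (t * kn k)) \<le> norm (a k) * (exp (s * kn k) * exp (t * kn k))"
    by (intro mult_left_mono mult_right_mono norm_ee_ivec_le assms) auto
  then show "norm (a k * ee k (ivec s \<sigma>)) * exp (t * kn k) \<le> norm (a k) * exp ((s + t) * kn k)"
    by (simp add: norm_mult exp_add algebra_simps)
qed

text \<open>The weight \<open>exp (s * kn k)\<close> is the largest modulus of \<open>ee k\<close> over the finitely many points
  \<open>ivec s \<sigma>\<close>, so the weighted norm reduces to unweighted ones on shifted tori.\<close>
lemma weighted_bessel:
  fixes a :: "int ^ 'n \<Rightarrow> complex"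
  assumes s: "0 \<le> s" and a: "wle s A a"
    and g: "\<And>\<sigma>. \<sigma> \<in> signs \<Longrightarrow> gb B (\<lambda>x. fser a (cvec x + ivec s \<sigma>))"
  shows "l2le s (sqrt (card (signs :: (real ^ 'n) set)) * B) a"
  unfolding l2le_def
proof safe
  fix F :: "(int ^ 'n) set" assume F: "finite F"
  have B: "0 \<le> B"
  proof -
    have "(\<chi> i. 1) \<in> (signs :: (real ^ 'n) set)" by (simp add: signs_def)
    then show ?thesis using gb_nonneg[OF g] by blast
  qed
  have "(\<Sum>k\<in>F. (norm (a k) * exp (s * kn k))\<^sup>2) \<le> (\<Sum>k\<in>F. \<Sum>\<sigma>\<in>signs. (norm (a k * ee k (ivec s \<sigma>)))\<^sup>2)"
  proof (intro sum_mono)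
    fix k :: "int ^ 'n"
    \<comment> \<open>By \<open>ee_ivec\<close> the modulus is
      \<open>exp (- s * freq k \<sigma>)\<close>, largest when the signs of \<open>\<sigma>\<close>
      oppose those of \<open>k\<close>.\<close>
    define \<sigma> :: "real ^ 'n" where "\<sigma> = (\<chi> i. if k $ i \<ge> 0 then -1 else 1)"
    have "\<sigma> \<in> signs" by (simp add: \<sigma>_def signs_def)
    have "freq k \<sigma> = - kn k"
      by (auto simp: freq_def kn_eq_sum \<sigma>_def sum_negf[symmetric] intro!: sum.cong)
    then have "(norm (a k) * exp (s * kn k))\<^sup>2 = (norm (a k * ee k (ivec s \<sigma>)))\<^sup>2"
      by (simp add: norm_mult ee_ivec)
    also have "\<dots> \<le> (\<Sum>\<sigma>\<in>signs. (norm (a k * ee k (ivec s \<sigma>)))\<^sup>2)"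
      by (rule member_le_sum[OF \<open>\<sigma> \<in> signs\<close>]) (auto simp: finite_signs)
    finally show "(norm (a k) * exp (s * kn k))\<^sup>2 \<le> \<dots>" .
  qed
  also have "\<dots> = (\<Sum>\<sigma>\<in>signs. \<Sum>k\<in>F. (norm (a k * ee k (ivec s \<sigma>)))\<^sup>2)" by (rule sum.swap)
  also have "\<dots> \<le> (\<Sum>\<sigma>\<in>(signs :: (real ^ 'n) set). B\<^sup>2)"
  proof (intro sum_mono)
    fix \<sigma> :: "real ^ 'n" assume \<sigma>: "\<sigma> \<in> signs"
    have w: "wle 0 A (\<lambda>k. a k * ee k (ivec s \<sigma>))"
      by (rule wle_ivec) (use a \<sigma> s in auto)
    have "sqrt (\<Sum>k\<in>F. (norm (a k * ee k (ivec s \<sigma>)))\<^sup>2) \<le> B"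
      by (rule bessel[OF w _ F]) (use g[OF \<sigma>] in \<open>simp add: fser_shift\<close>)
    then show "(\<Sum>k\<in>F. (norm (a k * ee k (ivec s \<sigma>)))\<^sup>2) \<le> B\<^sup>2"
      by (simp add: sqrt_le_D)
  qed
  also have "\<dots> = (sqrt (card (signs :: (real ^ 'n) set)) * B)\<^sup>2"
    by (simp add: power_mult_distrib)
  finally show "sqrt (\<Sum>k\<in>F. (norm (a k) * exp (s * kn k))\<^sup>2) \<le> sqrt (card (signs :: (real ^ 'n) set)) * B"
    using B by (intro real_le_lsqrt) (auto intro!: sum_nonneg)
qed

lemma half_lipschitz_zero: "half_lipschitz (\<lambda>x. 0)"
  by (auto simp: half_lipschitz_def intro: order.trans[OF abs_ge_zero])

text \<open>Bessel's inequality with bound 0, applied to the difference.\<close>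

lemma fser_eq_imp_coeff_eq:
  fixes a :: "int ^ 'n \<Rightarrow> complex"
  assumes "wle 0 A a" "wle 0 B b" "\<And>x. fser a (cvec x) = fser b (cvec x)"
  shows "a = b"
proof
  fix k
  have w: "wle 0 (A + norm (- 1 :: complex) * B) (\<lambda>k. a k + (- 1) * b k)"
    by (intro wle_add wle_cmult assms)
  have "fser (\<lambda>k. a k + (- 1) * b k) (cvec x) = 0" for x
    using fser_add[OF assms(1) wle_cmult[OF assms(2)], of "cvec x" "-1"] assms(3) fser_cmult[of "-1" b "cvec x"]
    by simp
  then have "gb 0 (\<lambda>x. fser (\<lambda>k. a k + (- 1) * b k) (cvec x))" by (simp add: gb_zero)
  from bessel[OF w this, of "{k}"] show "a k = b k" by simp
qed

definition herm :: "(int ^ 'n \<Rightarrow> complex) \<Rightarrow> bool" where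
  "herm a \<longleftrightarrow> (\<forall>k. a (- k) = cnj (a k))"

lemma fser_cnj: "cnj (fser a (cvec x)) = fser (\<lambda>k. cnj (a (- k))) (cvec x)"
proof -
  have "cnj (fser a (cvec x)) = (\<Sum>\<^sub>\<infinity>k. cnj (a k) * ee (- k) (cvec x))"
    unfolding fser_def infsum_cnj[symmetric] by (simp add: cnj_ee_cvec)
  also have "\<dots> = (\<Sum>\<^sub>\<infinity>k. cnj (a (- k)) * ee k (cvec x))"
    using infsum_reindex_bij_betw[of uminus UNIV UNIV "\<lambda>k. cnj (a (- k)) * ee k (cvec x)"]
    by (simp add: bij_uminus)
  finally show ?thesis by (simp add: fser_def)
qed

lemma herm_real: "herm a \<Longrightarrow> fser a (cvec x) \<in> \<real>"
  using fser_cnj[of a x] by (simp add: herm_def Reals_cnj_iff)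

text \<open>Conjugating the function reflects and conjugates the coefficients; uniqueness does the
  rest. Thus compositions are seen to have Hermitian coefficients without computing these.\<close>

lemma herm_if_real:
  fixes a :: "int ^ 'n \<Rightarrow> complex"
  assumes a: "wle 0 A a" and r: "\<And>x. fser a (cvec x) \<in> \<real>"
  shows "herm a"
proof -
  have "wle 0 A (\<lambda>k. cnj (a (- k)))"
    unfolding wle_def
  proof safe
    fix F :: "(int ^ 'n) set" assume F: "finite F"
    have "(\<Sum>k\<in>F. norm (cnj (a (- k))) * exp (0 * kn k)) = (\<Sum>k\<in>uminus ` F. norm (a k) * exp (0 * kn k))"
      by (subst sum.reindex) (auto simp: inj_on_def)
    then show "(\<Sum>k\<in>F. norm (cnj (a (- k))) * exp (0 * kn k)) \<le> A" using a F by (auto simp: wle_def)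
  qed
  from fser_eq_imp_coeff_eq[OF a this] have "a = (\<lambda>k. cnj (a (- k)))"
    using r fser_cnj[of a] by (simp add: Reals_cnj_iff)
  then show ?thesis unfolding herm_def by (metis complex_cnj_cnj)
qed

section \<open>Small divisors\<close>

text \<open>The weight is what Cauchy-Schwarz leaves over when the strip shrinks by
  \<open>\<sigma>\<close>; the factor \<open>1 + \<sigma> * kn k\<close> pays for an optional
  derivative. Bounding each divisor separately would give the exponent \<tau> + n/2 instead of
  \<tau>.\<close>

definition small_divisor_bound :: "real ^ 'n \<Rightarrow> real \<Rightarrow> real \<Rightarrow> bool" where
  "small_divisor_bound \<omega> \<tau> C \<longleftrightarrow> 0 < C \<and> (\<forall>k. k \<noteq> 0 \<longrightarrow> freq k \<omega> \<noteq> 0) \<and>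
     (\<forall>\<sigma> F. 0 < \<sigma> \<and> \<sigma> \<le> 1 \<and> finite F \<and> 0 \<notin> F \<longrightarrow>
        (\<Sum>k\<in>F. ((1 + \<sigma> * kn k) * exp (- \<sigma> * kn k) / freq k \<omega>)\<^sup>2) \<le> (C * \<sigma> powr (- \<tau>))\<^sup>2)"

lemma freq_diff: "freq (k - l) x = freq k x - freq l x"
  by (simp add: freq_def algebra_simps sum_subtractf)

lemma int_inverse_square_sum_le:
  "\<exists>C>0. \<forall>M :: int set. finite M \<longrightarrow> (\<Sum>m\<in>M. 1 / (real_of_int \<bar>m\<bar> + 1)\<^sup>2) \<le> C"
proof (intro exI conjI allI impI)
  let ?g = "\<lambda>n. 1 / (real (Suc n))\<^sup>2"
  have s: "summable ?g" using inverse_squares_sums by (auto simp: sums_iff)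
  show "0 < 2 * suminf ?g" using suminf_pos[OF s] by simp
  fix M :: "int set" assume M: "finite M"
  \<comment> \<open>\<open>nat \<bar>m\<bar>\<close> is injective on the nonnegative and on the
    negative integers separately, hence the factor 2 in the bound.\<close>
  have half: "(\<Sum>m\<in>N. 1 / (real_of_int \<bar>m\<bar> + 1)\<^sup>2) \<le> suminf ?g"
    if N: "finite N" "inj_on (\<lambda>m. nat \<bar>m\<bar>) N" for N :: "int set"
  proof -
    have "(\<Sum>m\<in>N. 1 / (real_of_int \<bar>m\<bar> + 1)\<^sup>2) = (\<Sum>n\<in>(\<lambda>m. nat \<bar>m\<bar>) ` N. ?g n)"
      by (subst sum.reindex[OF N(2)]) (intro sum.cong refl, simp add: add.commute)
    also have "\<dots> \<le> suminf ?g" by (rule sum_le_suminf[OF s]) (use N in auto)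
    finally show ?thesis .
  qed
  have "M = {m \<in> M. 0 \<le> m} \<union> {m \<in> M. m < 0}" by auto
  then have "(\<Sum>m\<in>M. 1 / (real_of_int \<bar>m\<bar> + 1)\<^sup>2) =
      (\<Sum>m\<in>{m \<in> M. 0 \<le> m} \<union> {m \<in> M. m < 0}. 1 / (real_of_int \<bar>m\<bar> + 1)\<^sup>2)" by simp
  also have "\<dots> = (\<Sum>m\<in>{m \<in> M. 0 \<le> m}. 1 / (real_of_int \<bar>m\<bar> + 1)\<^sup>2) +
      (\<Sum>m\<in>{m \<in> M. m < 0}. 1 / (real_of_int \<bar>m\<bar> + 1)\<^sup>2)"
    by (rule sum.union_disjoint) (use M in auto)
  also have "\<dots> \<le> suminf ?g + suminf ?g"
    by (intro add_mono half) (use M in \<open>auto simp: inj_on_def\<close>)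
  finally show "(\<Sum>m\<in>M. 1 / (real_of_int \<bar>m\<bar> + 1)\<^sup>2) \<le> 2 * suminf ?g" by simp
qed

text \<open>The divisors \<open>freq k \<omega>\<close> with \<open>kn k \<le> K\<close> are separated by \<open>\<alpha> (2 K)\<^sup>-\<^sup>\<tau>\<close>, so that their inverse
  squares add up like those of the integers.\<close>
lemma inverse_divisor_sum_le:
  fixes \<omega> :: "real ^ 'n"
  assumes \<alpha>: "0 < \<alpha>" "\<And>k. k \<noteq> 0 \<Longrightarrow> \<alpha> * kn k powr (- \<tau>) \<le> \<bar>freq k \<omega>\<bar>" and \<tau>: "0 \<le> \<tau>"
  shows "\<exists>c>0. \<forall>K F. 1 \<le> K \<and> finite F \<and> 0 \<notin> F \<and> (\<forall>k\<in>F. kn k \<le> K) \<longrightarrow>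
     (\<Sum>k\<in>F. 1 / (freq k \<omega>)\<^sup>2) \<le> c * (K powr \<tau>)\<^sup>2"
proof -
  obtain C0 where C0: "0 < C0" "\<And>M :: int set. finite M \<Longrightarrow> (\<Sum>m\<in>M. 1 / (real_of_int \<bar>m\<bar> + 1)\<^sup>2) \<le> C0"
    using int_inverse_square_sum_le by blast
  define c where "c = 9 * C0 * (2 powr \<tau>)\<^sup>2 / \<alpha>\<^sup>2"
  have "0 < c" using C0 \<alpha> by (simp add: c_def)
  moreover have "(\<Sum>k\<in>F. 1 / (freq k \<omega>)\<^sup>2) \<le> c * (K powr \<tau>)\<^sup>2"
    if K: "1 \<le> K" and F: "finite F" "0 \<notin> F" "\<forall>k\<in>F. kn k \<le> K" for K F
  proof -
    define \<delta> where "\<delta> = \<alpha> * (2 * K) powr (- \<tau>)"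
    have \<delta>: "0 < \<delta>" using \<alpha> K by (simp add: \<delta>_def)
    have low: "\<delta> \<le> \<bar>freq k \<omega>\<bar>" if "k \<noteq> 0" "kn k \<le> 2 * K" for k
    proof -
      have "(2 * K) powr (- \<tau>) \<le> kn k powr (- \<tau>)"
        by (rule powr_mono2') (use \<tau> that kn_ge_1[of k] in auto)
      then show ?thesis using \<alpha>(2)[OF that(1)] \<alpha>(1) unfolding \<delta>_def
        by (meson mult_left_mono less_imp_le order.trans)
    qed
    \<comment> \<open>Index of the interval of length \<open>\<delta>\<close> that contains the
      divisor. Two divisors never share one, because \<open>k - l\<close> has norm at most
      \<open>2 * K\<close>.\<close>
    define m where "m k = \<lfloor>freq k \<omega> / \<delta>\<rfloor>" for k
    have m: "of_int (m k) * \<delta> \<le> freq k \<omega>" "freq k \<omega> < (of_int (m k) + 1) * \<delta>" for k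
    proof -
      have "of_int (m k) \<le> freq k \<omega> / \<delta>" "freq k \<omega> / \<delta> < of_int (m k) + 1"
        unfolding m_def by linarith+
      then show "of_int (m k) * \<delta> \<le> freq k \<omega>" "freq k \<omega> < (of_int (m k) + 1) * \<delta>"
        using \<delta> by (simp_all add: field_simps)
    qed
    have inj: "inj_on m F"
    proof (rule inj_onI, rule ccontr)
      fix k l assume kl: "k \<in> F" "l \<in> F" "m k = m l" "k \<noteq> l"
      have "kn (k - l) \<le> kn k + kn l" using kn_triangle[of k "- l"] by simp
      also have "\<dots> \<le> 2 * K" using bspec[OF F(3) kl(1)] bspec[OF F(3) kl(2)] by linarith
      finally have "\<delta> \<le> \<bar>freq k \<omega> - freq l \<omega>\<bar>" using low[of "k - l"] kl(4) by (simp add: freq_diff)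
      moreover have "\<bar>freq k \<omega> - freq l \<omega>\<bar> < \<delta>"
        using m[of k] m[of l] unfolding kl(3) by (simp add: algebra_simps abs_if)
      ultimately show False by simp
    qed
    have divisor_le: "1 / (freq k \<omega>)\<^sup>2 \<le> 9 / \<delta>\<^sup>2 * (1 / (real_of_int \<bar>m k\<bar> + 1)\<^sup>2)" if k: "k \<in> F" for k
    proof -
      have d: "\<delta> \<le> \<bar>freq k \<omega>\<bar>" using low[of k] F k K by fastforce
      \<comment> \<open>For negative \<open>m k\<close> the floor rounds away from 0, which costs a
        second \<open>\<delta>\<close>. As
        \<open>\<delta> \<le> \<bar>freq k \<omega>\<bar>\<close>, the constant 3, hence 9 after
        squaring, covers both signs.\<close>
      have "(real_of_int \<bar>m k\<bar> + 1) * \<delta> \<le> 3 * \<bar>freq k \<omega>\<bar>"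
      proof (cases "m k \<ge> 0")
        case True
        then show ?thesis using m(1)[of k] d \<delta> by (simp add: algebra_simps)
      next
        case False
        then have "freq k \<omega> < 0"
          using m(2)[of k] mult_nonpos_nonneg[of "of_int (m k) + 1" \<delta>] \<delta> by linarith
        then have "- (of_int (m k) + 1) * \<delta> \<le> \<bar>freq k \<omega>\<bar>" using m(2)[of k] by (simp add: algebra_simps)
        then show ?thesis using False d by (simp add: algebra_simps)
      qed
      then have "((real_of_int \<bar>m k\<bar> + 1) * \<delta>)\<^sup>2 \<le> (3 * \<bar>freq k \<omega>\<bar>)\<^sup>2"
        using \<delta> by (intro power_mono) auto
      then have le: "(real_of_int \<bar>m k\<bar> + 1)\<^sup>2 * \<delta>\<^sup>2 \<le> 9 * (freq k \<omega>)\<^sup>2" by (simp add: power_mult_distrib)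
      have "0 < (freq k \<omega>)\<^sup>2" "0 < (real_of_int \<bar>m k\<bar> + 1)\<^sup>2 * \<delta>\<^sup>2"
        using d \<delta> by (auto simp: zero_less_mult_iff) 
      then show ?thesis using le by (simp add: divide_simps mult_ac)
    qed
    have "(\<Sum>k\<in>F. 1 / (freq k \<omega>)\<^sup>2) \<le> (\<Sum>k\<in>F. 9 / \<delta>\<^sup>2 * (1 / (real_of_int \<bar>m k\<bar> + 1)\<^sup>2))"
      by (intro sum_mono divisor_le)
    also have "\<dots> = 9 / \<delta>\<^sup>2 * (\<Sum>n\<in>m ` F. 1 / (real_of_int \<bar>n\<bar> + 1)\<^sup>2)"
      by (subst sum.reindex[OF inj]) (simp add: sum_distrib_left)
    also have "\<dots> \<le> 9 / \<delta>\<^sup>2 * C0" using F(1) by (intro mult_left_mono C0) auto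
    also have "\<dots> = c * (K powr \<tau>)\<^sup>2"
      using K \<alpha>(1) by (simp add: c_def \<delta>_def powr_minus powr_mult power_mult_distrib field_simps)
    finally show ?thesis .
  qed
  ultimately show ?thesis by blast
qed

text \<open>The frequencies are sorted into annuli \<open>i - 1 < \<sigma> * kn k \<le> i\<close>.
  On the \<open>i\<close>-th one the inverse squares add up to at most
  \<open>c * ((i / \<sigma>) powr \<tau>)^2\<close>, and the exponential decay of the weight beats
  the power of \<open>i\<close>.\<close>

lemma ex_small_divisor_bound:
  fixes \<omega> :: "real ^ 'n"
  assumes "diophantine \<tau> \<omega>" and \<tau>: "0 \<le> \<tau>"
  shows "\<exists>C. small_divisor_bound \<omega> \<tau> C"
proof -
  obtain \<alpha> where \<alpha>: "0 < \<alpha>" "\<And>k. k \<noteq> 0 \<Longrightarrow> \<alpha> * kn k powr (- \<tau>) \<le> \<bar>freq k \<omega>\<bar>"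
    using assms(1) unfolding diophantine_def kn_def by auto
  obtain c where c: "0 < c" "\<And>K F. 1 \<le> K \<Longrightarrow> finite F \<Longrightarrow> 0 \<notin> F \<Longrightarrow> \<forall>k\<in>F. kn k \<le> K \<Longrightarrow>
     (\<Sum>k\<in>F. 1 / (freq k \<omega>)\<^sup>2) \<le> c * (K powr \<tau>)\<^sup>2"
    using inverse_divisor_sum_le[OF \<alpha> \<tau>] by metis
  \<comment> \<open>\<open>N\<close> is an integer above \<open>2 + 2 * \<tau>\<close> or equal to
    it, so \<open>fact N * exp (1 + i)\<close> bounds the powers of \<open>i\<close>. Together with
    \<open>exp (2 - 2 * i)\<close> from the weight this leaves \<open>exp 3 * exp (- i)\<close>, a
    geometric series.\<close>
  define N where "N = nat \<lceil>2 * \<tau>\<rceil> + 2"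
  define G :: real where "G = fact N * exp 3 * (1 / (1 - exp (- 1)))"
  have e1: "0 < 1 - exp (- 1 :: real)" by simp
  have G: "0 < G" unfolding G_def using e1 by (intro mult_pos_pos divide_pos_pos) auto
  have nz: "freq k \<omega> \<noteq> 0" if "k \<noteq> 0" for k
  proof -
    have "0 < \<alpha> * kn k powr (- \<tau>)" using \<alpha>(1) kn_ge_1[OF that] by simp
    then show ?thesis using \<alpha>(2)[OF that] by auto
  qed
  have main: "(\<Sum>k\<in>F. ((1 + \<sigma> * kn k) * exp (- \<sigma> * kn k) / freq k \<omega>)\<^sup>2) \<le> (sqrt (c * G) * \<sigma> powr (- \<tau>))\<^sup>2"
    if \<sigma>: "0 < \<sigma>" "\<sigma> \<le> 1" and F: "finite F" "0 \<notin> F" for \<sigma> F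
  proof -
    define j where "j k = nat \<lceil>\<sigma> * kn k\<rceil>" for k :: "int ^ 'n"
    have j: "\<sigma> * kn k \<le> real (j k)" "real (j k) < \<sigma> * kn k + 1" "1 \<le> j k" if "k \<in> F" for k
    proof -
      have "k \<noteq> 0" using F that by auto
      then have "0 < \<sigma> * kn k" using kn_ge_1[of k] \<sigma> by auto
      then show "\<sigma> * kn k \<le> real (j k)" "real (j k) < \<sigma> * kn k + 1" "1 \<le> j k"
        unfolding j_def by linarith+
    qed
    have "(\<Sum>k\<in>F. ((1 + \<sigma> * kn k) * exp (- \<sigma> * kn k) / freq k \<omega>)\<^sup>2) =
       (\<Sum>i\<in>j ` F. \<Sum>k\<in>{k \<in> F. j k = i}. ((1 + \<sigma> * kn k) * exp (- \<sigma> * kn k) / freq k \<omega>)\<^sup>2)"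
      by (rule sum.image_gen[OF F(1)])
    also have "\<dots> \<le> (\<Sum>i\<in>j ` F. c * fact N * exp 3 * (\<sigma> powr (- \<tau>))\<^sup>2 * exp (- real i))"
    proof (intro sum_mono)
      fix i assume "i \<in> j ` F"
      then obtain k0 where k0: "k0 \<in> F" "i = j k0" by auto
      have i: "1 \<le> i" using j(3)[OF k0(1)] k0(2) by simp
      let ?A = "(1 + real i) * exp (1 - real i)"
      have "(\<Sum>k\<in>{k \<in> F. j k = i}. ((1 + \<sigma> * kn k) * exp (- \<sigma> * kn k) / freq k \<omega>)\<^sup>2) \<le>
          (\<Sum>k\<in>{k \<in> F. j k = i}. ?A\<^sup>2 * (1 / (freq k \<omega>)\<^sup>2))"
      proof (intro sum_mono)
        fix k assume k: "k \<in> {k \<in> F. j k = i}"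
        have "(1 + \<sigma> * kn k) * exp (- \<sigma> * kn k) \<le> ?A"
          using j[of k] k \<sigma> by (intro mult_mono) auto
        then have "((1 + \<sigma> * kn k) * exp (- \<sigma> * kn k))\<^sup>2 \<le> ?A\<^sup>2"
          using \<sigma> by (intro power_mono) auto
        then have "((1 + \<sigma> * kn k) * exp (- \<sigma> * kn k))\<^sup>2 * (1 / (freq k \<omega>)\<^sup>2) \<le> ?A\<^sup>2 * (1 / (freq k \<omega>)\<^sup>2)"
          by (rule mult_right_mono) auto
        then show "((1 + \<sigma> * kn k) * exp (- \<sigma> * kn k) / freq k \<omega>)\<^sup>2 \<le> ?A\<^sup>2 * (1 / (freq k \<omega>)\<^sup>2)"
          by (simp add: power_divide)
      qed
      also have "\<dots> = ?A\<^sup>2 * (\<Sum>k\<in>{k \<in> F. j k = i}. 1 / (freq k \<omega>)\<^sup>2)" by (simp add: sum_distrib_left)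
      also have "\<dots> \<le> ?A\<^sup>2 * (c * ((real i / \<sigma>) powr \<tau>)\<^sup>2)"
      proof (intro mult_left_mono c(2))
        show "1 \<le> real i / \<sigma>" using i \<sigma> by (simp add: field_simps)
        show "\<forall>k\<in>{k \<in> F. j k = i}. kn k \<le> real i / \<sigma>" using j(1) \<sigma> by (auto simp: field_simps)
      qed (use F in auto)
      also have "(real i / \<sigma>) powr \<tau> = real i powr \<tau> * \<sigma> powr (- \<tau>)"
        using \<sigma> by (simp add: powr_divide powr_minus_divide)
      also have "?A\<^sup>2 * (c * (real i powr \<tau> * \<sigma> powr (- \<tau>))\<^sup>2) =
          c * (\<sigma> powr (- \<tau>))\<^sup>2 * ((1 + real i)\<^sup>2 * (real i powr \<tau>)\<^sup>2 * (exp (1 - real i))\<^sup>2)"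
        by (simp add: power_mult_distrib mult_ac)
      also have "\<dots> \<le> c * (\<sigma> powr (- \<tau>))\<^sup>2 * (fact N * exp 3 * exp (- real i))"
      proof (intro mult_left_mono)
        have "(real i powr \<tau>)\<^sup>2 = real i powr (2 * \<tau>)" by (simp add: power2_eq_square powr_add[symmetric])
        also have "\<dots> \<le> (1 + real i) powr (2 * \<tau>)" using \<tau> by (intro powr_mono2) auto
        also have "\<dots> \<le> (1 + real i) powr (real (nat \<lceil>2 * \<tau>\<rceil>))"
          by (rule powr_mono) linarith+
        also have "\<dots> = (1 + real i) ^ nat \<lceil>2 * \<tau>\<rceil>" by (rule powr_realpow) simp
        finally have "(1 + real i)\<^sup>2 * (real i powr \<tau>)\<^sup>2 \<le> (1 + real i)\<^sup>2 * (1 + real i) ^ nat \<lceil>2 * \<tau>\<rceil>"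
          by (intro mult_left_mono) auto
        also have "\<dots> = (1 + real i) ^ N" by (simp add: N_def power_add power2_eq_square mult_ac)
        also have "\<dots> \<le> fact N * exp (1 + real i)" by (rule power_le_fact_exp) simp
        finally have "(1 + real i)\<^sup>2 * (real i powr \<tau>)\<^sup>2 * (exp (1 - real i))\<^sup>2 \<le>
            fact N * exp (1 + real i) * (exp (1 - real i))\<^sup>2"
          by (rule mult_right_mono) auto
        also have "\<dots> = fact N * exp 3 * exp (- real i)"
          by (simp add: power2_eq_square mult_exp_exp mult.assoc)
        finally show "(1 + real i)\<^sup>2 * (real i powr \<tau>)\<^sup>2 * (exp (1 - real i))\<^sup>2 \<le> fact N * exp 3 * exp (- real i)" .
      qed (use c in auto)
      also have "\<dots> = c * fact N * exp 3 * (\<sigma> powr (- \<tau>))\<^sup>2 * exp (- real i)" by (simp only: mult_ac)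
      finally show "(\<Sum>k\<in>{k \<in> F. j k = i}. ((1 + \<sigma> * kn k) * exp (- \<sigma> * kn k) / freq k \<omega>)\<^sup>2) \<le> \<dots>" .
    qed
    also have "\<dots> = c * fact N * exp 3 * (\<sigma> powr (- \<tau>))\<^sup>2 * (\<Sum>i\<in>j ` F. exp (- 1) ^ i)"
      by (simp add: sum_distrib_left exp_of_nat_mult[symmetric])
    also have "\<dots> \<le> c * fact N * exp 3 * (\<sigma> powr (- \<tau>))\<^sup>2 * (1 / (1 - exp (- 1)))"
    proof (intro mult_left_mono)
      have "(\<lambda>i. exp (- 1 :: real) ^ i) sums (1 / (1 - exp (- 1)))" by (rule geometric_sums) simp
      then show "(\<Sum>i\<in>j ` F. exp (- 1 :: real) ^ i) \<le> 1 / (1 - exp (- 1))"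
        using sum_le_suminf[of "\<lambda>i. exp (- 1 :: real) ^ i" "j ` F"] F(1) by (auto simp: sums_iff)
    qed (use c in auto)
    also have "\<dots> = c * G * (\<sigma> powr (- \<tau>))\<^sup>2" by (simp add: G_def)
    also have "\<dots> = (sqrt (c * G) * \<sigma> powr (- \<tau>))\<^sup>2" using c G by (simp add: power_mult_distrib)
    finally show ?thesis .
  qed
  have "0 < sqrt (c * G)" using c G by simp
  then show ?thesis unfolding small_divisor_bound_def using main nz by blast
qed

section \<open>Solution of the linearised equation\<close>

definition divis :: "real ^ 'n \<Rightarrow> (int ^ 'n \<Rightarrow> complex) \<Rightarrow> int ^ 'n \<Rightarrow> complex" where
  "divis \<omega> e k = (if k = 0 then 0 else e k / (\<i> * complex_of_real (freq k \<omega>)))"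

text \<open>Cauchy-Schwarz pairs the l2 bound on \<open>e\<close> with that on the weighted inverse
  divisors, which gives an l1 bound without a loss from the number of frequencies.\<close>

lemma wle_divis:
  fixes \<omega> :: "real ^ 'n"
  assumes R: "small_divisor_bound \<omega> \<tau> C" and e: "l2le s \<epsilon> e" and s: "t < s" "s \<le> t + 1"
  shows "wle t (C * (s - t) powr (- \<tau>) * \<epsilon>) (divis \<omega> e)"
    and "wle t (C * (s - t) powr (- \<tau> - 1) * \<epsilon>) (knm (divis \<omega> e))"
proof -
  define \<sigma> where "\<sigma> = s - t"
  have \<sigma>: "0 < \<sigma>" "\<sigma> \<le> 1" using s by (auto simp: \<sigma>_def)
  have C: "0 < C" using R by (simp add: small_divisor_bound_def)
  \<comment> \<open>One estimate for both claims: \<open>w = 1\<close> with \<open>B = 1\<close>,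
    and \<open>w = kn\<close> with \<open>B = 1 / \<sigma>\<close>.\<close>
  have gen: "(\<Sum>k\<in>F. w k * (norm (divis \<omega> e k) * exp (t * kn k))) \<le> B * (C * \<sigma> powr (- \<tau>)) * \<epsilon>"
    if F: "finite F" and w: "\<And>k. 0 \<le> w k" "\<And>k. w k \<le> B * (1 + \<sigma> * kn k)" and B: "0 \<le> B" for F w B
  proof -
    let ?D = "\<lambda>k. (1 + \<sigma> * kn k) * exp (- \<sigma> * kn k) / freq k \<omega>"
    let ?E = "\<lambda>k. norm (e k) * exp (s * kn k)"
    have "(\<Sum>k\<in>F. w k * (norm (divis \<omega> e k) * exp (t * kn k))) \<le>
       (\<Sum>k\<in>F - {0}. B * (\<bar>?D k\<bar> * \<bar>?E k\<bar>))"
    proof -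
      have "(\<Sum>k\<in>F. w k * (norm (divis \<omega> e k) * exp (t * kn k))) =
          (\<Sum>k\<in>F - {0}. w k * (norm (divis \<omega> e k) * exp (t * kn k)))"
        by (rule sum.mono_neutral_right) (use F in \<open>auto simp: divis_def\<close>)
      also have "\<dots> \<le> (\<Sum>k\<in>F - {0}. B * (\<bar>?D k\<bar> * \<bar>?E k\<bar>))"
      proof (intro sum_mono)
        fix k assume k: "k \<in> F - {0}"
        have "exp (t * kn k) = exp (- \<sigma> * kn k) * exp (s * kn k)"
          by (simp add: \<sigma>_def exp_add[symmetric] algebra_simps)
        then have eq: "norm (divis \<omega> e k) * exp (t * kn k) = exp (- \<sigma> * kn k) / \<bar>freq k \<omega>\<bar> * ?E k"
          using k by (simp add: divis_def norm_divide norm_mult)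
        have "w k * (norm (divis \<omega> e k) * exp (t * kn k)) \<le>
           B * (1 + \<sigma> * kn k) * (exp (- \<sigma> * kn k) / \<bar>freq k \<omega>\<bar> * ?E k)"
          unfolding eq by (intro mult_right_mono w) auto
        also have "\<dots> = B * (\<bar>?D k\<bar> * \<bar>?E k\<bar>)"
          using \<sigma> by (simp add: abs_mult)
        finally show "w k * (norm (divis \<omega> e k) * exp (t * kn k)) \<le> B * (\<bar>?D k\<bar> * \<bar>?E k\<bar>)" .
      qed
      finally show ?thesis .
    qed
    also have "\<dots> = B * (\<Sum>k\<in>F - {0}. \<bar>?D k\<bar> * \<bar>?E k\<bar>)" by (simp add: sum_distrib_left)
    also have "\<dots> \<le> B * (L2_set ?D (F - {0}) * L2_set ?E (F - {0}))"
      by (intro mult_left_mono L2_set_mult_ineq B)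
    also have "\<dots> \<le> B * ((C * \<sigma> powr (- \<tau>)) * \<epsilon>)"
    proof (intro mult_left_mono mult_mono B)
      have "(\<Sum>k\<in>F - {0}. (?D k)\<^sup>2) \<le> (C * \<sigma> powr (- \<tau>))\<^sup>2"
        using R \<sigma> F unfolding small_divisor_bound_def by blast
      then show "L2_set ?D (F - {0}) \<le> C * \<sigma> powr (- \<tau>)"
        unfolding L2_set_def using C by (intro real_le_lsqrt) (auto intro!: sum_nonneg)
      show "L2_set ?E (F - {0}) \<le> \<epsilon>" using e F unfolding L2_set_def l2le_def by auto
    qed (use C in auto)
    finally show ?thesis by (simp only: mult.assoc)
  qed
  show "wle t (C * (s - t) powr (- \<tau>) * \<epsilon>) (divis \<omega> e)"
    unfolding wle_def using gen[of _ "\<lambda>_. 1" 1] \<sigma> by (simp add: \<sigma>_def)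
  show "wle t (C * (s - t) powr (- \<tau> - 1) * \<epsilon>) (knm (divis \<omega> e))"
    unfolding wle_def
  proof safe
    fix F :: "(int ^ 'n) set" assume F: "finite F"
    have "(\<Sum>k\<in>F. kn k * (norm (divis \<omega> e k) * exp (t * kn k))) \<le> 1 / \<sigma> * (C * \<sigma> powr (- \<tau>)) * \<epsilon>"
      by (rule gen[OF F]) (use \<sigma> in \<open>auto simp: field_simps\<close>)
    also have "1 / \<sigma> * (C * \<sigma> powr (- \<tau>)) = C * \<sigma> powr (- \<tau> - 1)"
      using \<sigma> by (simp add: powr_diff)
    finally show "(\<Sum>k\<in>F. norm (knm (divis \<omega> e) k) * exp (t * kn k)) \<le> C * (s - t) powr (- \<tau> - 1) * \<epsilon>"
      by (simp add: \<sigma>_def mult.assoc)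
  qed
qed

section \<open>The iteration step\<close>

definition rvec :: "('n \<Rightarrow> int ^ 'n \<Rightarrow> complex) \<Rightarrow> real ^ 'n \<Rightarrow> real ^ 'n" where
  "rvec u x = (\<chi> i. Re (fser (u i) (cvec x)))"

lemma rvec_nth: "herm (u i) \<Longrightarrow> complex_of_real (rvec u x $ i) = fser (u i) (cvec x)"
  using herm_real[of "u i" x] by (simp add: rvec_def of_real_Re)

lemma cvec_rvec: "(\<And>i. herm (u i)) \<Longrightarrow> cvec (rvec u x) = (\<chi> i. fser (u i) (cvec x))"
  by (simp add: vec_eq_iff rvec_nth)

lemma half_lipschitz_rvec:
  assumes "\<And>i. wle 0 (A i) (u i)" "\<And>i. wle 0 g (knm (u i))" "g \<le> 1 / 2"
  shows "half_lipschitz (rvec u)"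
  unfolding half_lipschitz_def
proof (intro conjI allI impI ballI)
  fix x y :: "real ^ 'a" and r i assume r: "\<forall>i. \<bar>x $ i - y $ i\<bar> \<le> r"
  have r0: "0 \<le> r" using r by (meson abs_ge_zero order.trans)
  have "\<bar>rvec u x $ i - rvec u y $ i\<bar> \<le> norm (fser (u i) (cvec x) - fser (u i) (cvec y))"
    using abs_Re_le_cmod[of "fser (u i) (cvec x) - fser (u i) (cvec y)"] by (simp add: rvec_def)
  also have "\<dots> \<le> r * g" by (rule fser_lipschitz[OF assms(1,2)]) (use r in auto)
  also have "\<dots> \<le> r * (1 / 2)" by (rule mult_left_mono[OF assms(3) r0])
  finally show "\<bar>rvec u x $ i - rvec u y $ i\<bar> \<le> r / 2" by simp
next
  fix x v :: "real ^ 'a" assume "v \<in> period_lattice"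
  then show "rvec u (x + v) = rvec u x" by (simp add: rvec_def fser_periodic vec_eq_iff)
qed

text \<open>\<open>x + rvec u x\<close> conjugates \<open>\<omega> + P - Y\<close> to \<open>\<omega>\<close> up to the error with coefficients \<open>e\<close>.\<close>
definition kam_state ::
  "real ^ 'n \<Rightarrow> ('n \<Rightarrow> complex ^ 'n \<Rightarrow> complex) \<Rightarrow> real \<Rightarrow> real \<Rightarrow> real \<Rightarrow>
   ('n \<Rightarrow> int ^ 'n \<Rightarrow> complex) \<Rightarrow> ('n \<Rightarrow> int ^ 'n \<Rightarrow> complex) \<Rightarrow> real ^ 'n \<Rightarrow> bool" where
  "kam_state \<omega> P s \<gamma> \<epsilon> u e Y \<longleftrightarrow>
     (\<forall>i. (\<exists>A. wle s A (u i)) \<and> wle s \<gamma> (knm (u i)) \<and> herm (u i) \<and>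
          (\<exists>A. wle s A (e i)) \<and> l2le s \<epsilon> (e i) \<and> herm (e i)) \<and>
     (\<forall>x i. fser (e i) (cvec x) = P i (cvec (x + rvec u x)) - complex_of_real (Y $ i)
          - fser (dcoef \<omega> (u i)) (cvec x))"

lemma herm_divis: "herm e \<Longrightarrow> herm (divis \<omega> e)"
  by (auto simp: herm_def divis_def freq_def sum_negf)

text \<open>The equation \<open>\<partial>\<^sub>\<omega> W = e - [e]\<close> in terms of
  coefficients.\<close>

lemma dcoef_divis:
  assumes "\<And>k. k \<noteq> 0 \<Longrightarrow> freq k \<omega> \<noteq> 0"
  shows "dcoef \<omega> (divis \<omega> e) = (\<lambda>k. if k \<in> {0} then 0 else e k)"
proof
  fix k
  show "dcoef \<omega> (divis \<omega> e) k = (if k \<in> {0} then 0 else e k)"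
    using assms[of k] by (cases "k = 0") (auto simp: dcoef_def divis_def)
qed

lemma dcoef_axis_expand:
  assumes "wle s A (knm a)" "z \<in> strip s"
  shows "fser (dcoef h a) z = (\<Sum>j\<in>UNIV. complex_of_real (h $ j) * fser (dcoef (axis j 1) a) z)"
proof -
  interpret bounded_linear "\<lambda>h. fser (dcoef h a) z" by (rule bounded_linear_fser_dcoef[OF assms])
  have "fser (dcoef h a) z = fser (dcoef (\<Sum>j\<in>UNIV. (h $ j) *\<^sub>R axis j 1) a) z"
    using basis_expansion[of h] by (simp add: scalar_mult_eq_scaleR)
  also have "\<dots> = (\<Sum>j\<in>UNIV. (h $ j) *\<^sub>R fser (dcoef (axis j 1) a) z)"
    by (simp add: sum scaleR)
  finally show ?thesis by (simp add: scaleR_conv_of_real)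
qed

lemma rvec_has_derivative:
  fixes w :: "'n \<Rightarrow> int ^ 'n \<Rightarrow> complex"
  assumes w: "\<And>i. wle 0 (C i) (w i)" "\<And>i. wle 0 D (knm (w i))"
  shows "(rvec w has_derivative (\<lambda>h. \<chi> j. Re (fser (dcoef h (w j)) (cvec x)))) (at x)"
proof (rule has_derivative_componentwise_within[THEN iffD2], rule ballI)
  fix b :: "real ^ 'n" assume "b \<in> Basis"
  then obtain j where b: "b = axis j 1" by (auto simp: Basis_vec_def)
  have "((\<lambda>x. Re (fser (w j) (cvec x))) has_derivative (\<lambda>h. Re (fser (dcoef h (w j)) (cvec x)))) (at x)"
    by (rule bounded_linear.has_derivative[OF bounded_linear_Re fser_has_derivative[OF w(1,2)]])
  then show "((\<lambda>x. rvec w x \<bullet> b) has_derivative (\<lambda>h. (\<chi> j. Re (fser (dcoef h (w j)) (cvec x))) \<bullet> b)) (at x)"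
    by (simp add: b inner_axis rvec_def)
qed

text \<open>The chain rule, transferred by uniqueness of the derivative to coefficients
  \<open>v\<close> that are known only through the values of their series on the real torus.\<close>

lemma fser_comp_deriv:
  fixes u :: "int ^ 'n \<Rightarrow> complex" and w :: "'n \<Rightarrow> int ^ 'n \<Rightarrow> complex"
  assumes u: "wle 0 A u" "wle 0 B (knm u)"
    and w: "\<And>i. wle 0 C (w i)" "\<And>i. wle 0 D (knm (w i))" "\<And>i. herm (w i)"
    and v: "wle 0 A' v" "wle 0 B' (knm v)"
    and eq: "\<And>x. fser v (cvec x) = fser (w i) (cvec x) + fser u (cvec (x + rvec w x))"
  shows "fser (dcoef h v) (cvec x) = fser (dcoef h (w i)) (cvec x) +
      (fser (dcoef h u) (cvec (x + rvec w x)) +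
       (\<Sum>j\<in>UNIV. fser (dcoef (axis j 1) u) (cvec (x + rvec w x)) * complex_of_real (Re (fser (dcoef h (w j)) (cvec x)))))"
proof -
  define g where "g h = (\<chi> j. Re (fser (dcoef h (w j)) (cvec x)))" for h
  have dw: "(rvec w has_derivative g) (at x)"
    unfolding g_def by (rule rvec_has_derivative[OF w(1,2)])
  have "((\<lambda>x. x + rvec w x) has_derivative (\<lambda>h. h + g h)) (at x)"
    by (intro has_derivative_add has_derivative_ident dw)
  from has_derivative_compose[OF this fser_has_derivative[OF u]]
  have "((\<lambda>x. fser (w i) (cvec x) + fser u (cvec (x + rvec w x))) has_derivative
      (\<lambda>h. fser (dcoef h (w i)) (cvec x) + fser (dcoef (h + g h) u) (cvec (x + rvec w x)))) (at x)"
    by (rule has_derivative_add[OF fser_has_derivative[OF w(1,2)]])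
  moreover have "((\<lambda>x. fser (w i) (cvec x) + fser u (cvec (x + rvec w x))) has_derivative
      (\<lambda>h. fser (dcoef h v) (cvec x))) (at x)"
    using fser_has_derivative[OF v, of x] unfolding eq .
  ultimately have "(\<lambda>h. fser (dcoef h v) (cvec x)) =
     (\<lambda>h. fser (dcoef h (w i)) (cvec x) + fser (dcoef (h + g h) u) (cvec (x + rvec w x)))"
    by (rule has_derivative_unique[rotated])
  then have "fser (dcoef h v) (cvec x) =
      fser (dcoef h (w i)) (cvec x) + fser (dcoef (h + g h) u) (cvec (x + rvec w x))"
    by (rule fun_cong)
  also have "fser (dcoef (h + g h) u) (cvec (x + rvec w x)) =
      fser (dcoef h u) (cvec (x + rvec w x)) + fser (dcoef (g h) u) (cvec (x + rvec w x))"
    by (rule linear_add[OF bounded_linear.linear[OF bounded_linear_fser_dcoef[OF u(2)]]]) simp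
  also have "fser (dcoef (g h) u) (cvec (x + rvec w x)) =
      (\<Sum>j\<in>UNIV. fser (dcoef (axis j 1) u) (cvec (x + rvec w x)) * complex_of_real (Re (fser (dcoef h (w j)) (cvec x))))"
    by (subst dcoef_axis_expand[OF u(2)]) (simp_all add: g_def mult.commute)
  finally show ?thesis .
qed

text \<open>On a shifted torus \<open>id + u\<close> takes complex values, so it is compared with
  the real map at \<open>cvec x\<close>. The displacement \<open>Z\<close> has size at most
  \<open>2 * t\<close>, which is harmless for frequencies with
  \<open>t * kn k \<le> 1\<close>.\<close>

lemma gb_trig_near_torus:
  fixes u :: "'n \<Rightarrow> int ^ 'n \<Rightarrow> complex" and q :: "int ^ 'n \<Rightarrow> complex"
  assumes t: "0 < t" and u: "\<And>i. wle t (A i) (u i)" "\<And>i. wle t \<gamma> (knm (u i))" "\<gamma> \<le> 1 / 2" "\<And>i. herm (u i)"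
    and G: "finite G" "\<And>k. k \<in> G \<Longrightarrow> t * kn k \<le> 1" "sqrt (\<Sum>k\<in>G. (norm (q k))\<^sup>2) \<le> \<pi>" and \<sigma>: "\<sigma> \<in> signs"
  shows "gb (2 * noff TYPE('n) * exp (4 * real CARD('n)) * \<pi>)
    (\<lambda>x. \<Sum>k\<in>G. q k * ee k ((cvec x + ivec t \<sigma>) + (\<chi> i. fser (u i) (cvec x + ivec t \<sigma>))))"
proof -
  let ?n = "real CARD('n)"
  define a where "a = (\<lambda>k. if k \<in> G then q k else 0)"
  define Z where "Z x = ivec t \<sigma> + (\<chi> i. fser (u i) (cvec x + ivec t \<sigma>) - fser (u i) (cvec x))" for x
  have u0: "wle 0 (A i) (u i)" "wle 0 \<gamma> (knm (u i))" for i
    using wle_strip_mono[OF u(1)] wle_strip_mono[OF u(2)] t by auto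
  have U: "half_lipschitz (rvec u)" by (rule half_lipschitz_rvec[OF u0 u(3)])
  have "0 \<le> \<gamma>" using wle_nonneg[OF u(2)] .
  have Zle: "norm (Z x $ i) \<le> 2 * t" for x i
  proof -
    have "norm (fser (u i) (cvec x + ivec t \<sigma>) - fser (u i) (cvec x)) \<le> t * \<gamma>"
      by (rule fser_imag_diff[OF u(1,2)]) (use ivec_norm[OF \<sigma>, of t] t in simp)
    also have "\<dots> \<le> t * 1" using t u(3) by (intro mult_left_mono) auto
    finally show ?thesis
      using norm_triangle_ineq[of "ivec t \<sigma> $ i" "fser (u i) (cvec x + ivec t \<sigma>) - fser (u i) (cvec x)"]
        ivec_norm[OF \<sigma>, of t i] t by (simp add: Z_def)
  qed
  have n: "0 < ?n" by simp
  \<comment> \<open>The width for which \<open>?n * (2 * t) / r = 1 / 2\<close>, the limit allowed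
    by \<open>gb_fser_comp_diff\<close>. On \<open>G\<close> the weight is then at most
    \<open>exp (4 * ?n)\<close>.\<close>
  define r where "r = 4 * ?n * t"
  have r: "0 < r" "?n * (2 * t) / r = 1 / 2" using t n by (auto simp: r_def)
  let ?B = "exp (4 * ?n) * \<pi>"
  have \<pi>: "0 \<le> \<pi>" using G(3) by (meson order.trans real_sqrt_ge_zero sum_nonneg zero_le_power2)
  have lr: "l2le r ?B a" unfolding l2le_def
  proof safe
    fix F :: "(int ^ 'n) set" assume F: "finite F"
    have "(\<Sum>k\<in>F. (norm (a k) * exp (r * kn k))\<^sup>2) = (\<Sum>k\<in>F \<inter> G. (norm (q k) * exp (r * kn k))\<^sup>2)"
      using F by (auto simp: a_def intro!: sum.mono_neutral_cong_right split: if_splits)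
    also have "\<dots> \<le> (\<Sum>k\<in>G. (norm (q k) * exp (r * kn k))\<^sup>2)"
      using G(1) by (intro sum_mono2) auto
    also have "\<dots> \<le> (\<Sum>k\<in>G. (exp (4 * ?n))\<^sup>2 * (norm (q k))\<^sup>2)"
    proof (intro sum_mono)
      fix k assume k: "k \<in> G"
      have "r * kn k = 4 * ?n * (t * kn k)" by (simp add: r_def)
      also have "\<dots> \<le> 4 * ?n * 1" using G(2)[OF k] by (intro mult_left_mono) auto
      finally have "norm (q k) * exp (r * kn k) \<le> norm (q k) * exp (4 * ?n)"
        by (intro mult_left_mono) auto
      then have "(norm (q k) * exp (r * kn k))\<^sup>2 \<le> (norm (q k) * exp (4 * ?n))\<^sup>2"
        by (intro power_mono) auto
      then show "(norm (q k) * exp (r * kn k))\<^sup>2 \<le> (exp (4 * ?n))\<^sup>2 * (norm (q k))\<^sup>2"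
        by (simp add: power_mult_distrib mult.commute)
    qed
    finally have "sqrt (\<Sum>k\<in>F. (norm (a k) * exp (r * kn k))\<^sup>2) \<le> sqrt ((exp (4 * ?n))\<^sup>2 * (\<Sum>k\<in>G. (norm (q k))\<^sup>2))"
      unfolding sum_distrib_left by (rule real_sqrt_le_mono)
    also have "\<dots> = exp (4 * ?n) * sqrt (\<Sum>k\<in>G. (norm (q k))\<^sup>2)" by (simp add: real_sqrt_mult)
    also have "\<dots> \<le> ?B" by (intro mult_left_mono G) auto
    finally show "sqrt (\<Sum>k\<in>F. (norm (a k) * exp (r * kn k))\<^sup>2) \<le> ?B" .
  qed
  have wr: "wle r (\<Sum>k\<in>G. norm (q k) * exp (r * kn k)) a"
    unfolding a_def by (rule wle_finite[OF G(1)])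
  have l0: "l2le 0 ?B a"
  proof (rule l2le_mono[OF lr order_refl])
    show "norm (a k) * exp (0 * kn k) \<le> norm (a k) * exp (r * kn k)" for k
      using r(1) by (intro mult_left_mono) auto
  qed
  have w0: "wle 0 (\<Sum>k\<in>G. norm (q k) * exp (r * kn k)) a"
    by (rule wle_strip_mono[OF wr]) (use r in auto)
  \<comment> \<open>The difference to the real map and the real map itself contribute one copy of
    the bound each, hence the factor 2.\<close>
  have "gb (noff TYPE('n) * (2 * (?n * (2 * t) / r)) * ?B)
     (\<lambda>x. fser a (cvec (x + rvec u x) + Z x) - fser a (cvec (x + rvec u x)))"
    by (rule gb_fser_comp_diff[OF U wr lr Zle]) (use r in auto)
  from gb_add[OF this gb_fser_comp[OF U w0 l0]]
  have "gb (2 * noff TYPE('n) * exp (4 * ?n) * \<pi>) (\<lambda>x. fser a (cvec (x + rvec u x) + Z x))"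
    unfolding r(2) by (simp add: algebra_simps)
  moreover have "fser a (cvec (x + rvec u x) + Z x) =
      (\<Sum>k\<in>G. q k * ee k ((cvec x + ivec t \<sigma>) + (\<chi> i. fser (u i) (cvec x + ivec t \<sigma>))))" for x
  proof -
    have "cvec (x + rvec u x) + Z x = (cvec x + ivec t \<sigma>) + (\<chi> i. fser (u i) (cvec x + ivec t \<sigma>))"
      by (simp add: cvec_add cvec_rvec u(4) Z_def vec_eq_iff)
    then show ?thesis by (simp add: a_def fser_finite G(1))
  qed
  ultimately show ?thesis by simp
qed

text \<open>\<open>\<delta>\<close> bounds the derivative of the correction \<open>W\<close>, and
  \<open>(s - t) * \<delta>\<close> bounds \<open>W\<close>. The three terms for
  \<open>\<epsilon>'\<close> come from shifting the argument of the old error, from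
  \<open>DU\<close> times the old error, and from the new shell; the first two carry the small
  factors \<open>\<delta>\<close> and \<open>\<gamma>\<close>. The bound
  \<open>\<Omega> * \<delta>\<close> holds because the old error differs from its mean by
  \<open>\<partial>\<^sub>\<omega> W\<close>.\<close>

lemma kam_step:
  fixes \<omega> :: "real ^ 'n" and q :: "'n \<Rightarrow> int ^ 'n \<Rightarrow> complex"
  assumes st: "kam_state \<omega> P s \<gamma> \<epsilon> u e Y"
    and Preal: "\<And>x i. P i (cvec x) \<in> \<real>"
    and C: "small_divisor_bound \<omega> \<tau> C"
    and s: "0 < t" "t < s" "s \<le> 1"
    and \<delta>: "C * (s - t) powr (- \<tau> - 1) * \<epsilon> \<le> \<delta>" "real CARD('n) * \<delta> \<le> 1 / 4"
    and \<gamma>: "\<gamma> \<le> 1 / 4" "\<gamma> + 2 * \<delta> \<le> 1 / 2"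
    and G: "finite G" "\<And>k. k \<in> G \<Longrightarrow> t * kn k \<le> 1" "\<And>i. sqrt (\<Sum>k\<in>G. (norm (q i k))\<^sup>2) \<le> \<pi>"
    and Qreal: "\<And>x i. (\<Sum>k\<in>G. q i k * ee k (cvec x)) \<in> \<real>"
    and w: "\<And>i. \<bar>\<omega> $ i\<bar> \<le> \<Omega>"
    and \<epsilon>': "sqrt (card (signs :: (real ^ 'n) set)) * (noff TYPE('n) *
        (2 * (real CARD('n) * \<delta>) * \<epsilon> + real CARD('n) * \<gamma> * \<epsilon> + 2 * exp (4 * real CARD('n)) * \<pi>)) \<le> \<epsilon>'"
  shows "\<exists>u' e' Y'. kam_state \<omega> (\<lambda>i z. P i z + (\<Sum>k\<in>G. q i k * ee k z)) t (\<gamma> + 2 * \<delta>) \<epsilon>' u' e' Y' \<and>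
     (\<forall>i. wle 0 (2 * \<delta>) (\<lambda>k. u' i k - u i k) \<and> wle 0 (2 * \<delta>) (knm (\<lambda>k. u' i k - u i k)) \<and>
        \<bar>Y' $ i - Y $ i\<bar> \<le> \<epsilon> \<and> (\<forall>x. norm (fser (e i) (cvec x) - complex_of_real (Y' $ i - Y $ i)) \<le> \<Omega> * \<delta>))"
proof -
  let ?n = "real CARD('n)"
  define \<sigma> where "\<sigma> = s - t"
  have \<sigma>: "0 < \<sigma>" "\<sigma> \<le> 1" using s by (auto simp: \<sigma>_def)
  have n1: "1 \<le> ?n" by simp
  have uA: "\<exists>A. wle s A (u i)" and uB: "wle s \<gamma> (knm (u i))" and uh: "herm (u i)"
    and eA: "\<exists>A. wle s A (e i)" and e2: "l2le s \<epsilon> (e i)" and eh: "herm (e i)" for i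
    using st unfolding kam_state_def by auto
  have ident: "fser (e i) (cvec x) = P i (cvec (x + rvec u x)) - complex_of_real (Y $ i)
          - fser (dcoef \<omega> (u i)) (cvec x)" for i x
    using st unfolding kam_state_def by auto
  obtain Au where Au: "\<And>i. wle s (Au i) (u i)" using uA by metis
  obtain Ae where Ae: "\<And>i. wle s (Ae i) (e i)" using eA by metis
  have \<epsilon>0: "0 \<le> \<epsilon>" using l2le_nonneg[OF e2] .
  have \<gamma>0: "0 \<le> \<gamma>" using wle_nonneg[OF uB] .
  have C0: "0 < C" using C by (simp add: small_divisor_bound_def)
  have nz: "freq k \<omega> \<noteq> 0" if "k \<noteq> 0" for k using C that by (simp add: small_divisor_bound_def)
  have \<delta>0: "0 \<le> \<delta>" using \<delta>(1) C0 \<epsilon>0 by (meson mult_nonneg_nonneg less_imp_le order.trans powr_ge_zero)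
  have \<delta>4: "\<delta> \<le> 1 / 4"
    using mult_right_mono[OF n1 \<delta>0] \<delta>(2) by simp
  define \<rho> where "\<rho> = \<sigma> * \<delta>"
  have \<rho>: "0 \<le> \<rho>" "\<rho> \<le> \<delta>" "\<rho> \<le> \<sigma> / 4"
    using \<sigma> \<delta>0 \<delta>4 mult_right_mono[OF \<sigma>(2) \<delta>0] mult_left_mono[OF \<delta>4, of \<sigma>] by (auto simp: \<rho>_def)
  have ts: "t + \<rho> < s" using \<rho>(3) \<sigma>(1) by (simp add: \<sigma>_def)
  define wc where "wc i = divis \<omega> (e i)" for i
  have wc0: "wle t \<rho> (wc i)" for i
  proof -
    have "\<sigma> powr (- \<tau>) = \<sigma> * \<sigma> powr (- \<tau> - 1)" using \<sigma> by (simp add: powr_diff)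
    then have "C * (s - t) powr (- \<tau>) * \<epsilon> = \<sigma> * (C * (s - t) powr (- \<tau> - 1) * \<epsilon>)"
      by (simp add: \<sigma>_def mult_ac)
    also have "\<dots> \<le> \<rho>" unfolding \<rho>_def using \<delta>(1) \<sigma> by (intro mult_left_mono) auto
    finally show ?thesis
      unfolding wc_def using s by (intro wle_bound_mono[OF wle_divis(1)[OF C e2]]) auto
  qed
  have wc1: "wle t \<delta> (knm (wc i))" for i
    unfolding wc_def using s \<delta>(1) by (intro wle_bound_mono[OF wle_divis(2)[OF C e2]]) auto
  have wh: "herm (wc i)" for i unfolding wc_def by (rule herm_divis[OF eh])
  let ?W = "\<lambda>z. \<chi> i. fser (wc i) z"
  have W: "wn t \<rho> \<delta> (fser (wc i))" for i by (rule wn_fser[OF wc0 wc1])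
  note t0 = less_imp_le[OF s(1)]

  \<comment> \<open>\<open>id + u'\<close> will be \<open>(id + u) \<circ> (id + W)\<close>, so
    \<open>u' - u = W + (u \<circ> (id + W) - u)\<close>. Cauchy's estimate on the remaining strip
    bounds this by \<open>2 * \<delta>\<close>.\<close>
  have "wn t (2 * \<delta>) (2 * \<delta>) (\<lambda>z. fser (wc i) z + (fser (u i) (z + ?W z) - fser (u i) z))" for i
  proof -
    have "wn t (\<rho> * \<gamma>) (\<rho> * (\<gamma> / (s - (t + \<rho>))) + \<delta> * \<gamma>) (\<lambda>z. fser (u i) (z + ?W z) - fser (u i) z)"
      by (rule wn_comp_diff[where W = "\<lambda>i. fser (wc i)", OF t0 W wle_strip_mono[OF Au] wle_strip_mono[OF uB] wle_knm[OF uB]]) (use ts in auto)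
    from wn_add[OF W[of i] this]
    show ?thesis
    proof (rule wn_mono)
      have "\<rho> * \<gamma> \<le> \<delta> * 1" using \<rho> \<gamma>0 \<gamma> by (intro mult_mono) auto
      then show "\<rho> + \<rho> * \<gamma> \<le> 2 * \<delta>" using \<rho> by simp
      have "\<rho> * (\<gamma> / (s - (t + \<rho>))) \<le> 2 * \<delta> * \<gamma>"
      proof -
        have "\<sigma> / 2 \<le> s - (t + \<rho>)" using \<rho>(3) \<sigma>(1) by (simp add: \<sigma>_def field_simps)
        then have "\<gamma> / (s - (t + \<rho>)) \<le> \<gamma> / (\<sigma> / 2)" using \<sigma> \<gamma>0 by (intro divide_left_mono) auto
        then have "\<rho> * (\<gamma> / (s - (t + \<rho>))) \<le> \<rho> * (\<gamma> / (\<sigma> / 2))" using \<rho> by (intro mult_left_mono)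
        also have "\<dots> = 2 * \<delta> * \<gamma>" using \<sigma> by (simp add: \<rho>_def)
        finally show ?thesis .
      qed
      moreover have "\<delta> * \<gamma> \<le> \<delta> * (1 / 4)" by (intro mult_left_mono \<gamma> \<delta>0)
      ultimately show "\<delta> + (\<rho> * (\<gamma> / (s - (t + \<rho>))) + \<delta> * \<gamma>) \<le> 2 * \<delta>" using \<delta>0 by simp
    qed
  qed
  then have "\<forall>i. \<exists>d. wle t (2 * \<delta>) d \<and> wle t (2 * \<delta>) (knm d) \<and>
      (\<forall>z\<in>strip t. fser (wc i) z + (fser (u i) (z + ?W z) - fser (u i) z) = fser d z)"
    unfolding wn_def by blast
  then obtain d where d: "\<And>i. wle t (2 * \<delta>) (d i)" "\<And>i. wle t (2 * \<delta>) (knm (d i))"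
     "\<And>i z. z \<in> strip t \<Longrightarrow> fser (wc i) z + (fser (u i) (z + ?W z) - fser (u i) z) = fser (d i) z"
    by metis
  \<comment> \<open>Adding \<open>d\<close> rather than re-expanding the composition keeps the growth of \<open>\<gamma>\<close> additive.\<close>
  define u' where "u' i k = u i k + d i k" for i k
  have u'0: "wle t (Au i + 2 * \<delta>) (u' i)" for i
    unfolding u'_def using wle_add[OF wle_strip_mono[OF Au[of i]] d(1)[of i]] s by simp
  have u'1: "wle t (\<gamma> + 2 * \<delta>) (knm (u' i))" for i
    unfolding u'_def knm_add using wle_add[OF wle_strip_mono[OF uB[of i]] d(2)[of i]] s by simp
  have u'z: "fser (u' i) z = fser (wc i) z + fser (u i) (z + ?W z)" if z: "z \<in> strip t" for i z
    unfolding u'_def using fser_add[OF wle_strip_mono[OF Au[of i]] d(1)[of i] z] d(3)[OF z, of i, symmetric] s by simp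
  have cw: "cvec (x + rvec wc x) = cvec x + ?W (cvec x)" for x
    by (simp add: cvec_add cvec_rvec[OF wh])
  have u'x: "fser (u' i) (cvec x) = fser (wc i) (cvec x) + fser (u i) (cvec (x + rvec wc x))" for i x
    unfolding cw by (rule u'z) (use t0 in simp)
  have u'h: "herm (u' i)" for i
    by (rule herm_if_real[OF wle_strip_mono[OF u'0 t0]])
       (unfold u'x, intro Reals_add herm_real wh uh)
  have rv: "x + rvec u' x = (x + rvec wc x) + rvec u (x + rvec wc x)" for x
  proof -
    have "rvec u' x = rvec wc x + rvec u (x + rvec wc x)" by (simp add: rvec_def[of u'] rvec_def[of wc x] rvec_def[of u] u'x vec_eq_iff)
    then show ?thesis by simp
  qed

  \<comment> \<open>The new error as a function on the whole strip, where \<open>e j 0\<close> is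
    the mean. On the real torus it is identified with the conjugacy defect in
    \<open>newid\<close>.\<close>
  define E where "E i z = (fser (e i) (z + ?W z) - fser (e i) z)
     - (\<Sum>j\<in>UNIV. fser (dcoef (axis j 1) (u i)) (z + ?W z) * (fser (e j) z - e j 0))
     + (\<Sum>k\<in>G. q i k * ee k (z + (\<chi> i. fser (u' i) z)))" for i z
  have ax: "\<bar>axis j (1::real) $ i\<bar> \<le> 1" for i j :: 'n by (simp add: axis_def)
  have duA: "wle s \<gamma> (dcoef (axis j 1) (u i))" for i j
    using wle_dcoef[OF uB ax] by simp
  \<comment> \<open>The midpoint leaves room for two Cauchy estimates in a row, whose constants only
    have to be finite.\<close>
  define s2 where "s2 = (t + \<rho> + s) / 2"
  have s2: "t + \<rho> < s2" "s2 < s" using ts by (auto simp: s2_def)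
  have knmA: "wle s2 (A / (s - s2)) (knm a)" if "wle s A a" for A a
    by (rule wle_knm[OF that s2(2)])
  have knm2A: "wle (t + \<rho>) (A / (s - s2) / (s2 - (t + \<rho>))) (knm (knm a))" if "wle s A a" for A a
    by (rule wle_knm[OF knmA[OF that] s2(1)])
  have knmA': "wle (t + \<rho>) (A / (s - s2)) (knm a)" if "wle s A a" for A a
    by (rule wle_strip_mono[OF knmA[OF that]]) (use s2 in auto)
  have knmAt: "wle t (A / (s - s2)) (knm a)" if "wle s A a" for A a
    by (rule wle_strip_mono[OF knmA[OF that]]) (use s2 \<rho> in auto)
  have ts': "wle (t + \<rho>) A a" "wle t A a" if "wle s A a" for A a
    using wle_strip_mono[OF that] ts s by auto
  \<comment> \<open>Only the existence of an absolutely convergent expansion on the strip matters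
    here; the size comes from the grid averages.\<close>
  have Ewn: "\<exists>A B. wn t A B (E i)" for i
  proof -
    have 1: "\<exists>A B. wn t A B (\<lambda>z. fser (e i) (z + ?W z) - fser (e i) z)"
      using wn_comp_diff[where W = "\<lambda>i. fser (wc i)", OF t0 W ts'(1)[OF Ae] knmA'[OF Ae] knm2A[OF Ae]] by blast
    have 2: "\<exists>A B. wn t A B (\<lambda>z. fser (dcoef (axis j 1) (u i)) (z + ?W z) * (fser (e j) z - e j 0))" for j
    proof -
      have "wn t (Ae j + norm (- e j 0)) (Ae j / (s - s2) + 0) (\<lambda>z. fser (e j) z + - e j 0)"
        by (intro wn_add wn_fser wn_const ts' Ae knmAt)
      then have "wn t (Ae j + norm (- e j 0)) (Ae j / (s - s2) + 0) (\<lambda>z. fser (e j) z - e j 0)"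
        by simp
      from wn_mult[OF t0 wn_comp[where W = "\<lambda>i. fser (wc i)", OF t0 W ts'(1)[OF duA[of j i]] knmA'[OF duA[of j i]] knm2A[OF duA[of j i]]] this]
      show ?thesis by blast
    qed
    have "\<forall>j. \<exists>c. wn t (fst c) (snd c) (\<lambda>z. fser (dcoef (axis j 1) (u i)) (z + ?W z) * (fser (e j) z - e j 0))"
    proof
      fix j
      from 2[of j] obtain A B where "wn t A B (\<lambda>z. fser (dcoef (axis j 1) (u i)) (z + ?W z) * (fser (e j) z - e j 0))"
        by (elim exE)
      then show "\<exists>c. wn t (fst c) (snd c) (\<lambda>z. fser (dcoef (axis j 1) (u i)) (z + ?W z) * (fser (e j) z - e j 0))"
        by (intro exI[of _ "(A, B)"]) simp
    qed
    from choice[OF this] obtain c where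
      "\<forall>j. wn t (fst (c j)) (snd (c j)) (\<lambda>z. fser (dcoef (axis j 1) (u i)) (z + ?W z) * (fser (e j) z - e j 0))"
      by (elim exE)
    then have 2: "wn t (fst (c j)) (snd (c j)) (\<lambda>z. fser (dcoef (axis j 1) (u i)) (z + ?W z) * (fser (e j) z - e j 0))" for j
      by (rule spec)
    have 3: "\<exists>A B. wn t A B (\<lambda>z. \<Sum>k\<in>G. q i k * ee k (z + (\<chi> i. fser (u' i) z)))"
    proof -
      define M where "M = Max (range (\<lambda>i. Au i + 2 * \<delta>))"
      have U': "wn t M (\<gamma> + 2 * \<delta>) (fser (u' j))" for j
        by (rule wn_mono[OF wn_fser[OF u'0 u'1]]) (auto simp: M_def)
      have "knm (\<lambda>k. if k \<in> G then f k else 0) = (\<lambda>k. if k \<in> G then knm f k else 0)" for f :: "int ^ 'n \<Rightarrow> complex"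
        by (auto simp: knm_def)
      then have "\<exists>A1 A2. wle (t + M) A1 (knm (\<lambda>k. if k \<in> G then q i k else 0)) \<and>
          wle (t + M) A2 (knm (knm (\<lambda>k. if k \<in> G then q i k else 0)))"
        using wle_finite[OF G(1), of "t + M" "knm (q i)"] wle_finite[OF G(1), of "t + M" "knm (knm (q i))"] by auto
      then obtain A1 A2 where "wle (t + M) A1 (knm (\<lambda>k. if k \<in> G then q i k else 0))"
        "wle (t + M) A2 (knm (knm (\<lambda>k. if k \<in> G then q i k else 0)))" by blast
      from wn_comp[where W = "\<lambda>i. fser (u' i)", OF t0 U' wle_finite[OF G(1), of _ "q i"] this]
      show ?thesis unfolding fser_finite[OF G(1)] by blast
    qed
    from 1 3 obtain A1 B1 A3 B3 where 1: "wn t A1 B1 (\<lambda>z. fser (e i) (z + ?W z) - fser (e i) z)"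
      and 3: "wn t A3 B3 (\<lambda>z. \<Sum>k\<in>G. q i k * ee k (z + (\<chi> i. fser (u' i) z)))" by blast
    have "wn t (A1 + norm (-1 :: complex) * (\<Sum>j\<in>UNIV. fst (c j)) + A3) (B1 + norm (-1 :: complex) * (\<Sum>j\<in>UNIV. snd (c j)) + B3)
      (\<lambda>z. (fser (e i) (z + ?W z) - fser (e i) z)
       + (-1) * (\<Sum>j\<in>UNIV. fser (dcoef (axis j 1) (u i)) (z + ?W z) * (fser (e j) z - e j 0))
       + (\<Sum>k\<in>G. q i k * ee k (z + (\<chi> i. fser (u' i) z))))"
      by (intro wn_add wn_cmult wn_sum 1 2 3) auto
    then show ?thesis unfolding E_def by (intro exI) (erule wn_cong, simp)
  qed
  then have "\<forall>i. \<exists>A a. wle t A a \<and> (\<forall>z\<in>strip t. E i z = fser a z)" unfolding wn_def by blast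
  then obtain Ae' e' where e': "\<And>i. wle t (Ae' i) (e' i)" "\<And>i z. z \<in> strip t \<Longrightarrow> E i z = fser (e' i) z"
    by metis
  \<comment> \<open>\<open>weighted_bessel\<close> asks for a mean bound on every torus shifted by
    \<open>ivec t v\<close>.\<close>
  have gbE: "gb (noff TYPE('n) * (2 * (?n * \<delta>) * \<epsilon> + ?n * \<gamma> * \<epsilon> + 2 * exp (4 * ?n) * \<pi>))
      (\<lambda>x. fser (e' i) (cvec x + ivec t v))" if v: "v \<in> signs" for i v
  proof -
    have st': "cvec x + ivec t v \<in> strip t" for x by (rule ivec_strip[OF v t0])
    have Wst: "cvec x + ivec t v + ?W (cvec x + ivec t v) \<in> strip s" for x
      using wn_shift_strip[where W = "\<lambda>i. fser (wc i)", OF W st'] strip_mono[of "t + \<rho>" s] ts by auto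
    have 1: "gb (noff TYPE('n) * (2 * (?n * \<rho> / \<sigma>)) * \<epsilon>)
      (\<lambda>x. fser (e i) ((cvec x + ivec t v) + ?W (cvec x + ivec t v)) - fser (e i) (cvec x + ivec t v))"
    proof -
      \<comment> \<open>Absorbing the shift into the coefficients reduces this to the real torus
        with \<open>U = 0\<close>; a strip of width \<open>\<sigma> = s - t\<close> is left
        over.\<close>
      let ?a = "\<lambda>k. e i k * ee k (ivec t v)"
      have "gb (noff TYPE('n) * (2 * (?n * \<rho> / \<sigma>)) * \<epsilon>)
        (\<lambda>x. fser ?a (cvec (x + 0) + ?W (cvec x + ivec t v)) - fser ?a (cvec (x + 0)))"
      proof (rule gb_fser_comp_diff[OF half_lipschitz_zero])
        show "wle \<sigma> (Ae i) ?a" by (rule wle_ivec[OF _ v t0]) (use Ae in \<open>simp add: \<sigma>_def\<close>)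
        show "l2le \<sigma> \<epsilon> ?a" by (rule l2le_ivec[OF _ v t0]) (use e2 in \<open>simp add: \<sigma>_def\<close>)
        show "norm (?W (cvec x + ivec t v) $ j) \<le> \<rho>" for x j
          using norm_fser_le[OF wc0 st'] by simp
        show "?n * \<rho> / \<sigma> \<le> 1 / 2" using \<sigma> \<delta>(2) by (simp add: \<rho>_def)
      qed (rule \<sigma>)
      moreover have "fser (e i) (z + ivec t v) = fser ?a z" for z by (rule fser_shift)
      moreover have "(cvec x + ivec t v) + ?W (cvec x + ivec t v) = (cvec x + ?W (cvec x + ivec t v)) + ivec t v" for x
        by (simp add: add_ac)
      ultimately show ?thesis by (simp only: add_0_right)
    qed
    have 2: "gb (\<gamma> * (noff TYPE('n) * \<epsilon>))
       (\<lambda>x. fser (dcoef (axis j 1) (u i)) (cvec x + ivec t v + ?W (cvec x + ivec t v)) * (fser (e j) (cvec x + ivec t v) - e j 0))" for j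
    proof (rule gb_mult)
      let ?a = "\<lambda>k. if k \<in> {0} then 0 else e j k"
      have wa: "wle s (Ae j) ?a" by (rule wle_mono[OF Ae[of j] order_refl]) auto
      have la: "l2le s \<epsilon> ?a" by (rule l2le_mono[OF e2[of j] order_refl]) auto
      let ?b = "\<lambda>k. ?a k * ee k (ivec t v)"
      have "gb (noff TYPE('n) * \<epsilon>) (\<lambda>x. fser ?b (cvec (x + 0)))"
      proof (rule gb_fser_comp[OF half_lipschitz_zero])
        show "wle 0 (Ae j) ?b" by (rule wle_ivec[OF _ v t0]) (use wle_strip_mono[OF wa] s in simp)
        have "l2le (t + 0) \<epsilon> ?a" by (rule l2le_mono[OF la order_refl]) (use s in \<open>auto intro!: mult_left_mono mult_right_mono\<close>)
        then show "l2le 0 \<epsilon> ?b" by (rule l2le_ivec[OF _ v t0])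
      qed
      moreover have "fser (e j) (cvec x + ivec t v) - e j 0 = fser ?b (cvec (x + 0))" for x
        using fser_split[OF ts'(2)[OF Ae[of j]], of "{0}" "cvec x + ivec t v"] st'[of x]
        by (simp add: fser_shift[symmetric])
      ultimately show "gb (noff TYPE('n) * \<epsilon>) (\<lambda>x. fser (e j) (cvec x + ivec t v) - e j 0)" by simp
      show "norm (fser (dcoef (axis j 1) (u i)) (cvec x + ivec t v + ?W (cvec x + ivec t v)) * (fser (e j) (cvec x + ivec t v) - e j 0))
         \<le> \<gamma> * norm (fser (e j) (cvec x + ivec t v) - e j 0)" for x
        unfolding norm_mult by (intro mult_right_mono norm_fser_le[OF duA Wst]) auto
    qed (rule \<gamma>0)
    have 2: "gb (1 * (\<Sum>j\<in>(UNIV :: 'n set). \<gamma> * (noff TYPE('n) * \<epsilon>)))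
       (\<lambda>x. - (\<Sum>j\<in>UNIV. fser (dcoef (axis j 1) (u i)) (cvec x + ivec t v + ?W (cvec x + ivec t v)) * (fser (e j) (cvec x + ivec t v) - e j 0)))"
      by (rule gb_mult, rule gb_sum[OF _ 2]) auto
    have 3: "gb (2 * noff TYPE('n) * exp (4 * ?n) * \<pi>)
       (\<lambda>x. \<Sum>k\<in>G. q i k * ee k ((cvec x + ivec t v) + (\<chi> i. fser (u' i) (cvec x + ivec t v))))"
      by (rule gb_trig_near_torus[OF s(1) u'0 u'1 \<gamma>(2) u'h G v])
    have r: "?n * \<rho> / \<sigma> = ?n * \<delta>" using \<sigma> by (simp add: \<rho>_def)
    have "gb (noff TYPE('n) * (2 * (?n * \<delta>)) * \<epsilon> + 1 * (\<Sum>j\<in>(UNIV :: 'n set). \<gamma> * (noff TYPE('n) * \<epsilon>)) +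
        2 * noff TYPE('n) * exp (4 * ?n) * \<pi>) (\<lambda>x. E i (cvec x + ivec t v))"
      using gb_add[OF gb_add[OF 1 2] 3] unfolding r E_def by (simp add: add_ac)
    moreover have "noff TYPE('n) * (2 * (?n * \<delta>)) * \<epsilon> + 1 * (\<Sum>j\<in>(UNIV :: 'n set). \<gamma> * (noff TYPE('n) * \<epsilon>)) +
        2 * noff TYPE('n) * exp (4 * ?n) * \<pi> =
       noff TYPE('n) * (2 * (?n * \<delta>) * \<epsilon> + ?n * \<gamma> * \<epsilon> + 2 * exp (4 * ?n) * \<pi>)"
      by (simp add: algebra_simps)
    ultimately show ?thesis using e'(2)[OF st'] by simp
  qed
  have e'2: "l2le t \<epsilon>' (e' i)" for i
    by (rule l2le_mono[OF weighted_bessel[OF t0 e'(1) gbE] \<epsilon>']) auto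

  \<comment> \<open>The mean is real by Hermitian symmetry at \<open>k = 0\<close>, so nothing is
    lost by \<open>Re\<close>.\<close>
  define Y' where "Y' = (\<chi> i. Y $ i + Re (e i 0))"
  have e0: "complex_of_real (Re (e i 0)) = e i 0" for i
  proof -
    have "e i 0 = cnj (e i 0)" using eh[of i] unfolding herm_def by (metis minus_zero)
    then show ?thesis by (metis Reals_cnj_iff of_real_Re)
  qed
  have dw: "fser (dcoef \<omega> (wc j)) (cvec x) = fser (e j) (cvec x) - e j 0" for j x
    using fser_split[OF ts'(2)[OF Ae[of j]], of "{0}" "cvec x"] t0
    by (simp add: wc_def dcoef_divis[OF nz])
  have newid: "fser (e' i) (cvec x) = (P i (cvec (x + rvec u' x)) + (\<Sum>k\<in>G. q i k * ee k (cvec (x + rvec u' x))))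
       - complex_of_real (Y' $ i) - fser (dcoef \<omega> (u' i)) (cvec x)" for i x
  proof -
    let ?x = "x + rvec wc x"
    have re: "complex_of_real (Re (fser (e j) (cvec x) - e j 0)) = fser (e j) (cvec x) - e j 0" for j
      using herm_real[OF eh[of j], of x] e0[of j] by (simp add: of_real_Re)
    have "fser (dcoef \<omega> (u' i)) (cvec x) = fser (dcoef \<omega> (wc i)) (cvec x) + (fser (dcoef \<omega> (u i)) (cvec ?x) +
       (\<Sum>j\<in>UNIV. fser (dcoef (axis j 1) (u i)) (cvec ?x) * complex_of_real (Re (fser (dcoef \<omega> (wc j)) (cvec x)))))"
      by (rule fser_comp_deriv[OF wle_strip_mono[OF Au] wle_strip_mono[OF uB] wle_strip_mono[OF wc0]
            wle_strip_mono[OF wc1] wh wle_strip_mono[OF u'0] wle_strip_mono[OF u'1] u'x])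
         (use s in auto)
    \<comment> \<open>The terms \<open>e i - e i 0\<close> and
      \<open>\<partial>\<^sub>\<omega> u\<close> at the new point cancel against the old identity
      and the update of \<open>Y\<close>, which leaves exactly \<open>E\<close>.\<close>
    then have D: "fser (dcoef \<omega> (u' i)) (cvec x) = (fser (e i) (cvec x) - e i 0) + (fser (dcoef \<omega> (u i)) (cvec ?x) +
       (\<Sum>j\<in>UNIV. fser (dcoef (axis j 1) (u i)) (cvec ?x) * (fser (e j) (cvec x) - e j 0)))"
      unfolding dw re .
    have "fser (e' i) (cvec x) = E i (cvec x)" using e'(2) t0 by simp
    also have "\<dots> = (fser (e i) (cvec ?x) - fser (e i) (cvec x))
     - (\<Sum>j\<in>UNIV. fser (dcoef (axis j 1) (u i)) (cvec ?x) * (fser (e j) (cvec x) - e j 0))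
     + (\<Sum>k\<in>G. q i k * ee k (cvec (x + rvec u' x)))"
      unfolding E_def cw[symmetric] by (simp add: cvec_add cvec_rvec[OF u'h])
    also have "fser (e i) (cvec ?x) = P i (cvec (x + rvec u' x)) - complex_of_real (Y $ i) - fser (dcoef \<omega> (u i)) (cvec ?x)"
      unfolding rv by (rule ident)
    finally show ?thesis unfolding D by (simp add: Y'_def e0 algebra_simps)
  qed
  have e'h: "herm (e' i)" for i
  proof (rule herm_if_real[OF wle_strip_mono[OF e'(1) t0]])
    have "fser (dcoef \<omega> (u' i)) (cvec x) \<in> \<real>" for x
    proof -
      have "herm (dcoef \<omega> (u' i))" using u'h[of i] by (auto simp: herm_def dcoef_def freq_def sum_negf)
      then show ?thesis by (rule herm_real)
    qed
    then show "fser (e' i) (cvec x) \<in> \<real>" for x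
      unfolding newid by (intro Reals_diff Reals_add Preal Qreal) auto
  qed
  have state': "kam_state \<omega> (\<lambda>i z. P i z + (\<Sum>k\<in>G. q i k * ee k z)) t (\<gamma> + 2 * \<delta>) \<epsilon>' u' e' Y'"
    unfolding kam_state_def using u'0 u'1 u'h e'(1) e'2 e'h newid by blast
  have "wle 0 (2 * \<delta>) (\<lambda>k. u' i k - u i k)" "wle 0 (2 * \<delta>) (knm (\<lambda>k. u' i k - u i k))" for i
    unfolding u'_def using wle_strip_mono[OF d(1) t0] wle_strip_mono[OF d(2) t0] by auto
  moreover have "\<bar>Y' $ i - Y $ i\<bar> \<le> \<epsilon>" for i
    using l2le_coeff[OF e2[of i], of 0] abs_Re_le_cmod[of "e i 0"] by (simp add: Y'_def)
  moreover have "norm (fser (e i) (cvec x) - complex_of_real (Y' $ i - Y $ i)) \<le> \<Omega> * \<delta>" for i x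
  proof -
    have "fser (e i) (cvec x) - complex_of_real (Y' $ i - Y $ i) = fser (dcoef \<omega> (wc i)) (cvec x)"
      by (simp add: Y'_def e0 dw)
    also have "norm \<dots> \<le> \<Omega> * \<delta>" by (rule norm_fser_le[OF wle_dcoef[OF wc1 w]]) (use t0 in simp)
    finally show ?thesis .
  qed
  ultimately show ?thesis using state' by blast
qed

section \<open>Convergence\<close>

lemma shell_iff:
  "k \<in> shell b \<nu> \<longleftrightarrow> real b powi (int \<nu> - 1) < kn k \<and> kn k \<le> real b ^ \<nu>"
  by (simp add: shell_def kn_def)

lemma finite_shell: "finite (shell b \<nu>)"
  by (rule finite_subset[OF _ finite_kn_le[of "real b ^ \<nu>"]]) (auto simp: shell_iff)

lemma shell_minus: "- k \<in> shell b \<nu> \<longleftrightarrow> k \<in> shell b \<nu>"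
  by (simp add: shell_iff)

lemma zero_notin_shell: "0 < b \<Longrightarrow> 0 \<notin> shell b \<nu>"
  by (simp add: shell_iff not_less)

lemma shell_disjoint:
  assumes "1 \<le> b" "\<mu> < \<nu>" shows "shell b \<mu> \<inter> shell b \<nu> = {}"
proof -
  have "real b ^ \<mu> = real b powi int \<mu>" by simp
  also have "\<dots> \<le> real b powi (int \<nu> - 1)"
    using assms by (intro power_int_increasing) auto
  finally show ?thesis by (auto simp: shell_iff)
qed

lemma shell_cover:
  assumes b: "2 \<le> b" and k: "k \<noteq> 0"
  shows "\<exists>\<nu>. k \<in> shell b \<nu>"
proof -
  have b': "1 < real b" using b by simp
  obtain n where n: "kn k < real b ^ n" using real_arch_pow[OF b'] by blast
  define \<nu> where "\<nu> = (LEAST \<nu>. kn k \<le> real b ^ \<nu>)"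
  have le: "kn k \<le> real b ^ \<nu>" unfolding \<nu>_def by (rule LeastI[of _ n]) (use n in simp)
  have "real b powi (int \<nu> - 1) < kn k"
  proof (cases \<nu>)
    case 0
    \<comment> \<open>For \<open>\<nu> = 0\<close> the lower end is \<open>b powi (- 1)\<close>, so
      shell 0 consists of the \<open>k\<close> with \<open>kn k = 1\<close>.\<close>
    have "1 / real b < 1" using b' by simp
    then show ?thesis using kn_ge_1[OF k] 0 by (simp add: power_int_minus divide_inverse)
  next
    case (Suc \<mu>)
    then have "\<not> kn k \<le> real b ^ \<mu>" using not_less_Least[of \<mu> "\<lambda>\<nu>. kn k \<le> real b ^ \<nu>"] \<nu>_def by auto
    then show ?thesis by (simp add: Suc)
  qed
  then show ?thesis using le by (auto simp: shell_iff)
qed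

definition low :: "nat \<Rightarrow> nat \<Rightarrow> (int ^ 'n) set" where
  "low b \<nu> = (\<Union>\<mu><\<nu>. shell b \<mu>)"

lemma finite_low: "finite (low b \<nu>)"
  by (simp add: low_def finite_shell)

lemma low_Suc: "low b (Suc \<nu>) = low b \<nu> \<union> shell b \<nu>"
  by (auto simp: low_def less_Suc_eq)

lemma low_disjoint: "1 \<le> b \<Longrightarrow> low b \<nu> \<inter> shell b \<nu> = {}"
  using shell_disjoint by (fastforce simp: low_def)

lemma low_minus: "- k \<in> low b \<nu> \<longleftrightarrow> k \<in> low b \<nu>"
  by (simp add: low_def shell_minus)

lemma low_mono: "\<mu> \<le> \<nu> \<Longrightarrow> low b \<mu> \<subseteq> low b \<nu>"
  unfolding low_def by (intro UN_mono) auto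

lemma low_eventually:
  assumes b: "2 \<le> b" and F: "finite F"
  shows "\<forall>\<^sub>F \<nu> in sequentially. F - {0} \<subseteq> low b \<nu>"
  using F
proof (induction F rule: finite_induct)
  case (insert k F)
  have "\<forall>\<^sub>F \<nu> in sequentially. {k} - {0} \<subseteq> low b \<nu>"
  proof (cases "k = 0")
    case False
    then obtain \<mu> where "k \<in> shell b \<mu>" using shell_cover[OF b] by blast
    then have "k \<in> low b (Suc \<mu>)" by (simp add: low_Suc)
    then have "{k} - {0} \<subseteq> low b \<nu>" if "Suc \<mu> \<le> \<nu>" for \<nu> using low_mono[OF that] by auto
    then show ?thesis using eventually_sequentially by blast
  qed simp
  then show ?case using insert.IH by eventually_elim auto
qed simp

definition shell_norm :: "real \<Rightarrow> nat \<Rightarrow> (int ^ 'n \<Rightarrow> complex ^ 'n) \<Rightarrow> nat \<Rightarrow> real" where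
  "shell_norm r b p \<nu> = sqrt (\<Sum>k\<in>shell b \<nu>. (norm (p k))\<^sup>2 * kn k powr (2 * r))"

lemma shell_norm_nonneg: "0 \<le> shell_norm r b p \<nu>"
  by (simp add: shell_norm_def sum_nonneg)

lemma sum_shell_norm_le:
  assumes "fourier_norm r b p \<le> ennreal \<epsilon>" "0 \<le> \<epsilon>"
  shows "(\<Sum>\<nu><N. shell_norm r b p \<nu>) \<le> \<epsilon>"
proof -
  have "ennreal (\<Sum>\<nu><N. shell_norm r b p \<nu>) = (\<Sum>\<nu><N. ennreal (shell_norm r b p \<nu>))"
    by (simp add: sum_ennreal shell_norm_nonneg)
  also have "\<dots> \<le> (\<Sum>\<nu>. ennreal (shell_norm r b p \<nu>))" by (rule sum_le_suminf) auto
  also have "\<dots> \<le> ennreal \<epsilon>" using assms(1) by (simp add: fourier_norm_def shell_norm_def kn_def)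
  finally show ?thesis using assms(2) by simp
qed

text \<open>Uses the lower end \<open>b powr (\<nu> - 1)\<close> of the shell; the shift by 1 costs
  the factor \<open>b powr r\<close>.\<close>

lemma shell_l2_le:
  fixes p :: "int ^ 'n \<Rightarrow> complex ^ 'n"
  assumes b: "2 \<le> b" and r: "0 \<le> r"
  shows "sqrt (\<Sum>k\<in>shell b \<nu>. (norm (p k $ i))\<^sup>2) \<le> real b powr (r - real \<nu> * r) * shell_norm r b p \<nu>"
proof -
  have b0: "0 < real b" using b by simp
  have "(\<Sum>k\<in>shell b \<nu>. (norm (p k $ i))\<^sup>2) \<le>
     (\<Sum>k\<in>shell b \<nu>. (real b powr (r - real \<nu> * r))\<^sup>2 * ((norm (p k))\<^sup>2 * kn k powr (2 * r)))"
  proof (intro sum_mono)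
    fix k :: "int ^ 'n" assume k: "k \<in> shell b \<nu>"
    have "real b powr (real \<nu> - 1) \<le> kn k"
    proof -
      have "real b powi (int \<nu> - 1) = real b powr (real \<nu> - 1)"
        using powr_real_of_int'[of "real b" "int \<nu> - 1"] b0 by simp
      then show ?thesis using k by (simp add: shell_iff)
    qed
    then have "(real b powr (real \<nu> - 1)) powr (2 * r) \<le> kn k powr (2 * r)"
      using r b0 by (intro powr_mono2) auto
    then have "real b powr (2 * (real \<nu> * r - r)) \<le> kn k powr (2 * r)"
      by (simp add: powr_powr algebra_simps)
    then have "(real b powr (r - real \<nu> * r))\<^sup>2 * real b powr (2 * (real \<nu> * r - r)) \<le>
       (real b powr (r - real \<nu> * r))\<^sup>2 * kn k powr (2 * r)" by (rule mult_left_mono) auto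
    also have "(real b powr (r - real \<nu> * r))\<^sup>2 * real b powr (2 * (real \<nu> * r - r)) = 1"
      using b0 by (simp add: power2_eq_square powr_add[symmetric])
    finally have "(norm (p k))\<^sup>2 * 1 \<le> (norm (p k))\<^sup>2 * ((real b powr (r - real \<nu> * r))\<^sup>2 * kn k powr (2 * r))"
      by (rule mult_left_mono) auto
    then have le: "(norm (p k))\<^sup>2 \<le> (real b powr (r - real \<nu> * r))\<^sup>2 * ((norm (p k))\<^sup>2 * kn k powr (2 * r))"
      by (simp only: mult_1_right mult_ac)
    have "(norm (p k $ i))\<^sup>2 \<le> (norm (p k))\<^sup>2" by (intro power_mono Finite_Cartesian_Product.norm_nth_le) auto
    from order.trans[OF this le]
    show "(norm (p k $ i))\<^sup>2 \<le> (real b powr (r - real \<nu> * r))\<^sup>2 * ((norm (p k))\<^sup>2 * kn k powr (2 * r))" .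
  qed
  also have "\<dots> = (real b powr (r - real \<nu> * r))\<^sup>2 * (\<Sum>k\<in>shell b \<nu>. (norm (p k))\<^sup>2 * kn k powr (2 * r))"
    by (simp add: sum_distrib_left)
  finally show ?thesis unfolding shell_norm_def
    by (metis (no_types, lifting) abs_of_nonneg powr_ge_zero real_sqrt_abs real_sqrt_le_mono real_sqrt_mult)
qed

text \<open>The displacements converge in the norm with one derivative, so the identity in
  \<open>kam_state\<close> passes to the limit on the real torus. The errors vanish in the limit,
  being close to the increments of \<open>Y\<close>, which tend to 0.\<close>

lemma kam_limit:
  fixes \<omega> :: "real ^ 'n" and q :: "'n \<Rightarrow> int ^ 'n \<Rightarrow> complex" and u :: "nat \<Rightarrow> 'n \<Rightarrow> int ^ 'n \<Rightarrow> complex"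
  assumes b: "2 \<le> b" and q: "\<And>i. wle 0 A (q i)" "\<And>i. q i 0 = 0"
    and st: "\<And>\<nu>. kam_state \<omega> (\<lambda>i z. \<Sum>k\<in>low b \<nu>. q i k * ee k z) (s \<nu>) (\<gamma> \<nu>) (\<epsilon> \<nu>) (u \<nu>) (e \<nu>) (Y \<nu>)"
    and s: "\<And>\<nu>. 0 \<le> s \<nu>" and \<gamma>: "\<And>\<nu>. \<gamma> \<nu> \<le> \<eta>"
    and d: "\<And>\<nu> i. wle 0 (\<delta> \<nu>) (\<lambda>k. u (Suc \<nu>) i k - u \<nu> i k)" "\<And>\<nu> i. wle 0 (\<delta> \<nu>) (knm (\<lambda>k. u (Suc \<nu>) i k - u \<nu> i k))"
    and Y: "\<And>\<nu> i. \<bar>Y (Suc \<nu>) $ i - Y \<nu> $ i\<bar> \<le> \<epsilon> \<nu>"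
    and e: "\<And>\<nu> i x. norm (fser (e \<nu> i) (cvec x) - complex_of_real (Y (Suc \<nu>) $ i - Y \<nu> $ i)) \<le> \<Omega> * \<delta> \<nu>"
    and sum: "summable \<delta>" "summable \<epsilon>"
  shows "\<exists>v Z. (\<forall>i. (\<exists>A. wle 0 A (v i)) \<and> wle 0 \<eta> (knm (v i)) \<and> herm (v i)) \<and>
     (\<forall>x i. fser (dcoef \<omega> (v i)) (cvec x) = fser (q i) (cvec (x + rvec v x)) - complex_of_real (Z $ i))"
proof -
  have u: "\<exists>A. wle 0 A (u \<nu> i)" "wle 0 (\<gamma> \<nu>) (knm (u \<nu> i))" "herm (u \<nu> i)" for \<nu> i
    using st[of \<nu>] wle_strip_mono[OF _ s] unfolding kam_state_def by blast+
  have ident: "fser (e \<nu> i) (cvec x) = (\<Sum>k\<in>low b \<nu>. q i k * ee k (cvec (x + rvec (u \<nu>) x)))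
     - complex_of_real (Y \<nu> $ i) - fser (dcoef \<omega> (u \<nu> i)) (cvec x)" for \<nu> i x
    using st[of \<nu>] unfolding kam_state_def by blast
  have \<delta>0: "0 \<le> \<delta> \<nu>" for \<nu> using wle_nonneg[OF d(1)] .
  \<comment> \<open>Tail sums of \<open>\<delta>\<close>: they bound the distance to every later
    iterate, hence to the limit.\<close>
  define T where "T N = suminf (\<lambda>\<nu>. \<delta> (\<nu> + N))" for N
  have Tlim: "T \<longlonglongrightarrow> 0" unfolding T_def using suminf_exist_split2[OF sum(1)] .
  have part: "(\<Sum>\<nu>=N..<M. \<delta> \<nu>) \<le> T N" for N M
  proof -
    have "(\<Sum>\<nu>=N..<M. \<delta> \<nu>) = (\<Sum>\<nu><M - N. \<delta> (\<nu> + N))"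
      using sum.shift_bounds_nat_ivl[of \<delta> 0 N "M - N"] 
      by (cases "N \<le> M") (auto simp: lessThan_atLeast0)
    also have "\<dots> \<le> T N" unfolding T_def
      by (rule sum_le_suminf) (use sum(1) \<delta>0 in \<open>auto simp: summable_iff_shift\<close>)
    finally show ?thesis .
  qed
  have tele: "wle 0 (\<Sum>\<nu>=N..<N + m. \<delta> \<nu>) (\<lambda>k. u (N + m) i k - u N i k)"
    "wle 0 (\<Sum>\<nu>=N..<N + m. \<delta> \<nu>) (knm (\<lambda>k. u (N + m) i k - u N i k))" for N m i
  proof (induction m)
    case 0
    { case 1 then show ?case by (simp add: wle_def) }
    { case 2 then show ?case by (simp add: wle_def knm_def) }
  next
    case (Suc m)
    { case 1
      have "(\<lambda>k. u (N + Suc m) i k - u N i k) = (\<lambda>k. (u (N + m) i k - u N i k) + (u (Suc (N + m)) i k - u (N + m) i k))"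
        by auto
      then show ?case using wle_add[OF Suc(1) d(1)[of "N + m" i]] by simp }
    { case 2
      have "knm (\<lambda>k. u (N + Suc m) i k - u N i k) = (\<lambda>k. knm (\<lambda>k. u (N + m) i k - u N i k) k + knm (\<lambda>k. u (Suc (N + m)) i k - u (N + m) i k) k)"
        by (auto simp: knm_def algebra_simps)
      then show ?case using wle_add[OF Suc(2) d(2)[of "N + m" i]] by simp }
  qed
  have diff: "wle 0 (T N) (\<lambda>k. u M i k - u N i k)" "wle 0 (T N) (knm (\<lambda>k. u M i k - u N i k))" if "N \<le> M" for N M i
  proof -
    have M: "M = N + (M - N)" using that by simp
    show "wle 0 (T N) (\<lambda>k. u M i k - u N i k)" "wle 0 (T N) (knm (\<lambda>k. u M i k - u N i k))"
      using wle_bound_mono[OF tele(1)[of N "M - N" i] part] wle_bound_mono[OF tele(2)[of N "M - N" i] part]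
      unfolding M[symmetric] by simp_all
  qed
  have "convergent (\<lambda>\<nu>. u \<nu> i k)" for i k
  proof -
    have "summable (\<lambda>\<nu>. u (Suc \<nu>) i k - u \<nu> i k)"
    proof (rule summable_comparison_test'[OF sum(1)])
      fix \<nu> show "norm (u (Suc \<nu>) i k - u \<nu> i k) \<le> \<delta> \<nu>"
        using d(1)[of \<nu> i] unfolding wle_def by (auto dest: spec[of _ "{k}"])
    qed
    then have "convergent (\<lambda>n. \<Sum>\<nu><n. u (Suc \<nu>) i k - u \<nu> i k)" by (simp add: summable_iff_convergent)
    then have "convergent (\<lambda>n. u n i k - u 0 i k)"
      using sum_lessThan_telescope[of "\<lambda>n. u n i k"] by simp
    then have "convergent (\<lambda>n. (u n i k - u 0 i k) + u 0 i k)" by (intro convergent_add convergent_const)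
    then show ?thesis by simp
  qed
  then obtain v where v: "\<And>i k. (\<lambda>\<nu>. u \<nu> i k) \<longlonglongrightarrow> v i k" unfolding convergent_def by metis
  have vd: "wle 0 (T N) (\<lambda>k. v i k - u N i k)" "wle 0 (T N) (knm (\<lambda>k. v i k - u N i k))" for N i
  proof -
    show "wle 0 (T N) (\<lambda>k. v i k - u N i k)" unfolding wle_def
    proof safe
      fix F :: "(int ^ 'n) set" assume F: "finite F"
      show "(\<Sum>k\<in>F. norm (v i k - u N i k) * exp (0 * kn k)) \<le> T N"
      proof (rule LIMSEQ_le_const2)
        show "(\<lambda>M. \<Sum>k\<in>F. norm (u M i k - u N i k) * exp (0 * kn k)) \<longlonglongrightarrow>
            (\<Sum>k\<in>F. norm (v i k - u N i k) * exp (0 * kn k))"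
          by (intro tendsto_intros v)
        show "\<exists>M0. \<forall>M\<ge>M0. (\<Sum>k\<in>F. norm (u M i k - u N i k) * exp (0 * kn k)) \<le> T N"
          using diff(1) F unfolding wle_def by blast
      qed
    qed
    show "wle 0 (T N) (knm (\<lambda>k. v i k - u N i k))" unfolding wle_def
    proof safe
      fix F :: "(int ^ 'n) set" assume F: "finite F"
      show "(\<Sum>k\<in>F. norm (knm (\<lambda>k. v i k - u N i k) k) * exp (0 * kn k)) \<le> T N"
      proof (rule LIMSEQ_le_const2)
        show "(\<lambda>M. \<Sum>k\<in>F. norm (knm (\<lambda>k. u M i k - u N i k) k) * exp (0 * kn k)) \<longlonglongrightarrow>
            (\<Sum>k\<in>F. norm (knm (\<lambda>k. v i k - u N i k) k) * exp (0 * kn k))"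
          unfolding norm_knm by (intro tendsto_intros v)
        show "\<exists>M0. \<forall>M\<ge>M0. (\<Sum>k\<in>F. norm (knm (\<lambda>k. u M i k - u N i k) k) * exp (0 * kn k)) \<le> T N"
          using diff(2) F unfolding wle_def by blast
      qed
    qed
  qed
  have v1: "wle 0 \<eta> (knm (v i))" for i unfolding wle_def
  proof safe
    fix F :: "(int ^ 'n) set" assume F: "finite F"
    show "(\<Sum>k\<in>F. norm (knm (v i) k) * exp (0 * kn k)) \<le> \<eta>"
    proof (rule LIMSEQ_le_const2)
      show "(\<lambda>M. \<Sum>k\<in>F. norm (knm (u M i) k) * exp (0 * kn k)) \<longlonglongrightarrow>
          (\<Sum>k\<in>F. norm (knm (v i) k) * exp (0 * kn k))"
        unfolding norm_knm by (intro tendsto_intros v)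
      show "\<exists>M0. \<forall>M\<ge>M0. (\<Sum>k\<in>F. norm (knm (u M i) k) * exp (0 * kn k)) \<le> \<eta>"
        using u(2) \<gamma> F unfolding wle_def by (blast intro: order.trans)
    qed
  qed
  have veq: "v i = (\<lambda>k. (v i k - u N i k) + u N i k)" for i N by auto
  have v0: "\<exists>A. wle 0 A (v i)" for i
    using wle_add[OF vd(1)[of 0 i]] u(1)[of 0 i] veq[of i 0] by metis
  have vh: "herm (v i)" for i unfolding herm_def
  proof
    fix k
    have "(\<lambda>\<nu>. u \<nu> i (- k)) \<longlonglongrightarrow> cnj (v i k)"
      using u(3) tendsto_cnj[OF v[of i k]] by (simp add: herm_def)
    then show "v i (- k) = cnj (v i k)" using v LIMSEQ_unique by blast
  qed
  have "convergent (\<lambda>\<nu>. Y \<nu> $ i)" for i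
  proof -
    have "summable (\<lambda>\<nu>. Y (Suc \<nu>) $ i - Y \<nu> $ i)"
      by (rule summable_comparison_test'[OF sum(2)]) (use Y in simp)
    then have "convergent (\<lambda>n. \<Sum>\<nu><n. Y (Suc \<nu>) $ i - Y \<nu> $ i)" by (simp add: summable_iff_convergent)
    then have "convergent (\<lambda>n. Y n $ i - Y 0 $ i)" using sum_lessThan_telescope[of "\<lambda>n. Y n $ i"] by simp
    then have "convergent (\<lambda>n. (Y n $ i - Y 0 $ i) + Y 0 $ i)" by (intro convergent_add convergent_const)
    then show ?thesis by simp
  qed
  then obtain z where z: "\<And>i. (\<lambda>\<nu>. Y \<nu> $ i) \<longlonglongrightarrow> z i" unfolding convergent_def by metis
  define Z where "Z = (\<chi> i. z i)"
  have "fser (dcoef \<omega> (v i)) (cvec x) = fser (q i) (cvec (x + rvec v x)) - complex_of_real (Z $ i)" for x i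
  proof -
    have uv: "(\<lambda>\<nu>. fser (u \<nu> j) (cvec x)) \<longlonglongrightarrow> fser (v j) (cvec x)" for j
    proof (rule Lim_null[THEN iffD2], rule Lim_null_comparison[OF _ Tlim], rule always_eventually, rule allI)
      fix \<nu>
      obtain A where A: "wle 0 A (u \<nu> j)" using u(1) by blast
      have "fser (v j) (cvec x) = fser (\<lambda>k. v j k - u \<nu> j k) (cvec x) + fser (u \<nu> j) (cvec x)"
        using fser_add[OF vd(1)[of \<nu> j] A, of "cvec x"] veq[of j \<nu>] by simp
      then show "norm (fser (u \<nu> j) (cvec x) - fser (v j) (cvec x)) \<le> T \<nu>"
        using norm_fser_le[OF vd(1)[of \<nu> j], of "cvec x"] by simp
    qed
    have duv: "(\<lambda>\<nu>. fser (dcoef \<omega> (u \<nu> i)) (cvec x)) \<longlonglongrightarrow> fser (dcoef \<omega> (v i)) (cvec x)"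
    proof (rule Lim_null[THEN iffD2], rule Lim_null_comparison)
      show "(\<lambda>\<nu>. norm \<omega> * T \<nu>) \<longlonglongrightarrow> 0" using tendsto_mult_left[OF Tlim, of "norm \<omega>"] by simp
      show "\<forall>\<^sub>F \<nu> in sequentially. norm (fser (dcoef \<omega> (u \<nu> i)) (cvec x) - fser (dcoef \<omega> (v i)) (cvec x)) \<le> norm \<omega> * T \<nu>"
      proof (rule always_eventually, rule allI)
        fix \<nu>
        have "dcoef \<omega> (v i) = (\<lambda>k. dcoef \<omega> (\<lambda>k. v i k - u \<nu> i k) k + dcoef \<omega> (u \<nu> i) k)"
          by (auto simp: dcoef_def algebra_simps)
        then have "fser (dcoef \<omega> (v i)) (cvec x) = fser (dcoef \<omega> (\<lambda>k. v i k - u \<nu> i k)) (cvec x) + fser (dcoef \<omega> (u \<nu> i)) (cvec x)"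
          using fser_add[OF wle_dcoef[OF vd(2)[of \<nu> i] abs_component_le] wle_dcoef[OF u(2)[of \<nu> i] abs_component_le], of "cvec x" \<omega> \<omega>]
          by simp
        then show "norm (fser (dcoef \<omega> (u \<nu> i)) (cvec x) - fser (dcoef \<omega> (v i)) (cvec x)) \<le> norm \<omega> * T \<nu>"
          using norm_fser_le[OF wle_dcoef[OF vd(2)[of \<nu> i] abs_component_le], of "cvec x" \<omega>] by simp
      qed
    qed
    have e0: "(\<lambda>\<nu>. fser (e \<nu> i) (cvec x)) \<longlonglongrightarrow> 0"
    proof (rule Lim_null_comparison)
      have "(\<lambda>\<nu>. \<Omega> * \<delta> \<nu> + \<epsilon> \<nu>) \<longlonglongrightarrow> \<Omega> * 0 + 0"
        by (intro tendsto_intros summable_LIMSEQ_zero sum)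
      then show "(\<lambda>\<nu>. \<Omega> * \<delta> \<nu> + \<epsilon> \<nu>) \<longlonglongrightarrow> 0" by simp
      show "\<forall>\<^sub>F \<nu> in sequentially. norm (fser (e \<nu> i) (cvec x)) \<le> \<Omega> * \<delta> \<nu> + \<epsilon> \<nu>"
      proof (rule always_eventually, rule allI)
        fix \<nu>
        show "norm (fser (e \<nu> i) (cvec x)) \<le> \<Omega> * \<delta> \<nu> + \<epsilon> \<nu>"
          using norm_triangle_sub[of "fser (e \<nu> i) (cvec x)" "complex_of_real (Y (Suc \<nu>) $ i - Y \<nu> $ i)"]
            e[of \<nu> i x] Y[of \<nu> i] by (simp only: norm_of_real)
      qed
    qed
    have rv: "(\<lambda>\<nu>. rvec (u \<nu>) x) \<longlonglongrightarrow> rvec v x"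
      by (rule vec_tendstoI) (simp add: rvec_def tendsto_Re uv)
    have qlim: "(\<lambda>\<nu>. \<Sum>k\<in>low b \<nu>. q i k * ee k (cvec (x + rvec (u \<nu>) x))) \<longlonglongrightarrow> fser (q i) (cvec (x + rvec v x))"
    proof -
      have c: "(\<lambda>\<nu>. fser (q i) (cvec (x + rvec (u \<nu>) x))) \<longlonglongrightarrow> fser (q i) (cvec (x + rvec v x))"
        by (rule continuous_on_tendsto_compose[OF continuous_on_fser[OF q(1)]])
           (auto intro!: tendsto_intros rv)
      \<comment> \<open>The truncation error is estimated uniformly in the evaluation point, which
        moves with \<open>\<nu>\<close>.\<close>
      have "(\<lambda>\<nu>. (\<Sum>k\<in>low b \<nu>. q i k * ee k (cvec (x + rvec (u \<nu>) x))) - fser (q i) (cvec (x + rvec (u \<nu>) x))) \<longlonglongrightarrow> 0"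
      proof (rule LIMSEQ_I)
        fix h :: real assume h: "0 < h"
        obtain F where F: "finite F" "wle 0 (h / 2) (\<lambda>k. if k \<in> F then 0 else q i k)"
          by (rule wle_tail[OF q(1)[of i], of "h / 2" "{}"]) (use h in auto)
        obtain N where N: "\<And>\<nu>. N \<le> \<nu> \<Longrightarrow> F - {0} \<subseteq> low b \<nu>"
          using low_eventually[OF b F(1)] by (auto simp: eventually_sequentially)
        show "\<exists>no. \<forall>n\<ge>no. norm ((\<Sum>k\<in>low b n. q i k * ee k (cvec (x + rvec (u n) x))) - fser (q i) (cvec (x + rvec (u n) x)) - 0) < h"
        proof (intro exI allI impI)
          fix \<nu> assume \<nu>: "N \<le> \<nu>"
          let ?y = "cvec (x + rvec (u \<nu>) x)"
          have t: "wle 0 (h / 2) (\<lambda>k. if k \<in> low b \<nu> then 0 else q i k)"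
            by (rule wle_mono[OF F(2) order_refl]) (use N[OF \<nu>] q(2) in auto)
          have "fser (q i) ?y = (\<Sum>k\<in>low b \<nu>. q i k * ee k ?y) + fser (\<lambda>k. if k \<in> low b \<nu> then 0 else q i k) ?y"
            by (rule fser_split[OF q(1) finite_low]) simp
          then have "norm ((\<Sum>k\<in>low b \<nu>. q i k * ee k ?y) - fser (q i) ?y - 0) \<le> h / 2"
            using norm_fser_le[OF t, of ?y] by simp
          then show "norm ((\<Sum>k\<in>low b \<nu>. q i k * ee k ?y) - fser (q i) ?y - 0) < h" using h by simp
        qed
      qed
      from tendsto_add[OF this c] show ?thesis by simp
    qed
    have "(\<lambda>\<nu>. fser (e \<nu> i) (cvec x)) \<longlonglongrightarrow> fser (q i) (cvec (x + rvec v x)) - complex_of_real (z i) - fser (dcoef \<omega> (v i)) (cvec x)"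
      unfolding ident by (intro tendsto_intros qlim duv z)
    then have "0 = fser (q i) (cvec (x + rvec v x)) - complex_of_real (z i) - fser (dcoef \<omega> (v i)) (cvec x)"
      using e0 LIMSEQ_unique by blast
    then show ?thesis by (simp add: Z_def)
  qed
  then show ?thesis using v0 v1 vh by blast
qed

section \<open>Diffeomorphisms of the torus\<close>

text \<open>The bound \<open>norm h \<le> 2 * norm (L h)\<close> gives injectivity, hence
  bijectivity in finite dimensions, and the bound on the inverse.\<close>

lemma near_identity:
  fixes A :: "'a::euclidean_space \<Rightarrow>\<^sub>L 'a"
  assumes "norm A \<le> 1 / 2"
  defines "L \<equiv> \<lambda>h. h + A h"
  shows "bounded_linear L" "bij L" "bounded_linear (inv L)" "norm (inv L h) \<le> 2 * norm h"
proof -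
  have low: "norm h \<le> 2 * norm (L h)" for h
  proof -
    have "norm (A h) \<le> norm A * norm h" by (rule norm_blinfun)
    also have "\<dots> \<le> 1 / 2 * norm h" by (rule mult_right_mono[OF assms(1)]) simp
    finally have "norm (A h) \<le> norm h / 2" by simp
    then show ?thesis using norm_diff_ineq[of h "A h"] by (simp add: L_def)
  qed
  show L: "bounded_linear L" unfolding L_def by (intro bounded_linear_add bounded_linear_ident blinfun.bounded_linear_right)
  have lin: "linear L" using L by (rule bounded_linear.linear)
  have "inj L" unfolding linear_injective_0[OF lin] using low by (metis norm_le_zero_iff norm_zero mult_zero_right)
  then show bij: "bij L" using linear_injective_imp_surjective[OF lin] by (simp add: bij_def)
  have "linear (inv L)"
    by (rule linearI; rule inv_f_eq[OF \<open>inj L\<close>])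
       (simp_all add: linear_add[OF lin] linear_cmul[OF lin] bij_inv_eq_iff[OF bij] surj_f_inv_f[OF bij_is_surj[OF bij]])
  then show "bounded_linear (inv L)" by (simp add: linear_conv_bounded_linear)
  show "norm (inv L h) \<le> 2 * norm h"
    using low[of "inv L h"] by (simp add: surj_f_inv_f[OF bij_is_surj[OF bij]])
qed

locale small_displacement =
  fixes V :: "real ^ 'n \<Rightarrow> real ^ 'n" and V' :: "real ^ 'n \<Rightarrow> (real ^ 'n) \<Rightarrow>\<^sub>L (real ^ 'n)"
  assumes deriv: "\<And>x. (V has_derivative blinfun_apply (V' x)) (at x)"
    and cont: "continuous_on UNIV V'"
    and small: "\<And>x. norm (V' x) \<le> 1 / 2"
    and periodic: "\<And>x v. v \<in> period_lattice \<Longrightarrow> V (x + v) = V x"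
begin

definition "\<Psi> x = x + V x"

definition "D x h = h + V' x h"

lemma deriv_\<Psi>: "(\<Psi> has_derivative D x) (at x)"
  unfolding \<Psi>_def[abs_def] D_def by (intro has_derivative_add has_derivative_ident deriv)

lemma lipschitz: "norm (V x - V y) \<le> 1 / 2 * norm (x - y)"
  by (rule differentiable_bound[of UNIV V "\<lambda>x. blinfun_apply (V' x)"])
     (use deriv small in \<open>auto simp: norm_blinfun.rep_eq[symmetric]\<close>)

lemma expand: "norm (x - y) \<le> 2 * norm (\<Psi> x - \<Psi> y)"
proof -
  have "x - y = (\<Psi> x - \<Psi> y) - (V x - V y)" by (simp add: \<Psi>_def)
  then have "norm (x - y) \<le> norm (\<Psi> x - \<Psi> y) + norm (V x - V y)" by (metis norm_triangle_ineq4)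
  then show ?thesis using lipschitz[of x y] by simp
qed

lemma bij_\<Psi>: "bij \<Psi>"
proof -
  have "inj \<Psi>"
  proof (rule injI)
    fix x y assume "\<Psi> x = \<Psi> y"
    then show "x = y" using expand[of x y] by simp
  qed
  moreover have "\<exists>x. y = \<Psi> x" for y
  proof -
    \<comment> \<open>Surjectivity by Banach's fixed point theorem: \<open>\<Psi> x = y\<close>
      means that \<open>x\<close> is a fixed point of the contraction
      \<open>\<lambda>x. y - V x\<close>.\<close>
    have "dist (y - V x) (y - V x') \<le> 1 / 2 * dist x x'" for x x'
      using lipschitz[of x' x] by (simp add: dist_norm norm_minus_commute)
    then have "\<exists>!x. y - V x = x" by (intro banach_fix_type[of "1 / 2"]) auto
    then obtain x where "y - V x = x" by blast
    then have "y = \<Psi> x" by (simp add: \<Psi>_def algebra_simps)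
    then show ?thesis by blast
  qed
  ultimately show ?thesis by (auto simp: bij_def surj_def)
qed

lemma \<Psi>_inv [simp]: "\<Psi> (inv \<Psi> y) = y"
  using bij_\<Psi> by (simp add: bij_is_surj surj_f_inv_f)

lemma inv_lipschitz: "norm (inv \<Psi> x - inv \<Psi> y) \<le> 2 * norm (x - y)"
  using expand[of "inv \<Psi> x" "inv \<Psi> y"] by simp

lemma continuous_inv: "continuous_on UNIV (inv \<Psi>)"
proof -
  have "2-lipschitz_on UNIV (inv \<Psi>)"
    by (rule lipschitz_onI) (use inv_lipschitz in \<open>auto simp: dist_norm\<close>)
  then show ?thesis by (rule lipschitz_on_continuous_on)
qed

lemmas nearD = near_identity[OF small, folded D_def]

lemma deriv_inv: "(inv \<Psi> has_derivative inv (D (inv \<Psi> y))) (at y)"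
proof (rule has_derivative_inverse_basic[OF deriv_\<Psi>, where T = UNIV])
  show "bounded_linear (inv (D (inv \<Psi> y)))" using nearD(3)[of "inv \<Psi> y"] by (simp add: D_def[abs_def])
  show "inv (D (inv \<Psi> y)) \<circ> D (inv \<Psi> y) = id"
    using nearD(2)[of "inv \<Psi> y"] by (simp add: D_def[abs_def] bij_is_inj)
  show "continuous (at y) (inv \<Psi>)" using continuous_inv by (simp add: continuous_on_eq_continuous_at)
qed auto

lemma C1_\<Psi>: "C1_map \<Psi>"
  unfolding C1_map_def
proof (intro exI conjI allI)
  have "blinfun_apply (id_blinfun + V' x) = D x" for x by (auto simp: D_def blinfun.add_left)
  then show "(\<Psi> has_derivative blinfun_apply (id_blinfun + V' x)) (at x)" for x using deriv_\<Psi> by simp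
  show "continuous_on UNIV (\<lambda>x. id_blinfun + V' x)" by (intro continuous_intros cont)
qed

lemma C1_inv: "C1_map (inv \<Psi>)"
  unfolding C1_map_def
proof (intro exI conjI allI)
  let ?G = "\<lambda>y. Blinfun (inv (D (inv \<Psi> y)))"
  have bl: "bounded_linear (inv (D x))" for x using nearD(3)[of x] by (simp add: D_def[abs_def])
  have app: "blinfun_apply (?G y) = inv (D (inv \<Psi> y))" for y
    by (rule bounded_linear_Blinfun_apply[OF bl])
  show "(inv \<Psi> has_derivative blinfun_apply (?G y)) (at y)" for y unfolding app by (rule deriv_inv)
  have bijD: "bij (D x)" for x using nearD(2)[of x] by (simp add: D_def[abs_def])
  have nD: "norm (inv (D x) h) \<le> 2 * norm h" for x h using nearD(4)[of x h] by (simp add: D_def[abs_def])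
  \<comment> \<open>The difference of the inverses is
    \<open>inv A \<circ> (B - A) \<circ> inv B\<close>, and both inverses have norm at most 2, hence
    the factor 4.\<close>
  have le: "norm (?G y - ?G z) \<le> 4 * norm (V' (inv \<Psi> y) - V' (inv \<Psi> z))" for y z
  proof (rule norm_blinfun_bound)
    fix h
    let ?A = "D (inv \<Psi> y)" and ?B = "D (inv \<Psi> z)"
    have A: "inv ?A (?A k) = k" for k by (rule inv_f_f[OF bij_is_inj[OF bijD]])
    have B: "?B (inv ?B k) = k" for k by (rule surj_f_inv_f[OF bij_is_surj[OF bijD]])
    interpret A: bounded_linear "inv ?A" by (rule bl)
    have "inv ?A h - inv ?B h = inv ?A (?B (inv ?B h) - ?A (inv ?B h))"
      by (simp add: A.diff A B)
    also have "?B (inv ?B h) - ?A (inv ?B h) = - ((V' (inv \<Psi> y) - V' (inv \<Psi> z)) (inv ?B h))"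
      by (simp add: D_def blinfun.diff_left)
    finally have "norm (inv ?A h - inv ?B h) \<le> 2 * norm ((V' (inv \<Psi> y) - V' (inv \<Psi> z)) (inv ?B h))"
      using nD by (metis norm_minus_cancel)
    also have "\<dots> \<le> 2 * (norm (V' (inv \<Psi> y) - V' (inv \<Psi> z)) * norm (inv ?B h))"
      by (intro mult_left_mono norm_blinfun) auto
    also have "\<dots> \<le> 2 * (norm (V' (inv \<Psi> y) - V' (inv \<Psi> z)) * (2 * norm h))"
      by (intro mult_left_mono nD) auto
    finally show "norm ((?G y - ?G z) h) \<le> 4 * norm (V' (inv \<Psi> y) - V' (inv \<Psi> z)) * norm h"
      by (simp add: blinfun.diff_left app)
  qed simp
  have c: "continuous_on UNIV (\<lambda>y. V' (inv \<Psi> y))"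
    by (rule continuous_on_compose2[OF cont continuous_inv]) auto
  show "continuous_on UNIV ?G"
    unfolding continuous_on_def
  proof
    fix z
    have "((\<lambda>y. V' (inv \<Psi> y)) \<longlongrightarrow> V' (inv \<Psi> z)) (at z)" using c by (simp add: continuous_on_def)
    then have "((\<lambda>y. 4 * norm (V' (inv \<Psi> y) - V' (inv \<Psi> z))) \<longlongrightarrow> 4 * norm (V' (inv \<Psi> z) - V' (inv \<Psi> z))) (at z)"
      by (intro tendsto_intros)
    then have "((\<lambda>y. 4 * norm (V' (inv \<Psi> y) - V' (inv \<Psi> z))) \<longlongrightarrow> 0) (at z)" by simp
    then have "((\<lambda>y. ?G y - ?G z) \<longlongrightarrow> 0) (at z)"
      by (rule Lim_null_comparison[rotated]) (simp add: le)
    then show "(?G \<longlongrightarrow> ?G z) (at z within UNIV)" using Lim_null by blast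
  qed
qed

text \<open>The nontrivial direction holds because \<open>\<Psi>\<close> commutes with translations
  by periods and is injective.\<close>

lemma lattice: "\<Psi> x - \<Psi> y \<in> period_lattice \<longleftrightarrow> x - y \<in> period_lattice"
proof
  assume "x - y \<in> period_lattice"
  from periodic[OF this, of y] show "\<Psi> x - \<Psi> y \<in> period_lattice"
    using \<open>x - y \<in> period_lattice\<close> by (simp add: \<Psi>_def)
next
  assume *: "\<Psi> x - \<Psi> y \<in> period_lattice"
  have "\<Psi> (y + (\<Psi> x - \<Psi> y)) = \<Psi> x" using periodic[OF *, of y] by (simp add: \<Psi>_def)
  then have "y + (\<Psi> x - \<Psi> y) = x" using bij_is_inj[OF bij_\<Psi>] by (simp add: inj_eq)
  then show "x - y \<in> period_lattice" using * by (metis add_diff_cancel_left')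
qed

lemma torus_diffeo: "torus_C1_diffeo \<Psi>"
  unfolding torus_C1_diffeo_def using bij_\<Psi> C1_\<Psi> C1_inv lattice by blast

lemma inj_D: "inj (D x)"
  using nearD(2)[of x] by (simp add: D_def[abs_def] bij_is_inj)

lemma KAM_appliesI:
  assumes "\<And>x. V' x \<omega> = P (x + V x) - Y"
  shows "KAM_applies \<omega> P"
  unfolding KAM_applies_def
proof (intro exI conjI)
  show "torus_C1_diffeo \<Psi>" by (rule torus_diffeo)
  show "pullback \<Psi> (\<lambda>x. \<omega> + P x - Y) = (\<lambda>x. \<omega>)"
  proof
    fix x
    have "frechet_derivative \<Psi> (at x) = D x" using frechet_derivative_at[OF deriv_\<Psi>] by simp
    moreover have "\<omega> + P (\<Psi> x) - Y = D x \<omega>" using assms[of x] by (simp add: D_def \<Psi>_def)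
    ultimately show "pullback \<Psi> (\<lambda>x. \<omega> + P x - Y) x = \<omega>"
      by (simp add: pullback_def inv_f_f[OF inj_D])
  qed
qed

end

text \<open>The factor \<open>CARD('n)\<close> arises from bounding the Euclidean norm by the sum of
  the components.\<close>

lemma small_displacement_rvec:
  fixes v :: "'n \<Rightarrow> int ^ 'n \<Rightarrow> complex"
  assumes v: "\<And>i. wle 0 (A i) (v i)" "\<And>i. wle 0 \<eta> (knm (v i))" and \<eta>: "real CARD('n) * \<eta> \<le> 1 / 2"
  defines "V' \<equiv> \<lambda>x. Blinfun (\<lambda>h. \<chi> j. Re (fser (dcoef h (v j)) (cvec x)))"
  shows "small_displacement (rvec v) V'" "blinfun_apply (V' x) h = (\<chi> j. Re (fser (dcoef h (v j)) (cvec x)))"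
proof -
  have bl: "bounded_linear (\<lambda>h. \<chi> j. Re (fser (dcoef h (v j)) (cvec x)))" for x
    using rvec_has_derivative[OF v, where x = x] by (rule has_derivative_bounded_linear)
  have app: "blinfun_apply (V' x) = (\<lambda>h. \<chi> j. Re (fser (dcoef h (v j)) (cvec x)))" for x
    unfolding V'_def by (rule bounded_linear_Blinfun_apply[OF bl])
  show "blinfun_apply (V' x) h = (\<chi> j. Re (fser (dcoef h (v j)) (cvec x)))" by (simp add: app)
  show "small_displacement (rvec v) V'"
  proof
    show "(rvec v has_derivative blinfun_apply (V' x)) (at x)" for x
      unfolding app by (rule rvec_has_derivative[OF v])
    show "continuous_on UNIV V'"
    proof (rule continuous_on_blinfun_componentwise)
      fix b :: "real ^ 'n" assume "b \<in> Basis"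
      have "wle 0 (norm b * \<eta>) (dcoef b (v j))" for j by (rule wle_dcoef[OF v(2) abs_component_le])
      then show "continuous_on UNIV (\<lambda>x. V' x b)" unfolding app
        by (intro continuous_on_vec_lambda continuous_on_Re continuous_on_fser)
    qed
    show "norm (V' x) \<le> 1 / 2" for x
    proof (rule norm_blinfun_bound)
      fix h
      have "norm (V' x h) \<le> (\<Sum>j\<in>UNIV. \<bar>V' x h $ j\<bar>)" by (rule norm_le_l1_cart)
      also have "\<dots> \<le> (\<Sum>j\<in>(UNIV :: 'n set). norm h * \<eta>)"
      proof (intro sum_mono)
        fix j
        have "\<bar>V' x h $ j\<bar> \<le> norm (fser (dcoef h (v j)) (cvec x))" by (simp add: app abs_Re_le_cmod)
        also have "\<dots> \<le> norm h * \<eta>" by (rule norm_fser_le[OF wle_dcoef[OF v(2) abs_component_le]]) simp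
        finally show "\<bar>V' x h $ j\<bar> \<le> norm h * \<eta>" .
      qed
      also have "\<dots> = (real CARD('n) * \<eta>) * norm h" by simp
      also have "\<dots> \<le> 1 / 2 * norm h" by (rule mult_right_mono[OF \<eta>]) simp
      finally show "norm (V' x h) \<le> 1 / 2 * norm h" .
    qed simp
    show "rvec v (x + w) = rvec v x" if "w \<in> period_lattice" for x w
      using that by (simp add: rvec_def fser_periodic vec_eq_iff)
  qed
qed

text \<open>At \<open>x = 0\<close> all characters are 1, and unconditional convergence of a complex
  series is absolute convergence. The mean is set to 0 because the given sum leaves out
  \<open>k = 0\<close>.\<close>

lemma fourier_series_coeffs:
  fixes P :: "real ^ 'n \<Rightarrow> real ^ 'n" and p :: "int ^ 'n \<Rightarrow> complex ^ 'n"
  assumes "is_fourier_series P p"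
  defines "q \<equiv> \<lambda>i k. if k = 0 then 0 else p k $ i"
  shows "\<exists>A. \<forall>i. wle 0 A (q i)" "fser (q i) (cvec x) = complex_of_real (P x $ i)" "herm (q i)"
proof -
  have hs: "((\<lambda>k. p k $ i * ee k (cvec x)) has_sum complex_of_real (P x $ i)) (UNIV - {0})" for i x
  proof -
    have "((\<lambda>k. (exp (\<i> * complex_of_real (freq k x)) *s p k) $ i) has_sum
        (\<chi> i. complex_of_real (P x $ i)) $ i) (UNIV - {0})"
      using assms(1) unfolding is_fourier_series_def
      by (intro has_sum_bounded_linear[OF bounded_linear_vec_nth]) blast
    then show ?thesis by (simp add: ee_cvec mult.commute)
  qed
  have hs': "((\<lambda>k. q i k * ee k (cvec x)) has_sum complex_of_real (P x $ i)) UNIV" for i x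
    using hs[of i x] by (subst has_sum_cong_neutral[where T = "UNIV - {0}" and g = "\<lambda>k. p k $ i * ee k (cvec x)"])
      (auto simp: q_def)
  have "ee k (cvec 0) = 1" for k :: "int ^ 'n" by (simp add: ee_cvec freq_def)
  then have "(\<lambda>k. q i k) summable_on UNIV" for i
    using hs'[of i 0] by (auto simp: summable_on_def)
  then have s: "(\<lambda>k. norm (q i k)) summable_on UNIV" for i
    using summable_on_iff_abs_summable_on_complex by blast
  define A where "A = Max (range (\<lambda>i. \<Sum>\<^sub>\<infinity>k. norm (q i k)))"
  have w: "wle 0 A (q i)" for i
    by (rule wleI) (use s in \<open>auto simp: A_def\<close>)
  then show "\<exists>A. \<forall>i. wle 0 A (q i)" by blast
  show f: "fser (q i) (cvec x) = complex_of_real (P x $ i)" for i x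
    unfolding fser_def by (rule infsumI[OF hs'])
  show "herm (q i)" by (rule herm_if_real[OF w]) (simp add: f)
qed

section \<open>The case of nonnegative exponents\<close>

lemma trig_real:
  assumes "herm q" "finite G" "\<And>k. - k \<in> G \<longleftrightarrow> k \<in> G"
  shows "(\<Sum>k\<in>G. q k * ee k (cvec x)) \<in> \<real>"
proof -
  have "herm (\<lambda>k. if k \<in> G then q k else 0)" using assms(1,3) by (auto simp: herm_def)
  from herm_real[OF this, of x] show ?thesis by (simp add: fser_finite assms(2))
qed

lemma card_signs_ge_1: "1 \<le> card (signs :: (real ^ 'n) set)"
proof -
  have "(\<chi> i. 1) \<in> (signs :: (real ^ 'n) set)" by (simp add: signs_def)
  then have "0 < card (signs :: (real ^ 'n) set)" by (metis card_gt_0_iff empty_iff finite_signs)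
  then show ?thesis by simp
qed

lemma kam_nonneg:
  fixes \<omega> :: "real ^ 'n" and \<tau> :: real and b :: nat
  assumes dio: "diophantine \<tau> \<omega>" and \<tau>: "0 \<le> \<tau>" and b: "2 \<le> b"
  shows "\<exists>\<epsilon>>0. \<forall>(P :: real ^ 'n \<Rightarrow> real ^ 'n) (p :: int ^ 'n \<Rightarrow> complex ^ 'n).
           is_fourier_series P p \<and> fourier_norm (\<tau> + 1) b p \<le> ennreal \<epsilon> \<longrightarrow> KAM_applies \<omega> P"
proof -
  obtain C where C: "small_divisor_bound \<omega> \<tau> C" using ex_small_divisor_bound[OF dio \<tau>] by blast
  have C0: "0 < C" using C by (simp add: small_divisor_bound_def)
  \<comment> \<open>\<open>S\<close> collects the roots of the numbers of sign vectors and of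
    rounding offsets; \<open>2 powr (\<tau> + 1)\<close> in \<open>c1\<close> stems from
    \<open>s - t \<ge> s / 2\<close>. \<open>\<eta>\<close> makes \<open>n * \<eta>\<close> and
    \<open>K * \<eta>\<close> at most 1/4, and \<open>\<epsilon>0\<close> makes the total derivative
    bound \<open>4 * c1 * c3 * \<epsilon>0\<close> equal to \<open>\<eta>\<close>.\<close>
  define n where "n = real CARD('n)"
  define S where "S = sqrt (card (signs :: (real ^ 'n) set)) * noff TYPE('n)"
  define B where "B = real b powr (\<tau> + 1)"
  define K where "K = B * S * n"
  define c1 where "c1 = C * 2 powr (\<tau> + 1)"
  define c3 where "c3 = B * S * (2 * exp (4 * n)) * B"
  define \<eta> where "\<eta> = 1 / (4 * (n + K))"
  define \<epsilon>0 where "\<epsilon>0 = \<eta> / (4 * c1 * c3)"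
  have b0: "0 < real b" using b by simp
  have n: "1 \<le> n" by (simp add: n_def)
  have S: "0 < S" unfolding S_def using card_signs_ge_1[where 'n = 'n] noff_ge_1[where 'n = 'n]
    by (intro mult_pos_pos) auto
  have B: "0 < B" using b0 by (simp add: B_def)
  have K: "0 < K" unfolding K_def using B S n by simp
  have c1: "0 < c1" unfolding c1_def using C0 by simp
  have c3: "0 < c3" unfolding c3_def using B S by simp
  have \<eta>: "0 < \<eta>" unfolding \<eta>_def using n K by simp
  have \<eta>n: "n * \<eta> \<le> 1 / 4" unfolding \<eta>_def using n K by (simp add: field_simps)
  have \<eta>K: "K * \<eta> \<le> 1 / 4" unfolding \<eta>_def using n K by (simp add: field_simps)
  have \<eta>4: "\<eta> \<le> 1 / 4" using mult_right_mono[OF n less_imp_le[OF \<eta>]] \<eta>n by linarith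
  have \<epsilon>0: "0 < \<epsilon>0" unfolding \<epsilon>0_def using \<eta> c1 c3 by simp
  have "KAM_applies \<omega> P" if F: "is_fourier_series P p" and N: "fourier_norm (\<tau> + 1) b p \<le> ennreal \<epsilon>0"
    for P :: "real ^ 'n \<Rightarrow> real ^ 'n" and p :: "int ^ 'n \<Rightarrow> complex ^ 'n"
  proof -
    define q where "q = (\<lambda>i k. if k = 0 then 0 else p k $ i)"
    obtain A where A: "\<And>i. wle 0 A (q i)" using fourier_series_coeffs(1)[OF F] unfolding q_def by blast
    have qP: "fser (q i) (cvec x) = complex_of_real (P x $ i)" for i x
      using fourier_series_coeffs(2)[OF F] unfolding q_def by blast
    have qh: "herm (q i)" for i using fourier_series_coeffs(3)[OF F] unfolding q_def by blast
    define \<pi> where "\<pi> = shell_norm (\<tau> + 1) b p"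
    have \<pi>0: "0 \<le> \<pi> \<nu>" for \<nu> by (simp add: \<pi>_def shell_norm_nonneg)
    have \<pi>sum: "(\<Sum>\<nu><m. \<pi> \<nu>) \<le> \<epsilon>0" for m
      unfolding \<pi>_def by (rule sum_shell_norm_le[OF N]) (use \<epsilon>0 in simp)
    \<comment> \<open>The admissible error rescaled by \<open>b powr (\<nu> * (\<tau> + 1))\<close>;
      in this scale \<open>c1 * D \<nu>\<close> bounds the derivative of the correction with
      \<open>c1\<close> independent of \<open>\<nu>\<close>.\<close>
    define D where "D = rec_nat 0 (\<lambda>\<nu> d. d / 2 + c3 * \<pi> \<nu>)"
    have D: "D 0 = 0" "D (Suc \<nu>) = D \<nu> / 2 + c3 * \<pi> \<nu>" for \<nu> by (simp_all add: D_def)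
    have D0: "0 \<le> D \<nu>" for \<nu> by (induction \<nu>) (use D \<pi>0 c3 in auto)
    have Dsum: "(\<Sum>\<nu><m. D \<nu>) \<le> 2 * (c3 * \<epsilon>0)" for m
    proof -
      \<comment> \<open>The summed recursion; \<open>D m\<close> stems from the index shift, and
        half of the sum is absorbed on the left.\<close>
      have "(\<Sum>\<nu><m. D \<nu>) + D m \<le> (\<Sum>\<nu><m. D \<nu>) / 2 + c3 * (\<Sum>\<nu><m. \<pi> \<nu>)"
        by (induction m) (auto simp: D field_simps)
      moreover have "c3 * (\<Sum>\<nu><m. \<pi> \<nu>) \<le> c3 * \<epsilon>0" using c3 by (intro mult_left_mono \<pi>sum) auto
      ultimately show ?thesis using D0[of m] by linarith
    qed
    \<comment> \<open>Derivative bounds add up along the iteration, so the sum of the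
      \<open>D \<nu>\<close> has to be small, not just each of them.\<close>
    define \<gamma> where "\<gamma> \<nu> = 2 * c1 * (\<Sum>\<mu><\<nu>. D \<mu>)" for \<nu>
    have \<gamma>Suc: "\<gamma> (Suc \<nu>) = \<gamma> \<nu> + 2 * (c1 * D \<nu>)" for \<nu> by (simp add: \<gamma>_def algebra_simps)
    have \<gamma>0: "0 \<le> \<gamma> \<nu>" for \<nu> unfolding \<gamma>_def using c1 D0 by (simp add: sum_nonneg)
    have \<gamma>\<eta>: "\<gamma> \<nu> \<le> \<eta>" for \<nu>
    proof -
      have "\<gamma> \<nu> \<le> 2 * c1 * (2 * (c3 * \<epsilon>0))" unfolding \<gamma>_def using c1 by (intro mult_left_mono Dsum) auto
      also have "\<dots> = \<eta>" using c1 c3 by (simp add: \<epsilon>0_def)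
      finally show ?thesis .
    qed
    have c1D: "c1 * D \<nu> \<le> \<eta> / 2" for \<nu> using \<gamma>\<eta>[of "Suc \<nu>"] \<gamma>0[of \<nu>] by (simp add: \<gamma>Suc)
    define s where "s \<nu> = real b powr (- real \<nu>)" for \<nu>
    define \<epsilon> where "\<epsilon> \<nu> = real b powr (- real \<nu> * (\<tau> + 1)) * D \<nu>" for \<nu>
    have \<epsilon>D: "\<epsilon> \<nu> \<le> D \<nu>" "0 \<le> \<epsilon> \<nu>" for \<nu>
    proof -
      have "real b powr (- real \<nu> * (\<tau> + 1)) \<le> real b powr 0" using b \<tau> by (intro powr_mono) auto
      then show "\<epsilon> \<nu> \<le> D \<nu>" unfolding \<epsilon>_def using mult_right_mono[OF _ D0] b0 by fastforce
      show "0 \<le> \<epsilon> \<nu>" unfolding \<epsilon>_def using D0 by simp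
    qed
    define PP where "PP \<nu> = (\<lambda>i z. \<Sum>k\<in>low b \<nu>. q i k * ee k z)" for \<nu>
    let ?st = "\<lambda>\<nu> X. kam_state \<omega> (PP \<nu>) (s \<nu>) (\<gamma> \<nu>) (\<epsilon> \<nu>) (fst X) (fst (snd X)) (snd (snd X))"
    let ?rel = "\<lambda>\<nu> X X'. \<forall>i. wle 0 (2 * (c1 * D \<nu>)) (\<lambda>k. fst X' i k - fst X i k) \<and>
        wle 0 (2 * (c1 * D \<nu>)) (knm (\<lambda>k. fst X' i k - fst X i k)) \<and>
        \<bar>snd (snd X') $ i - snd (snd X) $ i\<bar> \<le> \<epsilon> \<nu> \<and>
        (\<forall>x. norm (fser (fst (snd X) i) (cvec x) - complex_of_real (snd (snd X') $ i - snd (snd X) $ i)) \<le> norm \<omega> * (c1 * D \<nu>))"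
    have "\<exists>X. \<forall>\<nu>. ?st \<nu> (X \<nu>) \<and> ?rel \<nu> (X \<nu>) (X (Suc \<nu>))"
    proof (rule dependent_nat_choice)
      \<comment> \<open>The start is the identity: \<open>low b 0\<close> is empty, so the initial
        field is constant and the error is 0.\<close>
      show "\<exists>X. ?st 0 X"
        by (rule exI[of _ "(\<lambda>i k. 0, \<lambda>i k. 0, 0)"])
           (auto simp: kam_state_def PP_def low_def \<gamma>_def \<epsilon>_def D wle_def l2le_def herm_def fser_def dcoef_def knm_def)
    next
      fix X \<nu> assume X: "?st \<nu> X"
      let ?t = "s (Suc \<nu>)"
      have t: "?t = s \<nu> / b" using b0 by (simp add: s_def powr_diff powr_minus powr_add field_simps)
      have s0: "0 < s \<nu>" using b0 by (simp add: s_def)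
      have st: "s \<nu> / 2 \<le> s \<nu> - ?t" 
      proof -
        have "s \<nu> / b \<le> s \<nu> / 2" using s0 b by (intro divide_left_mono) auto
        then show ?thesis using t by linarith
      qed
      have "\<exists>u' e' Y'. kam_state \<omega> (\<lambda>i z. PP \<nu> i z + (\<Sum>k\<in>shell b \<nu>. q i k * ee k z)) ?t (\<gamma> \<nu> + 2 * (c1 * D \<nu>)) (\<epsilon> (Suc \<nu>)) u' e' Y' \<and>
        (\<forall>i. wle 0 (2 * (c1 * D \<nu>)) (\<lambda>k. u' i k - fst X i k) \<and> wle 0 (2 * (c1 * D \<nu>)) (knm (\<lambda>k. u' i k - fst X i k)) \<and>
        \<bar>Y' $ i - snd (snd X) $ i\<bar> \<le> \<epsilon> \<nu> \<and> (\<forall>x. norm (fser (fst (snd X) i) (cvec x) - complex_of_real (Y' $ i - snd (snd X) $ i)) \<le> norm \<omega> * (c1 * D \<nu>)))"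
      proof (rule kam_step[OF X _ C])
        show "PP \<nu> i (cvec x) \<in> \<real>" for x i
          unfolding PP_def by (rule trig_real[OF qh finite_low low_minus])
        show "(\<Sum>k\<in>shell b \<nu>. q i k * ee k (cvec x)) \<in> \<real>" for x i
          by (rule trig_real[OF qh finite_shell shell_minus])
        show "0 < ?t" using b0 by (simp add: s_def)
        show "?t < s \<nu>" using st s0 by linarith
        have "real b powr (- real \<nu>) \<le> real b powr 0" using b by (intro powr_mono) auto
        then show "s \<nu> \<le> 1" using b0 by (simp add: s_def)
        show "\<bar>\<omega> $ i\<bar> \<le> norm \<omega>" for i by (rule abs_component_le)
        show "finite (shell b \<nu>)" by (rule finite_shell)
        show "C * (s \<nu> - ?t) powr (- \<tau> - 1) * \<epsilon> \<nu> \<le> c1 * D \<nu>"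
        proof -
          have "(s \<nu> - ?t) powr (- (\<tau> + 1)) \<le> (s \<nu> / 2) powr (- (\<tau> + 1))"
            using st s0 \<tau> by (intro powr_mono2') auto
          also have "\<dots> = real b powr (real \<nu> * (\<tau> + 1)) * 2 powr (\<tau> + 1)"
          proof -
            have "s \<nu> powr (- (\<tau> + 1)) = real b powr (real \<nu> * (\<tau> + 1))" by (simp add: s_def powr_powr algebra_simps)
            then show ?thesis by (simp only: powr_divide powr_minus_divide[of 2] divide_divide_eq_right div_by_1)
          qed
          finally have "C * (s \<nu> - ?t) powr (- \<tau> - 1) * \<epsilon> \<nu> \<le>
              C * (real b powr (real \<nu> * (\<tau> + 1)) * 2 powr (\<tau> + 1)) * \<epsilon> \<nu>"
            using C0 \<epsilon>D(2) by (intro mult_right_mono mult_left_mono) auto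
          also have "\<dots> = c1 * (real b powr (real \<nu> * (\<tau> + 1)) * real b powr (- real \<nu> * (\<tau> + 1))) * D \<nu>"
            by (simp add: c1_def \<epsilon>_def mult_ac)
          also have "real b powr (real \<nu> * (\<tau> + 1)) * real b powr (- real \<nu> * (\<tau> + 1)) = 1"
            using b0 by (simp add: powr_add[symmetric])
          finally show ?thesis by simp
        qed
        have "n * (c1 * D \<nu>) \<le> n * (\<eta> / 2)" using n by (intro mult_left_mono c1D) auto
        also have "n * (\<eta> / 2) = n * \<eta> / 2" by simp
        finally show "real CARD('n) * (c1 * D \<nu>) \<le> 1 / 4" using \<eta>n unfolding n_def by linarith
        show "\<gamma> \<nu> \<le> 1 / 4" using \<gamma>\<eta>[of \<nu>] \<eta>4 by simp
        show "\<gamma> \<nu> + 2 * (c1 * D \<nu>) \<le> 1 / 2" using \<gamma>\<eta>[of "Suc \<nu>"] \<eta>4 by (simp add: \<gamma>Suc)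
        show "?t * kn k \<le> 1" if "k \<in> shell b \<nu>" for k :: "int ^ 'n"
        proof -
          have "kn k \<le> real b powr real \<nu>" using that b0 by (simp add: shell_iff powr_realpow)
          then have "?t * kn k \<le> ?t * real b powr real \<nu>" using b0 by (intro mult_left_mono) (auto simp: s_def)
          also have "\<dots> = real b powr (- 1)" unfolding s_def powr_add[symmetric] by simp
          also have "\<dots> \<le> real b powr 0" using b by (intro powr_mono) auto
          finally show ?thesis using b0 by simp
        qed
        show "sqrt (\<Sum>k\<in>shell b \<nu>. (norm (q i k))\<^sup>2) \<le> real b powr ((\<tau> + 1) - real \<nu> * (\<tau> + 1)) * \<pi> \<nu>" for i
        proof -
          have "(\<Sum>k\<in>shell b \<nu>. (norm (q i k))\<^sup>2) = (\<Sum>k\<in>shell b \<nu>. (norm (p k $ i))\<^sup>2)"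
            using zero_notin_shell[of b \<nu>] b by (intro sum.cong) (auto simp: q_def)
          then show ?thesis using shell_l2_le[OF b, of "\<tau> + 1" p i \<nu>] \<tau> by (simp add: \<pi>_def)
        qed
        let ?x = "real b powr (- real \<nu> * (\<tau> + 1))"
        have pB: "real b powr ((\<tau> + 1) - real \<nu> * (\<tau> + 1)) = B * ?x"
          unfolding B_def powr_add[symmetric] by (rule arg_cong[where f = "\<lambda>z. real b powr z"]) simp
        have eS: "\<epsilon> (Suc \<nu>) = ?x / B * D (Suc \<nu>)"
        proof -
          have "real b powr (- real (Suc \<nu>) * (\<tau> + 1)) = ?x / B"
            unfolding B_def powr_diff[symmetric] by (rule arg_cong[where f = "\<lambda>z. real b powr z"]) (simp add: algebra_simps)
          then show ?thesis by (simp only: \<epsilon>_def)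
        qed
        \<comment> \<open>Up to the common scale \<open>?x / B\<close> the old error is multiplied
          by \<open>K * (2 * (c1 * D \<nu>) + \<gamma> \<nu>) \<le> 1 / 2\<close>. The factor
          \<open>B\<close> inside \<open>K\<close> is the price of rescaling to the next
          strip.\<close>
        have "S * (2 * (n * (c1 * D \<nu>)) * \<epsilon> \<nu> + n * \<gamma> \<nu> * \<epsilon> \<nu> + 2 * exp (4 * n) * (B * ?x * \<pi> \<nu>)) =
            ?x / B * (K * (2 * (c1 * D \<nu>) + \<gamma> \<nu>) * D \<nu> + c3 * \<pi> \<nu>)"
          using B by (simp add: \<epsilon>_def K_def c3_def field_simps)
        also have "\<dots> \<le> ?x / B * (1 / 2 * D \<nu> + c3 * \<pi> \<nu>)"
        proof (intro mult_left_mono add_right_mono mult_right_mono D0)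
          have "K * (2 * (c1 * D \<nu>) + \<gamma> \<nu>) \<le> K * (\<eta> + \<eta>)"
            using K c1D[of \<nu>] \<gamma>\<eta>[of \<nu>] by (intro mult_left_mono) auto
          then show "K * (2 * (c1 * D \<nu>) + \<gamma> \<nu>) \<le> 1 / 2" using \<eta>K by (simp add: algebra_simps)
        qed (use B in auto)
        also have "\<dots> = \<epsilon> (Suc \<nu>)" by (simp add: eS D)
        finally show "sqrt (card (signs :: (real ^ 'n) set)) * (noff TYPE('n) *
          (2 * (real CARD('n) * (c1 * D \<nu>)) * \<epsilon> \<nu> + real CARD('n) * \<gamma> \<nu> * \<epsilon> \<nu> + 2 * exp (4 * real CARD('n)) *
            (real b powr ((\<tau> + 1) - real \<nu> * (\<tau> + 1)) * \<pi> \<nu>))) \<le> \<epsilon> (Suc \<nu>)"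
          unfolding pB by (simp only: S_def n_def mult.assoc)
      qed
      moreover have "(\<lambda>i z. PP \<nu> i z + (\<Sum>k\<in>shell b \<nu>. q i k * ee k z)) = PP (Suc \<nu>)"
        unfolding PP_def low_Suc using low_disjoint[of b \<nu>] b
        by (subst sum.union_disjoint) (auto simp: finite_low finite_shell)
      ultimately obtain u' e' Y' where "?st (Suc \<nu>) (u', e', Y') \<and> ?rel \<nu> X (u', e', Y')"
        unfolding \<gamma>Suc by (elim exE) simp
      then show "\<exists>X'. ?st (Suc \<nu>) X' \<and> ?rel \<nu> X X'" by blast
    qed
    then obtain X where X: "\<And>\<nu>. ?st \<nu> (X \<nu>)" "\<And>\<nu>. ?rel \<nu> (X \<nu>) (X (Suc \<nu>))" by blast
    have sD: "summable D"
      by (rule summableI_nonneg_bounded[where x = "2 * (c3 * \<epsilon>0)"]) (use D0 Dsum in auto)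
    have "\<exists>v Z. (\<forall>i. (\<exists>A. wle 0 A (v i)) \<and> wle 0 \<eta> (knm (v i)) \<and> herm (v i)) \<and>
     (\<forall>x i. fser (dcoef \<omega> (v i)) (cvec x) = fser (q i) (cvec (x + rvec v x)) - complex_of_real (Z $ i))"
    proof (rule kam_limit[OF b A])
      show "kam_state \<omega> (\<lambda>i z. \<Sum>k\<in>low b \<nu>. q i k * ee k z) (s \<nu>) (\<gamma> \<nu>) (\<epsilon> \<nu>) (fst (X \<nu>)) (fst (snd (X \<nu>))) (snd (snd (X \<nu>)))" for \<nu>
        using X(1)[of \<nu>] unfolding PP_def .
      show "wle 0 (2 * (c1 * D \<nu>)) (\<lambda>k. fst (X (Suc \<nu>)) i k - fst (X \<nu>) i k)" for \<nu> i using X(2)[of \<nu>] by blast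
      show "wle 0 (2 * (c1 * D \<nu>)) (knm (\<lambda>k. fst (X (Suc \<nu>)) i k - fst (X \<nu>) i k))" for \<nu> i using X(2)[of \<nu>] by blast
      show "\<bar>snd (snd (X (Suc \<nu>))) $ i - snd (snd (X \<nu>)) $ i\<bar> \<le> \<epsilon> \<nu>" for \<nu> i using X(2)[of \<nu>] by blast
      show "norm (fser (fst (snd (X \<nu>)) i) (cvec x) - complex_of_real (snd (snd (X (Suc \<nu>))) $ i - snd (snd (X \<nu>)) $ i))
         \<le> norm \<omega> / 2 * (2 * (c1 * D \<nu>))" for \<nu> i x using X(2)[of \<nu>] by simp
      show "summable (\<lambda>\<nu>. 2 * (c1 * D \<nu>))" by (intro summable_mult sD)
      show "summable \<epsilon>" by (rule summable_comparison_test'[OF sD]) (use \<epsilon>D in auto)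
    qed (use \<gamma>\<eta> in \<open>auto simp: q_def s_def\<close>)
    then obtain v Z where v: "\<And>i. \<exists>A. wle 0 A (v i)" "\<And>i. wle 0 \<eta> (knm (v i))" "\<And>i. herm (v i)"
      and eq: "\<And>x i. fser (dcoef \<omega> (v i)) (cvec x) = fser (q i) (cvec (x + rvec v x)) - complex_of_real (Z $ i)"
      by blast
    from v(1) obtain A' where A': "\<And>i. wle 0 (A' i) (v i)" by metis
    have \<eta>2: "real CARD('n) * \<eta> \<le> 1 / 2" using \<eta>n by (simp add: n_def)
    note sd = small_displacement_rvec[OF A' v(2) \<eta>2]
    show ?thesis
    proof (rule small_displacement.KAM_appliesI[OF sd(1)])
      fix x
      show "Blinfun (\<lambda>h. \<chi> j. Re (fser (dcoef h (v j)) (cvec x))) \<omega> = P (x + rvec v x) - Z"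
        unfolding sd(2) eq qP by (simp add: vec_eq_iff)
    qed
  qed
  then show ?thesis using \<epsilon>0 by blast
qed

section \<open>The one-dimensional case\<close>

lemma freq_add: "freq (k + l) x = freq k x + freq l x"
  by (simp add: freq_def algebra_simps sum.distrib)

lemma freq_axis: "freq (axis i m) x = of_int m * x $ i"
proof -
  have "freq (axis i m) x = (\<Sum>j\<in>UNIV. if j = i then of_int m * x $ i else 0)"
    unfolding freq_def by (intro sum.cong) (auto simp: axis_def)
  then show ?thesis by simp
qed

text \<open>With a negative exponent the divisors would tend to infinity with \<open>k\<close>, whereas
  \<open>q \<omega>\<^sub>i - p \<omega>\<^sub>j\<close> is at most \<open>\<bar>\<omega>\<^sub>j\<bar>\<close> for suitable \<open>p\<close> and every \<open>q\<close>.\<close>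
lemma diophantine_neg_imp_one_dim:
  fixes \<omega> :: "real ^ 'n"
  assumes "diophantine \<tau> \<omega>" "\<tau> < 0"
  shows "i = (j :: 'n)"
proof (rule ccontr)
  assume ij: "i \<noteq> j"
  obtain \<alpha> where \<alpha>: "0 < \<alpha>" "\<And>k. k \<noteq> 0 \<Longrightarrow> \<alpha> * kn k powr (- \<tau>) \<le> \<bar>freq k \<omega>\<bar>"
    using assms(1) unfolding diophantine_def kn_def by auto
  have nz: "\<omega> $ j \<noteq> 0"
  proof -
    have k: "axis j 1 \<noteq> (0 :: int ^ 'n)" by (simp add: axis_eq_0_iff)
    have "0 < \<alpha> * kn (axis j 1 :: int ^ 'n) powr (- \<tau>)" using \<alpha>(1) kn_ge_1[OF k] by simp
    then show ?thesis using \<alpha>(2)[OF k] by (auto simp: freq_axis)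
  qed
  have pos: "0 < \<bar>\<omega> $ j\<bar> / \<alpha> + 1" using \<alpha>(1) by (simp add: add_nonneg_pos)
  \<comment> \<open>Chosen so that \<open>\<alpha> * y powr (- \<tau>) = \<bar>\<omega> $ j\<bar> +
    \<alpha>\<close>, which exceeds what the divisor can reach.\<close>
  define y where "y = (\<bar>\<omega> $ j\<bar> / \<alpha> + 1) powr (1 / - \<tau>)"
  obtain q :: nat where q: "y < real q" using reals_Archimedean2 by blast
  have y1: "0 < y" unfolding y_def using pos by simp
  define p where "p = \<lfloor>real q * \<omega> $ i / \<omega> $ j\<rfloor>"
  define k :: "int ^ 'n" where "k = axis i (int q) + axis j (- p)"
  have "k $ i = int q" using ij by (simp add: k_def axis_def)
  then have kq: "real q \<le> kn k" using comp_le_kn[of k i] by simp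
  have k0: "k \<noteq> 0" using \<open>k $ i = int q\<close> q y1 by auto
  have "freq k \<omega> = (real q * \<omega> $ i / \<omega> $ j - of_int p) * \<omega> $ j"
    using nz by (simp add: k_def freq_add freq_axis field_simps)
  then have "\<bar>freq k \<omega>\<bar> = \<bar>real q * \<omega> $ i / \<omega> $ j - of_int p\<bar> * \<bar>\<omega> $ j\<bar>" by (simp add: abs_mult)
  also have "\<dots> \<le> 1 * \<bar>\<omega> $ j\<bar>"
  proof (rule mult_right_mono)
    show "\<bar>real q * \<omega> $ i / \<omega> $ j - of_int p\<bar> \<le> 1" unfolding p_def by linarith
  qed simp
  finally have "\<alpha> * kn k powr (- \<tau>) \<le> \<bar>\<omega> $ j\<bar>" using \<alpha>(2)[OF k0] by simp
  moreover have "y powr (- \<tau>) \<le> kn k powr (- \<tau>)" using q kq y1 assms(2) by (intro powr_mono2) auto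
  moreover have "y powr (- \<tau>) = \<bar>\<omega> $ j\<bar> / \<alpha> + 1"
    unfolding y_def powr_powr using assms(2) pos by simp
  ultimately have "\<alpha> * (\<bar>\<omega> $ j\<bar> / \<alpha> + 1) \<le> \<alpha> * kn k powr (- \<tau>)" "\<alpha> * kn k powr (- \<tau>) \<le> \<bar>\<omega> $ j\<bar>"
    using \<alpha>(1) by simp_all
  then have "\<alpha> * (\<bar>\<omega> $ j\<bar> / \<alpha> + 1) \<le> \<bar>\<omega> $ j\<bar>" by (rule order.trans)
  moreover have "\<alpha> * (\<bar>\<omega> $ j\<bar> / \<alpha> + 1) = \<bar>\<omega> $ j\<bar> + \<alpha>" using \<alpha>(1) by (simp add: distrib_left)
  ultimately show False using \<alpha>(1) by linarith
qed

lemma card_shell_one_dim: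
  assumes one: "\<And>i j :: 'n. i = j" and b: "1 \<le> b"
  shows "real (card (shell b \<nu> :: (int ^ 'n) set)) \<le> 3 * real b ^ \<nu>"
proof -
  obtain i0 :: 'n where True by blast
  have inj: "inj_on (\<lambda>k. k $ i0) (shell b \<nu> :: (int ^ 'n) set)"
    by (rule inj_onI) (metis one vec_eq_iff)
  have "(\<lambda>k. k $ i0) ` (shell b \<nu> :: (int ^ 'n) set) \<subseteq> {- int (b ^ \<nu>)..int (b ^ \<nu>)}"
  proof
    fix m assume "m \<in> (\<lambda>k. k $ i0) ` (shell b \<nu> :: (int ^ 'n) set)"
    then obtain k :: "int ^ 'n" where k: "m = k $ i0" "kn k \<le> real b ^ \<nu>" by (auto simp: shell_iff)
    then have "real_of_int \<bar>m\<bar> \<le> real_of_int (int (b ^ \<nu>))" using comp_le_kn[of k i0] by simp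
    then have "\<bar>m\<bar> \<le> int (b ^ \<nu>)" by (simp only: of_int_le_iff)
    then show "m \<in> {- int (b ^ \<nu>)..int (b ^ \<nu>)}" by auto
  qed
  then have "card (shell b \<nu> :: (int ^ 'n) set) \<le> card {- int (b ^ \<nu>)..int (b ^ \<nu>)}"
    by (subst card_image[OF inj, symmetric]) (rule card_mono, auto)
  also have "\<dots> = 2 * b ^ \<nu> + 1"
  proof -
    have "int (b ^ \<nu>) - - int (b ^ \<nu>) + 1 = int (2 * b ^ \<nu> + 1)" by simp
    then show ?thesis by (simp only: card_atLeastAtMost_int nat_int)
  qed
  also have "\<dots> \<le> 3 * b ^ \<nu>" using b by simp
  finally have "card (shell b \<nu> :: (int ^ 'n) set) \<le> 3 * b ^ \<nu>" .
  then have "real (card (shell b \<nu> :: (int ^ 'n) set)) \<le> real (3 * b ^ \<nu>)" by (simp only: of_nat_le_iff)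
  then show ?thesis by simp
qed

text \<open>Cauchy-Schwarz on a shell costs the root of its cardinality, of order
  \<open>b powr (\<nu> / 2)\<close>. The weight compensates this for \<open>r \<ge> 1 / 2\<close>,
  that is, for \<open>\<tau> \<ge> - 1 / 2\<close> when \<open>r = \<tau> + 1\<close>.\<close>

lemma l1_bound_one_dim:
  fixes p :: "int ^ 'n \<Rightarrow> complex ^ 'n"
  assumes one: "\<And>i j :: 'n. i = j" and b: "2 \<le> b" and r: "1 / 2 \<le> r"
    and N: "fourier_norm r b p \<le> ennreal \<epsilon>" "0 \<le> \<epsilon>"
  shows "wle 0 (sqrt 3 * real b powr r * \<epsilon>) (\<lambda>k. if k = 0 then 0 else p k $ i)"
  unfolding wle_def
proof safe
  fix F :: "(int ^ 'n) set" assume F: "finite F"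
  let ?f = "\<lambda>k. norm (p k $ i)"
  have b0: "0 < real b" using b by simp
  obtain m where m: "F - {0} \<subseteq> low b m"
    using low_eventually[OF b F] by (auto simp: eventually_sequentially)
  have "(\<Sum>k\<in>F. norm (if k = 0 then 0 else p k $ i) * exp (0 * kn k)) = sum ?f (F - {0})"
    using F by (intro sum.mono_neutral_cong_right) auto
  also have "\<dots> \<le> sum ?f (low b m)" by (rule sum_mono2[OF finite_low m]) simp
  also have "\<dots> = (\<Sum>\<nu><m. sum ?f (shell b \<nu>))"
  proof (induction m)
    case (Suc m)
    have "low b m \<inter> shell b m = ({} :: (int ^ 'n) set)" by (rule low_disjoint) (use b in simp)
    then show ?case using Suc by (simp add: low_Suc sum.union_disjoint finite_low finite_shell)
  qed (simp add: low_def)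
  also have "\<dots> \<le> (\<Sum>\<nu><m. sqrt 3 * real b powr r * shell_norm r b p \<nu>)"
  proof (intro sum_mono)
    fix \<nu>
    have "sum ?f (shell b \<nu>) = (\<Sum>k\<in>shell b \<nu>. \<bar>1\<bar> * \<bar>?f k\<bar>)" by simp
    also have "\<dots> \<le> L2_set (\<lambda>_. 1) (shell b \<nu> :: (int ^ 'n) set) * L2_set ?f (shell b \<nu>)" by (rule L2_set_mult_ineq)
    also have "\<dots> \<le> sqrt (3 * real b ^ \<nu>) * (real b powr (r - real \<nu> * r) * shell_norm r b p \<nu>)"
    proof (rule mult_mono)
      show "L2_set (\<lambda>_. 1) (shell b \<nu> :: (int ^ 'n) set) \<le> sqrt (3 * real b ^ \<nu>)"
        using card_shell_one_dim[OF one, of b \<nu>] b by (simp add: L2_set_def)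
      show "L2_set ?f (shell b \<nu>) \<le> real b powr (r - real \<nu> * r) * shell_norm r b p \<nu>"
        unfolding L2_set_def using r by (intro shell_l2_le b) simp
    qed auto
    also have "sqrt (3 * real b ^ \<nu>) = sqrt 3 * real b powr (real \<nu> / 2)"
      using b0 by (simp add: real_sqrt_mult powr_half_sqrt[symmetric] powr_realpow[symmetric] powr_powr)
    also have "sqrt 3 * real b powr (real \<nu> / 2) * (real b powr (r - real \<nu> * r) * shell_norm r b p \<nu>) =
        sqrt 3 * (real b powr (real \<nu> / 2) * real b powr (r - real \<nu> * r)) * shell_norm r b p \<nu>"
      by simp
    also have "\<dots> \<le> sqrt 3 * real b powr r * shell_norm r b p \<nu>"
    proof (intro mult_right_mono mult_left_mono shell_norm_nonneg)
      have "real \<nu> / 2 \<le> real \<nu> * r" using mult_left_mono[OF r, of "real \<nu>"] by simp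
      then show "real b powr (real \<nu> / 2) * real b powr (r - real \<nu> * r) \<le> real b powr r"
        unfolding powr_add[symmetric] using b by (intro powr_mono) auto
    qed auto
    finally show "sum ?f (shell b \<nu>) \<le> sqrt 3 * real b powr r * shell_norm r b p \<nu>" .
  qed
  also have "\<dots> = sqrt 3 * real b powr r * (\<Sum>\<nu><m. shell_norm r b p \<nu>)" by (simp add: sum_distrib_left)
  also have "\<dots> \<le> sqrt 3 * real b powr r * \<epsilon>"
    by (intro mult_left_mono sum_shell_norm_le N) auto
  finally show "(\<Sum>k\<in>F. norm (if k = 0 then 0 else p k $ i) * exp (0 * kn k)) \<le> sqrt 3 * real b powr r * \<epsilon>" .
qed

text \<open>The derivative of \<open>inv \<Psi>\<close> is the inverse of \<open>D\<close>, so
  pulling back by \<open>inv \<Psi>\<close> means applying \<open>D\<close> itself: the condition is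
  pointwise and contains no composition.\<close>

lemma (in small_displacement) KAM_applies_invI:
  assumes "\<And>z. X z + V' z (X z) = \<omega>" "\<And>z. X z = \<omega> + P z - Y"
  shows "KAM_applies \<omega> P"
  unfolding KAM_applies_def
proof (intro exI conjI)
  have inv: "inv (inv \<Psi>) = \<Psi>" by (rule inv_inv_eq[OF bij_\<Psi>])
  show "torus_C1_diffeo (inv \<Psi>)"
    unfolding torus_C1_diffeo_def inv
    using bij_imp_bij_inv[OF bij_\<Psi>] C1_\<Psi> C1_inv lattice[of "inv \<Psi> x" "inv \<Psi> y" for x y] by simp
  show "pullback (inv \<Psi>) (\<lambda>x. \<omega> + P x - Y) = (\<lambda>x. \<omega>)"
  proof
    fix x
    let ?z = "inv \<Psi> x"
    have "bij (D ?z)" using nearD(2)[of ?z] by (simp add: D_def[abs_def])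
    then have "inv (inv (D ?z)) = D ?z" by (rule inv_inv_eq)
    moreover have "frechet_derivative (inv \<Psi>) (at x) = inv (D ?z)"
      using frechet_derivative_at[OF deriv_inv] by simp
    ultimately show "pullback (inv \<Psi>) (\<lambda>x. \<omega> + P x - Y) x = \<omega>"
      using assms(1)[of ?z] by (simp add: pullback_def D_def assms(2)[symmetric])
  qed
qed

text \<open>In one dimension the inverse \<open>\<Theta>\<close> of the conjugacy satisfies \<open>\<Theta>' = 1 / (1 + g - y)\<close>; the constant \<open>y\<close>
  is chosen by the intermediate value theorem such that \<open>\<Theta>'\<close> has mean 1.\<close>
lemma periodic_reparametrization:
  fixes g :: "real \<Rightarrow> real"
  assumes g: "continuous_on UNIV g" "\<And>t. \<bar>g t\<bar> \<le> 1 / 8" "\<And>t. g (t + 2 * pi) = g t"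
  shows "\<exists>y V. \<bar>y\<bar> \<le> 1 / 8 \<and> (\<forall>t. (V has_real_derivative (1 / (1 + g t - y) - 1)) (at t)) \<and>
     (\<forall>t. V (t + 2 * pi) = V t)"
proof -
  define h where "h y t = 1 / (1 + g t - y)" for y t
  define I where "I y = integral {0..2 * pi} (h y)" for y
  have pos: "0 < 1 + g t - y" if "\<bar>y\<bar> \<le> 1 / 8" for y t using g(2)[of t] that by linarith
  have gb: "- (1 / 8) \<le> g t" "g t \<le> 1 / 8" for t using g(2)[of t] by (auto simp: abs_le_iff)
  have hc: "continuous_on UNIV (h y)" if "\<bar>y\<bar> \<le> 1 / 8" for y
    unfolding h_def using pos[OF that] by (intro continuous_intros g) (auto simp: less_imp_neq[symmetric])
  have hi: "h y integrable_on {0..2 * pi}" if "\<bar>y\<bar> \<le> 1 / 8" for y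
    using hc[OF that] by (intro integrable_continuous_real) (rule continuous_on_subset, auto)
  have "continuous_on {-1/8..1/8} I"
  proof -
    have "continuous_on ({-1/8..1/8} \<times> cbox 0 (2 * pi)) (\<lambda>(y, t). h y t)"
    proof -
      have "continuous_on ({-1/8..1/8} \<times> cbox 0 (2 * pi)) (\<lambda>x. 1 / (1 + g (snd x) - fst x))"
      proof (intro continuous_intros)
        show "continuous_on ({-1/8..1/8} \<times> cbox 0 (2 * pi)) (\<lambda>x. g (snd x))"
          by (rule continuous_on_compose2[OF g(1)]) (auto intro: continuous_intros)
        show "\<forall>x\<in>{- 1 / 8..1 / 8} \<times> cbox 0 (2 * pi). 1 + g (snd x) - fst x \<noteq> 0"
        proof
          fix x :: "real \<times> real" assume "x \<in> {- 1 / 8..1 / 8} \<times> cbox 0 (2 * pi)"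
          then have "\<bar>fst x\<bar> \<le> 1 / 8" by (auto simp: abs_le_iff)
          then show "1 + g (snd x) - fst x \<noteq> 0" using pos[of "fst x" "snd x"] by simp
        qed
      qed
      then show ?thesis by (simp add: h_def case_prod_unfold)
    qed
    from integral_continuous_on_param[OF this] show ?thesis by (simp add: I_def[abs_def])
  qed
  \<comment> \<open>At either end of the range of \<open>y\<close> the integrand lies on one side of
    1, because \<open>\<bar>g t\<bar> \<le> 1 / 8\<close>.\<close>
  moreover have "I (-1/8) \<le> 2 * pi"
  proof -
    have "I (-1/8) \<le> integral {0..2 * pi} (\<lambda>_. 1)"
      unfolding I_def
    proof (intro integral_le hi)
      show "h (-1/8) t \<le> 1" for t using gb(1)[of t] by (simp add: h_def divide_le_eq_1)
    qed auto
    then show ?thesis by simp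
  qed
  moreover have "2 * pi \<le> I (1/8)"
  proof -
    have "integral {0..2 * pi} (\<lambda>_. 1) \<le> I (1/8)"
      unfolding I_def
    proof (intro integral_le hi)
      show "1 \<le> h (1/8) t" for t using gb[of t] by (simp add: h_def le_divide_eq_1)
    qed auto
    then show ?thesis by simp
  qed
  ultimately obtain y where y: "-1/8 \<le> y" "y \<le> 1/8" "I y = 2 * pi"
    using IVT'[of I "-1/8" "2 * pi" "1/8"] by auto
  have y8: "\<bar>y\<bar> \<le> 1 / 8" using y by (auto simp: abs_le_iff)
  \<comment> \<open>The infinite end points make the antiderivative global, as needed for comparing
    \<open>V\<close> at \<open>t\<close> and \<open>t + 2 * pi\<close>.\<close>
  have "\<exists>V. \<forall>x. - \<infinity> < ereal x \<longrightarrow> ereal x < \<infinity> \<longrightarrow> (V has_vector_derivative (h y x - 1)) (at x)"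
    using hc[OF y8] by (intro einterval_antiderivative) (auto simp: continuous_on_eq_continuous_at intro!: continuous_intros)
  then obtain V where V: "\<And>t. (V has_real_derivative (h y t - 1)) (at t)"
    by (auto simp: has_real_derivative_iff_has_vector_derivative)
  have V0: "V (2 * pi) - V 0 = 0"
  proof -
    have "((\<lambda>t. h y t - 1) has_integral (V (2 * pi) - V 0)) {0..2 * pi}"
      by (rule fundamental_theorem_of_calculus)
         (auto simp: has_real_derivative_iff_has_vector_derivative[symmetric] intro: has_field_derivative_at_within V)
    then have "I y - 2 * pi = V (2 * pi) - V 0"
    proof (rule has_integral_unique[rotated])
      show "((\<lambda>t. h y t - 1) has_integral (I y - 2 * pi)) {0..2 * pi}"
      proof (rule has_integral_diff)
        show "(h y has_integral I y) {0..2 * pi}" unfolding I_def using hi[OF y8] by (rule integrable_integral)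
        show "((\<lambda>t. 1) has_integral 2 * pi) {0..2 * pi}"
          using has_integral_const_real[of "1 :: real" 0 "2 * pi"] by (simp only: content_real real_scaleR_def) simp
      qed
    qed
    then show ?thesis using y(3) by simp
  qed
  have "V (t + 2 * pi) = V t" for t
  proof -
    \<comment> \<open>The difference is constant by periodicity of \<open>g\<close>, and it is 0 at
      \<open>t = 0\<close> because \<open>h y\<close> has mean 1.\<close>
    have "((\<lambda>t. V (t + 2 * pi) - V t) has_real_derivative 0) (at x)" for x
    proof -
      have "((\<lambda>t. V (t + 2 * pi)) has_real_derivative (h y (x + 2 * pi) - 1)) (at x)"
        using V[of "x + 2 * pi"] by (simp add: DERIV_shift)
      from DERIV_diff[OF this V[of x]] show ?thesis by (simp add: h_def g(3))
    qed
    then have "V (t + 2 * pi) - V t = V (0 + 2 * pi) - V 0"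
      using DERIV_isconst_all[of "\<lambda>t. V (t + 2 * pi) - V t" t 0] by blast
    then show ?thesis using V0 by simp
  qed
  then show ?thesis using V y8 unfolding h_def by blast
qed

text \<open>\<open>one\<close> says that the index type has a single element, so the coordinate
  \<open>i0\<close> identifies the torus with a circle.\<close>

lemma kam_one_dim:
  fixes \<omega> :: "real ^ 'n" and P :: "real ^ 'n \<Rightarrow> real ^ 'n"
  assumes one: "\<And>i j :: 'n. i = j" and w: "\<omega> $ i0 \<noteq> 0"
    and P: "continuous_on UNIV P" "\<And>x. \<bar>P x $ i0\<bar> \<le> \<bar>\<omega> $ i0\<bar> / 8" "\<And>x v. v \<in> period_lattice \<Longrightarrow> P (x + v) = P x"
  shows "KAM_applies \<omega> P"
proof -
  define c :: "real \<Rightarrow> real ^ 'n" where "c t = (\<chi> i. t)" for t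
  have cx: "c (x $ i0) = x" for x by (simp add: c_def vec_eq_iff) (metis one)
  define g where "g t = P (c t) $ i0 / \<omega> $ i0" for t
  have gc: "continuous_on UNIV g"
    unfolding g_def using w
    by (intro continuous_intros continuous_on_compose2[OF P(1)]) (auto simp: c_def[abs_def] intro!: continuous_intros continuous_on_vec_lambda)
  have g8: "\<bar>g t\<bar> \<le> 1 / 8" for t
    using P(2)[of "c t"] w by (simp add: g_def divide_simps)
  have gp: "g (t + 2 * pi) = g t" for t
  proof -
    have "c (2 * pi) \<in> period_lattice"
      unfolding period_lattice_def by (rule image_eqI[where x = "\<chi> i. 1"]) (simp_all add: c_def)
    moreover have "c (t + 2 * pi) = c t + c (2 * pi)" by (simp add: c_def vec_eq_iff)
    ultimately show ?thesis by (simp add: g_def P(3))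
  qed
  obtain y V where y: "\<bar>y\<bar> \<le> 1 / 8" and V: "\<And>t. (V has_real_derivative (1 / (1 + g t - y) - 1)) (at t)"
    and Vp: "\<And>t. V (t + 2 * pi) = V t"
    using periodic_reparametrization[OF gc g8 gp] by blast
  have Vpn: "V (t + 2 * pi * real m) = V t" for t m
  proof (induction m arbitrary: t)
    case (Suc m)
    have "V (t + 2 * pi * real (Suc m)) = V ((t + 2 * pi * real m) + 2 * pi)" by (simp add: algebra_simps)
    then show ?case using Vp Suc by simp
  qed simp
  have Vpi: "V (t + 2 * pi * of_int m) = V t" for t m
  proof (cases "0 \<le> m")
    case True
    then show ?thesis using Vpn[of t "nat m"] by simp
  next
    case False
    then show ?thesis using Vpn[of "t + 2 * pi * of_int m" "nat (- m)"] by simp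
  qed
  define d where "d t = 1 / (1 + g t - y) - 1" for t
  have den: "3 / 4 \<le> 1 + g t - y" "1 + g t - y \<le> 5 / 4" for t using g8[of t] y by (auto simp: abs_le_iff)
  have d2: "\<bar>d t\<bar> \<le> 1 / 2" for t
  proof -
    have "1 / (1 + g t - y) \<le> 1 / (3 / 4)" using den(1)[of t] by (intro divide_left_mono) auto
    moreover have "1 / (5 / 4) \<le> 1 / (1 + g t - y)" using den[of t] by (intro divide_left_mono) auto
    moreover define u where "u = 1 / (1 + g t - y)"
    ultimately have "u \<le> 1 / (3 / 4)" "1 / (5 / 4) \<le> u" by simp_all
    then have "\<bar>u - 1\<bar> \<le> 1 / 2" unfolding abs_le_iff by simp
    then show ?thesis by (simp only: d_def u_def)
  qed
  have dc: "continuous_on UNIV d"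
  proof -
    have "1 + g t - y \<noteq> 0" for t using den(1)[of t] by linarith
    then show ?thesis unfolding d_def by (intro continuous_intros gc) auto
  qed
  define W where "W x = c (V (x $ i0))" for x
  define W' :: "real ^ 'n \<Rightarrow> (real ^ 'n) \<Rightarrow>\<^sub>L (real ^ 'n)"
    where "W' x = Blinfun (\<lambda>h. d (x $ i0) *\<^sub>R h)" for x
  have app: "blinfun_apply (W' x) = (\<lambda>h. d (x $ i0) *\<^sub>R h)" for x
    unfolding W'_def by (rule bounded_linear_Blinfun_apply) (rule bounded_linear_scaleR_right)
  interpret small_displacement W W'
  proof
    show "(W has_derivative blinfun_apply (W' x)) (at x)" for x
      unfolding app
    proof (rule has_derivative_componentwise_within[THEN iffD2], rule ballI)
      fix e :: "real ^ 'n" assume "e \<in> Basis"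
      then obtain j where e: "e = axis j 1" by (auto simp: Basis_vec_def)
      have j: "j = i0" by (rule one)
      have "((\<lambda>x. V (x $ i0)) has_derivative (\<lambda>h. d (x $ i0) * h $ i0)) (at x)"
        using has_derivative_compose[OF bounded_linear_imp_has_derivative[OF bounded_linear_vec_nth, of i0 "at x"] V[of "x $ i0", unfolded has_field_derivative_def]]
        by (simp add: d_def)
      then show "((\<lambda>x. W x \<bullet> e) has_derivative (\<lambda>h. (d (x $ i0) *\<^sub>R h) \<bullet> e)) (at x)"
        by (simp add: e inner_axis W_def c_def j)
    qed
    show "continuous_on UNIV W'"
    proof (rule continuous_on_blinfun_componentwise)
      fix e :: "real ^ 'n"
      have "continuous_on UNIV (\<lambda>x :: real ^ 'n. d (x $ i0))"
        by (rule continuous_on_compose2[OF dc]) (auto intro!: continuous_intros)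
      then show "continuous_on UNIV (\<lambda>x. W' x e)" unfolding app by (intro continuous_intros)
    qed
    show "norm (W' x) \<le> 1 / 2" for x
    proof (rule norm_blinfun_bound)
      show "norm (W' x h) \<le> 1 / 2 * norm h" for h
        unfolding app norm_scaleR by (rule mult_right_mono[OF d2]) simp
    qed simp
    show "W (x + v) = W x" if "v \<in> period_lattice" for x v
      using that Vpi by (auto simp: W_def period_lattice_def)
  qed
  show ?thesis
  proof (rule KAM_applies_invI)
    fix z
    \<comment> \<open>With \<open>Y = c (\<omega> $ i0 * y)\<close> the field is
      \<open>\<omega> $ i0\<close> times \<open>?u\<close>, the reciprocal of the derivative of
      \<open>id + V\<close>, so their product is constant.\<close>
    let ?X = "\<omega> + P z - c (\<omega> $ i0 * y)"
    let ?u = "1 + g (z $ i0) - y"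
    have X: "?X $ i0 = \<omega> $ i0 * ?u"
      using w by (simp add: g_def cx) (simp add: c_def field_simps)
    have "(?X + W' z ?X) $ i0 = (1 + d (z $ i0)) * ?X $ i0"
      by (simp only: app vector_add_component vector_scaleR_component real_scaleR_def distrib_right mult_1_left)
    also have "\<dots> = 1 / ?u * (\<omega> $ i0 * ?u)"
      unfolding X by (simp only: d_def add_diff_cancel_left' add_diff_eq)
    also have "\<dots> = \<omega> $ i0" using den(1)[of "z $ i0"] by simp
    finally have "(?X + W' z ?X) $ i0 = \<omega> $ i0" .
    then show "?X + W' z ?X = \<omega>" by (simp add: vec_eq_iff) (metis one)
  qed simp
qed

lemma kam_neg:
  fixes \<omega> :: "real ^ 'n" and \<tau> :: real and b :: nat
  assumes dio: "diophantine \<tau> \<omega>" and \<tau>: "- 1 / 2 \<le> \<tau>" "\<tau> < 0" and b: "2 \<le> b"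
  shows "\<exists>\<epsilon>>0. \<forall>(P :: real ^ 'n \<Rightarrow> real ^ 'n) (p :: int ^ 'n \<Rightarrow> complex ^ 'n).
           is_fourier_series P p \<and> fourier_norm (\<tau> + 1) b p \<le> ennreal \<epsilon> \<longrightarrow> KAM_applies \<omega> P"
proof -
  have one: "i = j" for i j :: 'n by (rule diophantine_neg_imp_one_dim[OF dio \<tau>(2)])
  obtain i0 :: 'n where True by blast
  have w: "\<omega> $ i0 \<noteq> 0"
  proof -
    obtain \<alpha> where \<alpha>: "0 < \<alpha>" "\<And>k. k \<noteq> 0 \<Longrightarrow> \<alpha> * kn k powr (- \<tau>) \<le> \<bar>freq k \<omega>\<bar>"
      using dio unfolding diophantine_def kn_def by auto
    have k: "axis i0 1 \<noteq> (0 :: int ^ 'n)" by (simp add: axis_eq_0_iff)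
    have "0 < \<alpha> * kn (axis i0 1 :: int ^ 'n) powr (- \<tau>)" using \<alpha>(1) kn_ge_1[OF k] by simp
    then show ?thesis using \<alpha>(2)[OF k] by (auto simp: freq_axis)
  qed
  define M where "M = sqrt 3 * real b powr (\<tau> + 1)"
  have M: "0 < M" using b by (simp add: M_def)
  \<comment> \<open>\<open>M * \<epsilon>\<close> equals
    \<open>\<bar>\<omega> $ i0\<bar> / 8\<close>, the sup bound that \<open>kam_one_dim\<close> asks
    for.\<close>
  define \<epsilon> where "\<epsilon> = \<bar>\<omega> $ i0\<bar> / (8 * M)"
  have \<epsilon>: "0 < \<epsilon>" using w M by (simp add: \<epsilon>_def)
  have "KAM_applies \<omega> P" if F: "is_fourier_series P p" and N: "fourier_norm (\<tau> + 1) b p \<le> ennreal \<epsilon>"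
    for P :: "real ^ 'n \<Rightarrow> real ^ 'n" and p :: "int ^ 'n \<Rightarrow> complex ^ 'n"
  proof (rule kam_one_dim[OF one w])
    let ?q = "\<lambda>i k. if k = 0 then 0 else p k $ i"
    have q: "wle 0 (M * \<epsilon>) (?q i)" for i
      unfolding M_def by (rule l1_bound_one_dim[OF one b _ N]) (use \<tau> \<epsilon> in auto)
    have Px: "P x $ i = Re (fser (?q i) (cvec x))" for x i
      using fourier_series_coeffs(2)[OF F, of i x] by simp
    have "P = (\<lambda>x. \<chi> i. Re (fser (?q i) (cvec x)))" by (auto simp: vec_eq_iff Px)
    then show "continuous_on UNIV P"
      by (elim ssubst) (intro continuous_on_vec_lambda continuous_on_Re continuous_on_fser[OF q])
    show "\<bar>P x $ i0\<bar> \<le> \<bar>\<omega> $ i0\<bar> / 8" for x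
    proof -
      have "\<bar>P x $ i0\<bar> \<le> M * \<epsilon>"
        unfolding Px using order.trans[OF abs_Re_le_cmod norm_fser_le[OF q[of i0], of "cvec x"]] by simp
      then show ?thesis using M by (simp add: \<epsilon>_def)
    qed
    show "P (x + v) = P x" if "v \<in> period_lattice" for x v
      using that by (simp add: vec_eq_iff Px fser_periodic)
  qed
  then show ?thesis using \<epsilon> by blast
qed

theorem mainTheorem1:
  fixes \<omega> :: "real ^ 'n" and \<tau> :: real and b :: nat
  assumes "diophantine \<tau> \<omega>" and "- 1 / 2 \<le> \<tau>" and "2 \<le> b"
  shows "\<exists>\<epsilon>>0. \<forall>(P :: real ^ 'n \<Rightarrow> real ^ 'n) (p :: int ^ 'n \<Rightarrow> complex ^ 'n).
           is_fourier_series P p \<and> fourier_norm (\<tau> + 1) b p \<le> ennreal \<epsilon> \<longrightarrow> KAM_applies \<omega> P"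
  using kam_neg[OF assms(1,2) _ assms(3)] kam_nonneg[OF assms(1) _ assms(3)] by (meson not_less)

end
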